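(* Let $M$ be a smooth $7$-manifold and let $\sigma\in\Omega^3_+(M)$ be a closed $\mathrm{G}_2$-structure, i.e. $d\sigma=0$. Then the scalar curvature of the associated metric $g_\sigma$ is non-positive, and it vanishes identically if and only if the entire Ricci tensor of $g_\sigma$ vanishes. Equivalently, the scalar curvature of $g_\sigma$ vanishes identically if and only if $d\sigma=d\ast_\sigma\sigma=0$.
   Context: On $\mathbb R^7$ with dual basis $e^1,\dots,e^7$ (write $e^{ijk}=e^i\wedge e^j\wedge e^k$) let $\phi = e^{123}+e^{145}+e^{167}+e^{246}-e^{257}-e^{347}-e^{356}$; $\mathrm{G}_2\subset GL(7,\mathbb R)$ is the stabilizer of $\phi$, and it preserves the standard metric and orientation of $\mathbb R^7$. A $3$-form $\sigma$ on a smooth $7$-manifold $M$ is definite, written $\sigma\in\Omega^3_+(M)$, if for each $x\in M$ there is a linear isomorphism $u:T_xM\to\mathbb R^7$ with $u^*\phi=\sigma_x$; a definite $3$-form is called a $\mathrm{G}_2$-structure. Pulling back the standard metric and orientation by such $u$ gives a well-defined associated metric $g_\sigma$, orientation, and Hodge star $\ast_\sigma$. *)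

theory Defs
  imports "HOL-Analysis.Analysis"
begin

subsection \<open>Smooth maps and smooth manifolds\<close>

(* C^k on an open set S: all iterated directional derivatives up to order k exist as
   Frechet derivatives, and those of order k are continuous. *)
primrec Ck_on ::
  "nat \<Rightarrow> 'a::real_normed_vector set \<Rightarrow> ('a \<Rightarrow> 'b::real_normed_vector) \<Rightarrow> bool" where
  "Ck_on 0 S f \<longleftrightarrow> continuous_on S f"
| "Ck_on (Suc k) S f \<longleftrightarrow>
     (\<forall>x\<in>S. f differentiable (at x)) \<and>
     (\<forall>v. Ck_on k S (\<lambda>x. frechet_derivative f (at x) v))"

definition smooth_on :: "'a::real_normed_vector set \<Rightarrow> ('a \<Rightarrow> 'b::real_normed_vector) \<Rightarrow> bool"
  where "smooth_on S f \<longleftrightarrow> (\<forall>k. Ck_on k S f)"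

(* A chart (U, \<psi>) has domain U; the values of \<psi> outside U are irrelevant. *)
type_synonym ('a, 'n) chart = "'a set \<times> ('a \<Rightarrow> real ^ 'n)"

definition chart_image :: "('a, 'n::finite) chart \<Rightarrow> (real ^ 'n) set"
  where "chart_image c = snd c ` fst c"

definition chart_inv :: "('a, 'n::finite) chart \<Rightarrow> real ^ 'n \<Rightarrow> 'a"
  where "chart_inv c = inv_into (fst c) (snd c)"

definition is_chart :: "'a topology \<Rightarrow> ('a, 'n::finite) chart \<Rightarrow> bool"
  where "is_chart M c \<longleftrightarrow>
     openin M (fst c) \<and> open (chart_image c) \<and>
     homeomorphic_map (subtopology M (fst c)) (top_of_set (chart_image c)) (snd c)"

(* The smooth structure is the one generated by the atlas A, which need not be maximal. *)
definition smooth_manifold :: "'a topology \<Rightarrow> ('a, 'n::finite) chart set \<Rightarrow> bool"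
  where "smooth_manifold M A \<longleftrightarrow>
     Hausdorff_space M \<and> second_countable M \<and>
     (\<forall>c\<in>A. is_chart M c) \<and> (\<Union>c\<in>A. fst c) = topspace M \<and>
     (\<forall>c\<in>A. \<forall>d\<in>A. smooth_on (snd c ` (fst c \<inter> fst d)) (snd d \<circ> chart_inv c))"

definition charts_at :: "('a, 'n::finite) chart set \<Rightarrow> 'a \<Rightarrow> ('a, 'n) chart set"
  where "charts_at A p = {c \<in> A. p \<in> fst c}"


subsection \<open>Tangent vectors and differential forms\<close>

(* A tangent vector at p is the family of its coordinate vectors in all charts at p, related
   by the derivatives of the transition maps; the value is fixed to be 0 on other charts.
   The vector space operations are pointwise. *)
type_synonym ('a, 'n) tvec = "('a, 'n) chart \<Rightarrow> real ^ 'n"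

definition tangent_space :: "('a, 'n::finite) chart set \<Rightarrow> 'a \<Rightarrow> ('a, 'n) tvec set"
  where "tangent_space A p =
     {X. (\<forall>c\<in>charts_at A p. \<forall>d\<in>charts_at A p.
            X d = frechet_derivative (snd d \<circ> chart_inv c) (at (snd c p)) (X c)) \<and>
         (\<forall>c. c \<notin> charts_at A p \<longrightarrow> X c = 0)}"

(* The tangent vector at p whose coordinate vector in the chart c is v. *)
definition chart_tvec ::
  "('a, 'n::finite) chart set \<Rightarrow> ('a, 'n) chart \<Rightarrow> 'a \<Rightarrow> real ^ 'n \<Rightarrow> ('a, 'n) tvec"
  where "chart_tvec A c p v = (\<lambda>d. if d \<in> charts_at A p
           then frechet_derivative (snd d \<circ> chart_inv c) (at (snd c p)) v else 0)"

definition tangent_iso ::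
  "('a, 'n::finite) chart set \<Rightarrow> 'a \<Rightarrow> (('a, 'n) tvec \<Rightarrow> real ^ 'n) \<Rightarrow> bool"
  where "tangent_iso A p u \<longleftrightarrow>
     bij_betw u (tangent_space A p) UNIV \<and>
     (\<forall>X\<in>tangent_space A p. \<forall>Y\<in>tangent_space A p. u (\<lambda>c. X c + Y c) = u X + u Y) \<and>
     (\<forall>X\<in>tangent_space A p. \<forall>a::real. u (\<lambda>c. a *\<^sub>R X c) = a *\<^sub>R u X)"

(* A k-form takes a point p and a list of k tangent vectors at p; its values on other
   lists are irrelevant. *)
type_synonym ('a, 'n) form = "'a \<Rightarrow> ('a, 'n) tvec list \<Rightarrow> real"

definition alternating_at ::
  "('a, 'n::finite) chart set \<Rightarrow> 'a \<Rightarrow> nat \<Rightarrow> (('a, 'n) tvec list \<Rightarrow> real) \<Rightarrow> bool"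
  where "alternating_at A p k \<alpha> \<longleftrightarrow>
     (\<forall>Xs. set Xs \<subseteq> tangent_space A p \<and> length Xs = k \<longrightarrow>
        (\<forall>i<k. \<forall>Y\<in>tangent_space A p. \<forall>Z\<in>tangent_space A p. \<forall>a b::real.
           \<alpha> (Xs[i := (\<lambda>c. a *\<^sub>R Y c + b *\<^sub>R Z c)]) =
           a * \<alpha> (Xs[i := Y]) + b * \<alpha> (Xs[i := Z])) \<and>
        (\<forall>i<k. \<forall>j<k. i \<noteq> j \<and> Xs ! i = Xs ! j \<longrightarrow> \<alpha> Xs = 0))"

definition local_form ::
  "('a, 'n::finite) chart set \<Rightarrow> ('a, 'n) chart \<Rightarrow> ('a, 'n) form \<Rightarrow>
   real ^ 'n \<Rightarrow> (real ^ 'n) list \<Rightarrow> real"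
  where "local_form A c \<omega> x vs =
     \<omega> (chart_inv c x) (map (chart_tvec A c (chart_inv c x)) vs)"

definition smooth_form ::
  "'a topology \<Rightarrow> ('a, 'n::finite) chart set \<Rightarrow> nat \<Rightarrow> ('a, 'n) form \<Rightarrow> bool"
  where "smooth_form M A k \<omega> \<longleftrightarrow>
     (\<forall>p\<in>topspace M. alternating_at A p k (\<omega> p)) \<and>
     (\<forall>c\<in>A. \<forall>vs. length vs = k \<longrightarrow>
        smooth_on (chart_image c) (\<lambda>x. local_form A c \<omega> x vs))"

(* Exterior derivative in coordinates, on constant vector fields v_0, ..., v_k:
   the alternating sum of (-1)^i D_{v_i} of \<omega>(v_0, ..., v_k) with v_i omitted. *)
definition ext_deriv ::
  "(real ^ 'n::finite \<Rightarrow> (real ^ 'n) list \<Rightarrow> real) \<Rightarrow> real ^ 'n \<Rightarrow> (real ^ 'n) list \<Rightarrow> real"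
  where "ext_deriv \<omega> x vs =
     (\<Sum>i<length vs. (-1) ^ i *
        frechet_derivative (\<lambda>y. \<omega> y (take i vs @ drop (Suc i) vs)) (at x) (vs ! i))"

definition closed_form :: "('a, 'n::finite) chart set \<Rightarrow> nat \<Rightarrow> ('a, 'n) form \<Rightarrow> bool"
  where "closed_form A k \<omega> \<longleftrightarrow>
     (\<forall>c\<in>A. \<forall>x\<in>chart_image c. \<forall>vs. length vs = Suc k \<longrightarrow>
        ext_deriv (local_form A c \<omega>) x vs = 0)"


subsection \<open>Curvature of a metric\<close>

(* The metric g p X Y is given on tangent vectors; metric_matrix is its matrix of
   components in the chart c at the point with coordinates x. *)
definition metric_matrix ::
  "('a, 'n::finite) chart set \<Rightarrow> ('a, 'n) chart \<Rightarrow>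
   ('a \<Rightarrow> ('a, 'n) tvec \<Rightarrow> ('a, 'n) tvec \<Rightarrow> real) \<Rightarrow> real ^ 'n \<Rightarrow> real ^ 'n ^ 'n"
  where "metric_matrix A c g x = (\<chi> i j.
     g (chart_inv c x) (chart_tvec A c (chart_inv c x) (axis i 1))
                       (chart_tvec A c (chart_inv c x) (axis j 1)))"

definition pderivative :: "'n::finite \<Rightarrow> (real ^ 'n \<Rightarrow> real) \<Rightarrow> real ^ 'n \<Rightarrow> real"
  where "pderivative i f x = frechet_derivative f (at x) (axis i 1)"

(* christoffel g k i j is the symbol with upper index k and lower indices i, j. *)
definition christoffel ::
  "(real ^ 'n::finite \<Rightarrow> real ^ 'n ^ 'n) \<Rightarrow> 'n \<Rightarrow> 'n \<Rightarrow> 'n \<Rightarrow> real ^ 'n \<Rightarrow> real"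
  where "christoffel g k i j x =
     (1/2) * (\<Sum>l\<in>UNIV. matrix_inv (g x) $ k $ l *
        (pderivative i (\<lambda>y. g y $ j $ l) x + pderivative j (\<lambda>y. g y $ i $ l) x
         - pderivative l (\<lambda>y. g y $ i $ j) x))"

(* riemann g l k i j is the coefficient of e_l in R(e_i, e_j) e_k, where
   R(X, Y) = [\<nabla>_X, \<nabla>_Y] - \<nabla>_[X, Y]. *)
definition riemann ::
  "(real ^ 'n::finite \<Rightarrow> real ^ 'n ^ 'n) \<Rightarrow> 'n \<Rightarrow> 'n \<Rightarrow> 'n \<Rightarrow> 'n \<Rightarrow> real ^ 'n \<Rightarrow> real"
  where "riemann g l k i j x =
     pderivative i (christoffel g l j k) x - pderivative j (christoffel g l i k) x
     + (\<Sum>m\<in>UNIV. christoffel g l i m x * christoffel g m j k x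
                  - christoffel g l j m x * christoffel g m i k x)"

definition ricci_matrix ::
  "(real ^ 'n::finite \<Rightarrow> real ^ 'n ^ 'n) \<Rightarrow> real ^ 'n \<Rightarrow> real ^ 'n ^ 'n"
  where "ricci_matrix g x = (\<chi> j k. \<Sum>i\<in>UNIV. riemann g i k i j x)"

(* Ricci tensor and scalar curvature at p, computed in a chart c at p; the values do not
   depend on the choice of c. *)
definition ricci ::
  "('a, 'n::finite) chart set \<Rightarrow> ('a, 'n) chart \<Rightarrow>
   ('a \<Rightarrow> ('a, 'n) tvec \<Rightarrow> ('a, 'n) tvec \<Rightarrow> real) \<Rightarrow> 'a \<Rightarrow> ('a, 'n) tvec \<Rightarrow> ('a, 'n) tvec \<Rightarrow> real"
  where "ricci A c g p X Y =
     (\<Sum>j\<in>UNIV. \<Sum>k\<in>UNIV. ricci_matrix (metric_matrix A c g) (snd c p) $ j $ k * X c $ j * Y c $ k)"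

definition scalar_curvature ::
  "('a, 'n::finite) chart set \<Rightarrow> ('a, 'n) chart \<Rightarrow>
   ('a \<Rightarrow> ('a, 'n) tvec \<Rightarrow> ('a, 'n) tvec \<Rightarrow> real) \<Rightarrow> 'a \<Rightarrow> real"
  where "scalar_curvature A c g p =
     (\<Sum>j\<in>UNIV. \<Sum>k\<in>UNIV. matrix_inv (metric_matrix A c g (snd c p)) $ j $ k *
        ricci_matrix (metric_matrix A c g) (snd c p) $ j $ k)"


subsection \<open>\<open>G\<^sub>2\<close>-structures\<close>

(* The covector product e^{i_1} \<and> ... \<and> e^{i_k} for I = [i_1, ..., i_k], evaluated on
   vs = [v_1, ..., v_k] as the determinant of the matrix of entries (v_a)_{i_b}. *)
definition dual_wedge :: "'n::finite list \<Rightarrow> (real ^ 'n) list \<Rightarrow> real"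
  where "dual_wedge I vs =
     (\<Sum>\<pi> | \<pi> permutes {..<length I}. of_int (sign \<pi>) * (\<Prod>a<length I. (vs ! \<pi> a) $ (I ! a)))"

(* In the index type 7 the numeral 7 equals 0, so 1, ..., 7 are its seven distinct elements. *)
definition phi :: "(real ^ 7) list \<Rightarrow> real"
  where "phi vs =
     dual_wedge [1,2,3] vs + dual_wedge [1,4,5] vs + dual_wedge [1,6,7] vs
     + dual_wedge [2,4,6] vs - dual_wedge [2,5,7] vs - dual_wedge [3,4,7] vs
     - dual_wedge [3,5,6] vs"

definition volume_form :: "(real ^ 7) list \<Rightarrow> real"
  where "volume_form = dual_wedge [1,2,3,4,5,6,7]"

(* Hodge star of a k-form on R^7 with the standard metric and orientation:
   (1/k!) times the sum of \<alpha>(e_{i_1}, ..., e_{i_k}) vol(e_{i_1}, ..., e_{i_k}, v_1, ..., v_{7-k})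
   over all multi-indices, normalised by \<alpha> \<and> *\<beta> = <\<alpha>, \<beta>> vol. *)
definition hodge_std :: "nat \<Rightarrow> ((real ^ 7) list \<Rightarrow> real) \<Rightarrow> (real ^ 7) list \<Rightarrow> real"
  where "hodge_std k \<alpha> vs =
     (\<Sum>I | length I = k. \<alpha> (map (\<lambda>i. axis i 1) I) *
        volume_form (map (\<lambda>i. axis i 1) I @ vs)) / fact k"

definition g2_frame ::
  "('a, 7) chart set \<Rightarrow> ('a, 7) form \<Rightarrow> 'a \<Rightarrow> (('a, 7) tvec \<Rightarrow> real ^ 7) \<Rightarrow> bool"
  where "g2_frame A \<sigma> p u \<longleftrightarrow>
     tangent_iso A p u \<and>
     (\<forall>Xs. set Xs \<subseteq> tangent_space A p \<and> length Xs = 3 \<longrightarrow> \<sigma> p Xs = phi (map u Xs))"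

definition g2_structure :: "'a topology \<Rightarrow> ('a, 7) chart set \<Rightarrow> ('a, 7) form \<Rightarrow> bool"
  where "g2_structure M A \<sigma> \<longleftrightarrow>
     smooth_form M A 3 \<sigma> \<and> (\<forall>p\<in>topspace M. \<exists>u. g2_frame A \<sigma> p u)"

(* Two frames u at p differ by an element of G_2, which is contained in SO(7), so g2_metric
   and hodge below do not depend on the frame chosen. *)
definition some_g2_frame ::
  "('a, 7) chart set \<Rightarrow> ('a, 7) form \<Rightarrow> 'a \<Rightarrow> ('a, 7) tvec \<Rightarrow> real ^ 7"
  where "some_g2_frame A \<sigma> p = (SOME u. g2_frame A \<sigma> p u)"

definition g2_metric ::
  "('a, 7) chart set \<Rightarrow> ('a, 7) form \<Rightarrow> 'a \<Rightarrow> ('a, 7) tvec \<Rightarrow> ('a, 7) tvec \<Rightarrow> real"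
  where "g2_metric A \<sigma> p X Y = some_g2_frame A \<sigma> p X \<bullet> some_g2_frame A \<sigma> p Y"

(* hodge A \<sigma> k \<alpha> is the Hodge star, determined by \<sigma>, of the k-form \<alpha>. *)
definition hodge ::
  "('a, 7) chart set \<Rightarrow> ('a, 7) form \<Rightarrow> nat \<Rightarrow> ('a, 7) form \<Rightarrow> ('a, 7) form"
  where "hodge A \<sigma> k \<alpha> p Xs =
     hodge_std k
       (\<lambda>vs. \<alpha> p (map (inv_into (tangent_space A p) (some_g2_frame A \<sigma> p)) vs))
       (map (some_g2_frame A \<sigma> p) Xs)"

end

theory Submission
  imports Defs
begin

text \<open>
  Write \<open>\<psi> = *\<phi>\<close>. In an orthonormal frame \<open>\<phi>\<^sub>a\<^sub>b\<^sub>i \<phi>\<^sub>i\<^sub>c\<^sub>d = \<delta>\<^sub>a\<^sub>c \<delta>\<^sub>b\<^sub>d - \<delta>\<^sub>a\<^sub>d \<delta>\<^sub>b\<^sub>c + \<psi>\<^sub>a\<^sub>b\<^sub>c\<^sub>d\<close>. As \<open>\<psi>\<close> is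
  alternating at every point, differentiating this identity forces \<open>\<nabla>\<^sub>l \<sigma> = \<tau>\<^sub>l \<lrcorner> \<psi>\<close> for a 2-tensor \<open>\<tau>\<close>,
  and \<open>d\<sigma> = 0\<close> says that \<open>\<tau>\<close> is skew with \<open>\<phi>\<^sub>a\<^sub>j\<^sub>k \<tau>\<^sub>j\<^sub>k = 0\<close>. Hence \<open>\<sigma>\<close> is orthogonal to \<open>\<nabla>\<^sub>l \<sigma>\<close>, the
  divergence of \<open>\<sigma>\<close> is \<open>2\<tau>\<close>, and its contraction with \<open>\<sigma>\<close> vanishes. The derivatives of these two
  orthogonality relations, the derivative of \<open>d\<sigma> = 0\<close> and the Ricci identity for \<open>\<nabla>\<nabla>\<sigma>\<close>, contracted with \<open>\<sigma>\<close>,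
  give \<open>12 Scal = 3 |div \<sigma>|\<^sup>2 - |\<nabla>\<sigma>|\<^sup>2\<close> (norms over all indices), that is \<open>Scal = - |\<tau>|\<^sup>2 \<le> 0\<close>. The alternation of \<open>\<nabla>\<psi>\<close>
  determines \<open>\<tau>\<close>, so \<open>\<tau> = 0\<close> is equivalent to \<open>d*\<sigma> = 0\<close>. If \<open>\<nabla>\<sigma> = 0\<close>, then the curvature endomorphisms
  annihilate \<open>\<sigma>\<close>, and contracting this with \<open>\<sigma>\<close> gives \<open>Ric = 0\<close>.
\<close>


subsection \<open>Laplace expansion of covector products\<close>

text \<open>The orthonormal frames come from a pointwise choice and need not depend continuously on
  the point, so no frame component may be differentiated. This shapes the whole argument. The metric
  has to be recovered algebraically from \<sigma> before it is known to be smooth. Every identity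
  that is to be differentiated is written as a trace with the inverse metric, which is smooth and
  parallel, and a frame is inserted only at the point where the result is read off. The contraction
  of two copies of \<phi> serves twice. It expresses \<psi> through smooth data, and it forces the
  variation of \<psi> with the metric kept parallel to remain alternating. This cuts the 35
  components of each \<open>\<nabla>\<^sub>l \<sigma>\<close> down to 7; closedness then leaves 14
  of the 49 entries of \<tau>, a two-form with values in the Lie algebra of the stabilizer. The
  constant 12 is 3 times 4: closedness gives three equal terms, and the three curvature terms of the
  Ricci identity contribute 6 - 1 - 1. The same 6 - 1 - 1 appears in the Ricci-flat case, where its
  being nonzero is what matters.\<close>

definition leibniz :: "nat \<Rightarrow> (nat \<Rightarrow> nat \<Rightarrow> real) \<Rightarrow> real" where
  "leibniz n M = (\<Sum>\<pi> | \<pi> permutes {..<n}. of_int (sign \<pi>) * (\<Prod>a<n. M a (\<pi> a)))"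

definition lift_perm :: "(nat \<Rightarrow> nat) \<Rightarrow> nat \<Rightarrow> nat" where
  "lift_perm q a = (case a of 0 \<Rightarrow> 0 | Suc a \<Rightarrow> Suc (q a))"

lemma lift_perm_simps [simp]: "lift_perm q 0 = 0" "lift_perm q (Suc a) = Suc (q a)"
  by (auto simp: lift_perm_def)

lemma lift_perm_transpose_comp:
  "lift_perm (Transposition.transpose a b \<circ> p) = Transposition.transpose (Suc a) (Suc b) \<circ> lift_perm p"
  by (rule ext) (auto simp: lift_perm_def Transposition.transpose_def split: nat.splits)

text \<open>Induction over products of transpositions: lifting turns a transposition into a
  transposition, so each factor changes both signs alike.\<close>

lemma lift_perm_permutes_sign:
  assumes "q permutes {..<n}"
  shows "lift_perm q permutes {..<Suc n} \<and> sign (lift_perm q) = sign q"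
proof -
  have "finite {..<n}" by simp
  from assms this show ?thesis
  proof (induction rule: permutes_induct)
    case id
    have "lift_perm id = id"
      by (rule ext) (auto simp: lift_perm_def split: nat.splits)
    then show ?case by (simp add: id_def[symmetric])
  next
    case (swap a b p)
    have p: "lift_perm p permutes {..<Suc n}" "sign (lift_perm p) = sign p"
      using swap by auto
    have t: "Transposition.transpose (Suc a) (Suc b) permutes {..<Suc n}"
      using swap by (intro permutes_swap_id) auto
    have perm: "permutation p" "permutation (lift_perm p)"
      using swap p permutation_permutes finite_lessThan by blast+
    have "sign (lift_perm (Transposition.transpose a b \<circ> p)) = - sign (lift_perm p)"
      unfolding lift_perm_transpose_comp
      using swap perm by (subst sign_compose) (auto simp: permutation_swap_id sign_swap_id)
    moreover have "sign (Transposition.transpose a b \<circ> p) = - sign p"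
      using swap perm by (subst sign_compose) (auto simp: permutation_swap_id sign_swap_id)
    moreover have "lift_perm (Transposition.transpose a b \<circ> p) permutes {..<Suc n}"
      unfolding lift_perm_transpose_comp by (rule permutes_compose[OF p(1) t])
    ultimately show ?case using p by (metis (no_types))
  qed
qed

lemma lift_perm_bij:
  "bij_betw lift_perm {q. q permutes {..<n}} {\<pi>. \<pi> permutes {..<Suc n} \<and> \<pi> 0 = 0}"
proof (rule bij_betwI')
  fix x y assume "x \<in> {q. q permutes {..<n}}" "y \<in> {q. q permutes {..<n}}"
  show "(lift_perm x = lift_perm y) = (x = y)"
    by (metis ext lift_perm_simps(2) old.nat.inject)
next
  fix x assume "x \<in> {q. q permutes {..<n}}"
  then show "lift_perm x \<in> {\<pi>. \<pi> permutes {..<Suc n} \<and> \<pi> 0 = 0}"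
    using lift_perm_permutes_sign by auto
next
  fix \<pi> assume "\<pi> \<in> {\<pi>. \<pi> permutes {..<Suc n} \<and> \<pi> 0 = 0}"
  then have \<pi>: "\<pi> permutes {..<Suc n}" "\<pi> 0 = 0" by auto
  define q where "q a = \<pi> (Suc a) - 1" for a
  have nz: "\<pi> (Suc a) \<noteq> 0" for a
    using permutes_inj[OF \<pi>(1)] \<pi>(2) by (metis injD nat.distinct(1))
  have Suc_q: "Suc (q a) = \<pi> (Suc a)" for a
    using nz[of a] by (simp add: q_def)
  have eq: "\<pi> = lift_perm q"
    by (rule ext) (auto simp: lift_perm_def \<pi>(2) Suc_q split: nat.splits)
  have "bij_betw q {..<n} {..<n}"
  proof (rule bij_betw_imageI)
    show inj: "inj_on q {..<n}"
    proof (rule inj_onI)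
      fix a b assume "q a = q b"
      then have "\<pi> (Suc a) = \<pi> (Suc b)" by (metis Suc_q)
      then show "a = b" using permutes_inj[OF \<pi>(1)] by (auto dest: injD)
    qed
    have "q ` {..<n} \<subseteq> {..<n}"
    proof (clarify)
      fix a assume "a < n"
      then have "\<pi> (Suc a) < Suc n" using permutes_in_image[OF \<pi>(1)] by auto
      then show "q a < n" using Suc_q[of a] by simp
    qed
    then show "q ` {..<n} = {..<n}"
      using inj by (simp add: endo_inj_surj)
  qed
  moreover have "q a = a" if "a \<notin> {..<n}" for a
  proof -
    have "\<pi> (Suc a) = Suc a" using that permutes_not_in[OF \<pi>(1)] by auto
    then show ?thesis by (simp add: q_def)
  qed
  ultimately have "q permutes {..<n}" by (rule bij_imp_permutes)
  with eq show "\<exists>x\<in>{q. q permutes {..<n}}. \<pi> = lift_perm x" by auto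
qed

definition leibniz_at :: "nat \<Rightarrow> nat \<Rightarrow> (nat \<Rightarrow> nat \<Rightarrow> real) \<Rightarrow> real" where
  "leibniz_at n i M =
    (\<Sum>\<pi> | \<pi> permutes {..<Suc n} \<and> \<pi> i = 0. of_int (sign \<pi>) * (\<Prod>a<Suc n. M a (\<pi> a)))"

lemma leibniz_at_0:
  "leibniz_at n 0 M = M 0 0 * leibniz n (\<lambda>a b. M (Suc a) (Suc b))"
proof -
  have "leibniz_at n 0 M = (\<Sum>q | q permutes {..<n}.
      of_int (sign (lift_perm q)) * (\<Prod>a<Suc n. M a (lift_perm q a)))"
    unfolding leibniz_at_def by (rule sum.reindex_bij_betw[OF lift_perm_bij, symmetric])
  also have "\<dots> = (\<Sum>q | q permutes {..<n}. M 0 0 * (of_int (sign q) * (\<Prod>a<n. M (Suc a) (Suc (q a)))))"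
    by (rule sum.cong) (auto simp: prod.lessThan_Suc_shift lift_perm_permutes_sign simp del: prod.lessThan_Suc)
  finally show ?thesis by (simp add: leibniz_def sum_distrib_left)
qed

text \<open>Composing with the transposition of the neighbours \<open>i\<close> and
  \<open>Suc i\<close> moves the row that is matched with column 0 by one position, at the cost of a
  sign. Swaps of neighbours leave the order of the remaining rows intact, as the minor in
  \<open>leibniz_at_eq\<close> requires.\<close>

lemma leibniz_at_Suc:
  assumes "Suc i \<le> n"
  shows "leibniz_at n (Suc i) M = - leibniz_at n i (\<lambda>a. M (Transposition.transpose i (Suc i) a))"
proof -
  let ?t = "Transposition.transpose i (Suc i)"
  have tp: "?t permutes {..<Suc n}" using assms by (intro permutes_swap_id) auto
  have bij: "bij_betw (\<lambda>\<pi>. \<pi> \<circ> ?t) {\<pi>. \<pi> permutes {..<Suc n} \<and> \<pi> i = 0}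
     {\<pi>. \<pi> permutes {..<Suc n} \<and> \<pi> (Suc i) = 0}"
    by (rule bij_betw_byWitness[where f' = "\<lambda>\<pi>. \<pi> \<circ> ?t"])
      (auto simp: comp_assoc intro: permutes_compose[OF tp])
  have "leibniz_at n (Suc i) M = (\<Sum>\<pi> | \<pi> permutes {..<Suc n} \<and> \<pi> i = 0.
      of_int (sign (\<pi> \<circ> ?t)) * (\<Prod>a<Suc n. M a ((\<pi> \<circ> ?t) a)))"
    unfolding leibniz_at_def by (rule sum.reindex_bij_betw[OF bij, symmetric])
  also have "\<dots> = (\<Sum>\<pi> | \<pi> permutes {..<Suc n} \<and> \<pi> i = 0.
      - (of_int (sign \<pi>) * (\<Prod>a<Suc n. M (?t a) (\<pi> a))))"
  proof (rule sum.cong[OF refl])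
    fix \<pi> assume "\<pi> \<in> {\<pi>. \<pi> permutes {..<Suc n} \<and> \<pi> i = 0}"
    then have "permutation \<pi>" using permutation_permutes finite_lessThan by blast
    then have s: "sign (\<pi> \<circ> ?t) = - sign \<pi>"
      by (simp add: sign_compose permutation_swap_id sign_swap_id)
    have "(\<Prod>a<Suc n. M a ((\<pi> \<circ> ?t) a)) = (\<Prod>a<Suc n. M (?t a) ((\<pi> \<circ> ?t) (?t a)))"
      using prod.permute[OF tp, of "\<lambda>a. M a ((\<pi> \<circ> ?t) a)"] by (simp add: comp_def del: prod.lessThan_Suc)
    then show "of_int (sign (\<pi> \<circ> ?t)) * (\<Prod>a<Suc n. M a ((\<pi> \<circ> ?t) a)) =
      - (of_int (sign \<pi>) * (\<Prod>a<Suc n. M (?t a) (\<pi> a)))"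
      by (simp add: s del: prod.lessThan_Suc)
  qed
  finally show ?thesis by (simp add: leibniz_at_def sum_negf)
qed

lemma leibniz_cong:
  "(\<And>a b. a < n \<Longrightarrow> b < n \<Longrightarrow> M a b = M' a b) \<Longrightarrow> leibniz n M = leibniz n M'"
  unfolding leibniz_def
  by (intro sum.cong prod.cong arg_cong2[where f = "(*)"] refl)
    (auto dest: permutes_in_image[of _ "{..<n}"])

lemma leibniz_at_eq:
  "i \<le> n \<Longrightarrow> leibniz_at n i M =
     (-1)^i * M i 0 * leibniz n (\<lambda>a b. M (if a < i then a else Suc a) (Suc b))"
proof (induction i arbitrary: M)
  case 0
  then show ?case by (simp add: leibniz_at_0)
next
  case (Suc i)
  have "leibniz_at n (Suc i) M = - leibniz_at n i (\<lambda>a. M (Transposition.transpose i (Suc i) a))"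
    using Suc leibniz_at_Suc by simp
  also have "\<dots> = - ((-1)^i * M (Suc i) 0 *
      leibniz n (\<lambda>a b. M (Transposition.transpose i (Suc i) (if a < i then a else Suc a)) (Suc b)))"
    using Suc by simp
  also have "leibniz n (\<lambda>a b. M (Transposition.transpose i (Suc i) (if a < i then a else Suc a)) (Suc b)) =
     leibniz n (\<lambda>a b. M (if a < Suc i then a else Suc a) (Suc b))"
    by (rule leibniz_cong) (auto simp: Transposition.transpose_def less_Suc_eq)
  finally show ?case by simp
qed

text \<open>The permutations are split according to the row that they send to column 0. Rows and
  columns are natural numbers, so the minor with row \<open>i\<close> skipped has the same type as
  \<open>M\<close>.\<close>

lemma leibniz_Suc:
  "leibniz (Suc n) M =
    (\<Sum>i<Suc n. (-1)^i * M i 0 * leibniz n (\<lambda>a b. M (if a < i then a else Suc a) (Suc b)))"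
proof -
  let ?P = "{\<pi>. \<pi> permutes {..<Suc n}}"
  have "\<exists>!i. i < Suc n \<and> \<pi> i = 0" if "\<pi> \<in> ?P" for \<pi>
  proof -
    have \<pi>: "\<pi> permutes {..<Suc n}" using that by simp
    obtain i where "\<pi> i = 0" using permutes_surj[OF \<pi>] by (metis surjD)
    moreover have "i < Suc n"
      using permutes_in_image[OF \<pi>, of i] \<open>\<pi> i = 0\<close> by simp
    ultimately show ?thesis using permutes_inj[OF \<pi>] by (metis injD)
  qed
  then have "{\<pi>. \<pi> permutes {..<Suc n}} = (\<Union>i<Suc n. {\<pi>. \<pi> permutes {..<Suc n} \<and> \<pi> i = 0})"
    by blast
  moreover have "{\<pi>. \<pi> permutes {..<Suc n} \<and> \<pi> i = 0} \<inter> {\<pi>. \<pi> permutes {..<Suc n} \<and> \<pi> j = 0} = {}"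
    if "i \<noteq> j" for i j using that by (auto dest!: permutes_inj) (metis injD)
  moreover have "finite {\<pi>. \<pi> permutes {..<Suc n} \<and> \<pi> i = 0}" for i
    by (rule finite_subset[OF _ finite_permutations[of "{..<Suc n}"]]) auto
  ultimately have "leibniz (Suc n) M = (\<Sum>i<Suc n. leibniz_at n i M)"
    unfolding leibniz_def leibniz_at_def by (simp add: sum.UNION_disjoint del: sum.lessThan_Suc prod.lessThan_Suc)
  also have "\<dots> = (\<Sum>i<Suc n. (-1)^i * M i 0 * leibniz n (\<lambda>a b. M (if a < i then a else Suc a) (Suc b)))"
    by (rule sum.cong) (auto simp: leibniz_at_eq)
  finally show ?thesis .
qed

text \<open>Rows stand for covectors and columns for vectors, so that expansion along column 0
  splits off the first vector of the list.\<close>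

lemma dual_wedge_leibniz:
  "dual_wedge I vs = leibniz (length I) (\<lambda>a b. vs ! b $ (I ! a))"
  by (simp add: dual_wedge_def leibniz_def)

text \<open>This turns evaluation into a recursion on the list of vectors, so coordinate vectors
  with many zeros can be consumed one at a time.\<close>

lemma dual_wedge_Cons:
  "dual_wedge (j # I) (v # vs) =
    (\<Sum>i<Suc (length I). (-1)^i * v $ ((j # I) ! i) *
       dual_wedge (take i (j # I) @ drop (Suc i) (j # I)) vs)"
proof -
  have "leibniz (length I) (\<lambda>a b. (v # vs) ! Suc b $ ((j # I) ! (if a < i then a else Suc a))) =
     dual_wedge (take i (j # I) @ drop (Suc i) (j # I)) vs" if "i < Suc (length I)" for i
  proof -
    have "length (take i (j # I) @ drop (Suc i) (j # I)) = length I" using that by simp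
    moreover have "(take i (j # I) @ drop (Suc i) (j # I)) ! a = (j # I) ! (if a < i then a else Suc a)"
      if "a < length I" for a
      using that \<open>i < Suc (length I)\<close> by (auto simp: nth_append min_def)
    ultimately show ?thesis
      unfolding dual_wedge_leibniz by (auto intro: leibniz_cong)
  qed
  then show ?thesis
    unfolding dual_wedge_leibniz[of "j # I"] list.size(4) add_Suc_right add_0_right leibniz_Suc
    by (intro sum.cong) auto
qed

lemma dual_wedge_Nil [simp]: "dual_wedge [] vs = 1"
  by (simp add: dual_wedge_def)

subsection \<open>The forms \<open>\<phi>\<close> and \<open>*\<phi>\<close> on \<open>\<real>\<^sup>7\<close>\<close>

lemma exhaust_7:
  fixes x :: 7
  shows "x = 1 \<or> x = 2 \<or> x = 3 \<or> x = 4 \<or> x = 5 \<or> x = 6 \<or> x = 7"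
proof (induct x)
  case (of_int z)
  then have "0 \<le> z" and "z < 7" by simp_all
  then have "z = 0 \<or> z = 1 \<or> z = 2 \<or> z = 3 \<or> z = 4 \<or> z = 5 \<or> z = 6" by arith
  then show ?case by auto
qed

lemma UNIV_7: "(UNIV :: 7 set) = {1, 2, 3, 4, 5, 6, 7}"
  using exhaust_7 by auto

lemma forall_7: "(\<forall>i::7. P i) \<longleftrightarrow> P 1 \<and> P 2 \<and> P 3 \<and> P 4 \<and> P 5 \<and> P 6 \<and> P 7"
  by (metis exhaust_7)

lemma sum_7: "sum f (UNIV :: 7 set) = f 1 + f 2 + f 3 + f 4 + f 5 + f 6 + f 7"
  unfolding UNIV_7 by (simp add: ac_simps)

lemma dual_wedge_3:
  "dual_wedge [i, j, k] [a, b, c] =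
     a$i * (b$j * c$k - b$k * c$j) - a$j * (b$i * c$k - b$k * c$i) + a$k * (b$i * c$j - b$j * c$i)"
  by (simp add: dual_wedge_Cons algebra_simps)

lemma dual_wedge_4:
  "dual_wedge [i, j, k, l] [a, b, c, d] =
     a$i * dual_wedge [j, k, l] [b, c, d] - a$j * dual_wedge [i, k, l] [b, c, d]
     + a$k * dual_wedge [i, j, l] [b, c, d] - a$l * dual_wedge [i, j, k] [b, c, d]"
  by (simp add: dual_wedge_Cons[of _ _ a] eval_nat_numeral)

lemma phi_eq:
  "phi [a, b, c] =
     (let d = (\<lambda>i j k. a$i * (b$j * c$k - b$k * c$j) - a$j * (b$i * c$k - b$k * c$i)
                        + a$k * (b$i * c$j - b$j * c$i))
      in d 1 2 3 + d 1 4 5 + d 1 6 7 + d 2 4 6 - d 2 5 7 - d 3 4 7 - d 3 5 6)"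
  by (simp only: phi_def Let_def dual_wedge_3)

text \<open>Each term replaces the index triple of a term of \<open>phi\<close> by its complement.
  All seven resulting permutations of 1, ..., 7 are even, so the coefficients carry over
  unchanged.\<close>

definition psi :: "(real ^ 7) list \<Rightarrow> real" where
  "psi vs = dual_wedge [4,5,6,7] vs + dual_wedge [2,3,6,7] vs + dual_wedge [2,3,4,5] vs
     + dual_wedge [1,3,5,7] vs - dual_wedge [1,3,4,6] vs - dual_wedge [1,2,5,6] vs
     - dual_wedge [1,2,4,7] vs"

text \<open>As a congruence rule it keeps the simplifier from expanding the cofactor of a vanishing entry.\<close>
lemma mult_weak_cong: "a = a' \<Longrightarrow> a * b = a' * (b::real)" by simp

lemma sum_lists3:
  "(\<Sum>I | length I = 3. f I) = (\<Sum>i\<in>UNIV. \<Sum>j\<in>UNIV. \<Sum>k\<in>(UNIV :: 'n::finite set). f [i, j, k])"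
proof -
  have "(\<Sum>I | length I = 3. f I) = (\<Sum>(i,j,k)\<in>UNIV. f [i, j, k])"
    by (rule sum.reindex_bij_witness[where j = "\<lambda>I. (I ! 0, I ! 1, I ! 2)" and i = "\<lambda>(i,j,k). [i,j,k]"])
      (auto simp: length_Suc_conv numeral_3_eq_3)
  also have "\<dots> = (\<Sum>i\<in>UNIV. \<Sum>j\<in>UNIV. \<Sum>k\<in>UNIV. f [i, j, k])"
    by (simp add: sum.cartesian_product UNIV_Times_UNIV[symmetric] del: UNIV_Times_UNIV)
  finally show ?thesis .
qed

lemma neq_7:
  "(1::7) = 2 \<longleftrightarrow> False"
  "(1::7) = 3 \<longleftrightarrow> False"
  "(1::7) = 4 \<longleftrightarrow> False"
  "(1::7) = 5 \<longleftrightarrow> False"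
  "(1::7) = 6 \<longleftrightarrow> False"
  "(1::7) = 7 \<longleftrightarrow> False"
  "(2::7) = 1 \<longleftrightarrow> False"
  "(2::7) = 3 \<longleftrightarrow> False"
  "(2::7) = 4 \<longleftrightarrow> False"
  "(2::7) = 5 \<longleftrightarrow> False"
  "(2::7) = 6 \<longleftrightarrow> False"
  "(2::7) = 7 \<longleftrightarrow> False"
  "(3::7) = 1 \<longleftrightarrow> False"
  "(3::7) = 2 \<longleftrightarrow> False"
  "(3::7) = 4 \<longleftrightarrow> False"
  "(3::7) = 5 \<longleftrightarrow> False"
  "(3::7) = 6 \<longleftrightarrow> False"
  "(3::7) = 7 \<longleftrightarrow> False"
  "(4::7) = 1 \<longleftrightarrow> False"
  "(4::7) = 2 \<longleftrightarrow> False"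
  "(4::7) = 3 \<longleftrightarrow> False"
  "(4::7) = 5 \<longleftrightarrow> False"
  "(4::7) = 6 \<longleftrightarrow> False"
  "(4::7) = 7 \<longleftrightarrow> False"
  "(5::7) = 1 \<longleftrightarrow> False"
  "(5::7) = 2 \<longleftrightarrow> False"
  "(5::7) = 3 \<longleftrightarrow> False"
  "(5::7) = 4 \<longleftrightarrow> False"
  "(5::7) = 6 \<longleftrightarrow> False"
  "(5::7) = 7 \<longleftrightarrow> False"
  "(6::7) = 1 \<longleftrightarrow> False"
  "(6::7) = 2 \<longleftrightarrow> False"
  "(6::7) = 3 \<longleftrightarrow> False"
  "(6::7) = 4 \<longleftrightarrow> False"
  "(6::7) = 5 \<longleftrightarrow> False"
  "(6::7) = 7 \<longleftrightarrow> False"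
  "(7::7) = 1 \<longleftrightarrow> False"
  "(7::7) = 2 \<longleftrightarrow> False"
  "(7::7) = 3 \<longleftrightarrow> False"
  "(7::7) = 4 \<longleftrightarrow> False"
  "(7::7) = 5 \<longleftrightarrow> False"
  "(7::7) = 6 \<longleftrightarrow> False"
  by simp_all

lemma axis_7: "axis (i::7) (1::real) $ j = (if i = j then 1 else 0)"
  by (simp add: axis_def)

lemma phi_repeat [simp]: "phi [a, a, c] = 0" "phi [a, c, c] = 0" "phi [a, c, a] = 0"
  unfolding phi_def dual_wedge_3 by algebra+

lemma phi_swap: "phi [b, a, c] = - phi [a, b, c]" "phi [a, c, b] = - phi [a, b, c]"
  unfolding phi_def dual_wedge_3 by algebra+

text \<open>The multiplication table of the cross product on the imaginary octonions, in the form of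
  rewrite rules: with two basis vectors inserted a single component of the third argument is left,
  so index sums are evaluated without expanding determinants.\<close>

lemma phi_axis_less:
  "phi [axis 1 1, axis 2 1, v] = v $ 3"
  "phi [axis 1 1, axis 3 1, v] = - v $ 2"
  "phi [axis 1 1, axis 4 1, v] = v $ 5"
  "phi [axis 1 1, axis 5 1, v] = - v $ 4"
  "phi [axis 1 1, axis 6 1, v] = v $ 7"
  "phi [axis 1 1, axis 7 1, v] = - v $ 6"
  "phi [axis 2 1, axis 3 1, v] = v $ 1"
  "phi [axis 2 1, axis 4 1, v] = v $ 6"
  "phi [axis 2 1, axis 5 1, v] = - v $ 7"
  "phi [axis 2 1, axis 6 1, v] = - v $ 4"
  "phi [axis 2 1, axis 7 1, v] = v $ 5"
  "phi [axis 3 1, axis 4 1, v] = - v $ 7"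
  "phi [axis 3 1, axis 5 1, v] = - v $ 6"
  "phi [axis 3 1, axis 6 1, v] = v $ 5"
  "phi [axis 3 1, axis 7 1, v] = v $ 4"
  "phi [axis 4 1, axis 5 1, v] = v $ 1"
  "phi [axis 4 1, axis 6 1, v] = v $ 2"
  "phi [axis 4 1, axis 7 1, v] = - v $ 3"
  "phi [axis 5 1, axis 6 1, v] = - v $ 3"
  "phi [axis 5 1, axis 7 1, v] = - v $ 2"
  "phi [axis 6 1, axis 7 1, v] = v $ 1"
  by (simp_all only: phi_eq Let_def axis_7 neq_7 refl if_True if_False mult_zero_left mult_zero_right
      mult_1_left mult_minus_left minus_zero diff_0_right diff_0 diff_self add_0_left add_0_right)

lemmas phi_axis_axis = phi_axis_less phi_axis_less[THEN trans[OF phi_swap(1) arg_cong[where f = uminus]]] phi_repeat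

lemma dual_wedge_expand:
  "dual_wedge [j0, j1, j2, j3, j4] (v # vs) = v $ j0 * dual_wedge [j1, j2, j3, j4] vs - v $ j1 * dual_wedge [j0, j2, j3, j4] vs + v $ j2 * dual_wedge [j0, j1, j3, j4] vs - v $ j3 * dual_wedge [j0, j1, j2, j4] vs + v $ j4 * dual_wedge [j0, j1, j2, j3] vs"
  "dual_wedge [j0, j1, j2, j3, j4, j5] (v # vs) = v $ j0 * dual_wedge [j1, j2, j3, j4, j5] vs - v $ j1 * dual_wedge [j0, j2, j3, j4, j5] vs + v $ j2 * dual_wedge [j0, j1, j3, j4, j5] vs - v $ j3 * dual_wedge [j0, j1, j2, j4, j5] vs + v $ j4 * dual_wedge [j0, j1, j2, j3, j5] vs - v $ j5 * dual_wedge [j0, j1, j2, j3, j4] vs"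
  "dual_wedge [j0, j1, j2, j3, j4, j5, j6] (v # vs) = v $ j0 * dual_wedge [j1, j2, j3, j4, j5, j6] vs - v $ j1 * dual_wedge [j0, j2, j3, j4, j5, j6] vs + v $ j2 * dual_wedge [j0, j1, j3, j4, j5, j6] vs - v $ j3 * dual_wedge [j0, j1, j2, j4, j5, j6] vs + v $ j4 * dual_wedge [j0, j1, j2, j3, j5, j6] vs - v $ j5 * dual_wedge [j0, j1, j2, j3, j4, j6] vs + v $ j6 * dual_wedge [j0, j1, j2, j3, j4, j5] vs"
  by (simp_all add: dual_wedge_Cons eval_nat_numeral)

lemma hodge_phi: "hodge_std 3 phi [a, b, c, d] = psi [a, b, c, d]"
proof -
  \<comment> \<open>Every index set is counted in its 3! = 6 orders with equal products of signs;
    this factor cancels \<open>fact 3\<close>.\<close>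
  have "(\<Sum>I | length I = 3. phi (map (\<lambda>i. axis i 1) I) * volume_form (map (\<lambda>i. axis i 1) I @ [a,b,c,d]))
     = 6 * psi [a, b, c, d]"
    unfolding sum_lists3 
    \<comment> \<open>The factor \<open>phi\<close> is evaluated while \<open>volume_form\<close> is
      still folded: only the 42 ordered triples on which it is nonzero reach the expansion of the 7
      by 7 determinant.\<close>
    apply (simp only: sum_7 list.map phi_axis_axis axis_7 neq_7 refl if_True if_False mult_zero_left mult_zero_right
      mult_1_left mult_minus_left minus_minus minus_zero diff_0_right diff_0 diff_self add_0_left add_0_right append.simps)
    apply (simp only: volume_form_def dual_wedge_expand axis_7 neq_7 refl if_True if_False mult_zero_left
      mult_1_left mult_minus_left minus_zero diff_0_right diff_0 diff_self add_0_left add_0_right append.simps cong: mult_weak_cong)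
    by (simp add: psi_def)
  then show ?thesis unfolding hodge_std_def by (simp add: fact_numeral)
qed

text \<open>The four vectors are arbitrary because they will be images of tangent vectors under
  frames. The claim is a polynomial identity in their coordinates.\<close>

lemma phi_contraction:
  "(\<Sum>i\<in>UNIV. phi [a, b, axis i 1] * phi [axis i 1, c, d]) =
     (a \<bullet> c) * (b \<bullet> d) - (a \<bullet> d) * (b \<bullet> c) + psi [a, b, c, d]"
proof -
  show ?thesis
  unfolding sum_7 inner_vec_def 
  apply (simp only: phi_eq psi_def axis_7 neq_7 refl if_True if_False mult_zero_left mult_zero_right
      mult_1_left mult_minus_left minus_zero diff_0_right diff_0 diff_self add_0_left add_0_right Let_def)
  apply (simp only: dual_wedge_4 dual_wedge_3 inner_real_def mult_1_right)
  apply (algebra)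
  done
qed

lemma psi_eq: "psi [a, b, c, d] = (let D = (\<lambda>i j k. b$i * (c$j * d$k - c$k * d$j) - b$j * (c$i * d$k - c$k * d$i)
                        + b$k * (c$i * d$j - c$j * d$i));
     E = (\<lambda>i j k l. a$i * D j k l - a$j * D i k l + a$k * D i j l - a$l * D i j k)
     in E 4 5 6 7 + E 2 3 6 7 + E 2 3 4 5 + E 1 3 5 7 - E 1 3 4 6 - E 1 2 5 6 - E 1 2 4 7)"
  by (simp only: psi_def dual_wedge_4 dual_wedge_3 Let_def)

lemmas numeral_7_simps = axis_7 neq_7 refl if_True if_False mult_zero_left mult_zero_right
      mult_1_left mult_1_right mult_minus_left mult_minus_right minus_minus minus_zero diff_0_right diff_0 diff_self diff_minus_eq_add minus_add_distrib
      add_0_left add_0_right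

lemma psi_swap:
  "psi [b, a, c, d] = - psi [a, b, c, d]" "psi [a, c, b, d] = - psi [a, b, c, d]"
  "psi [a, b, d, c] = - psi [a, b, c, d]"
  unfolding psi_def dual_wedge_4 dual_wedge_3 by algebra+

lemma psi_repeat [simp]: "psi [a, a, b, c] = 0" "psi [a, b, b, c] = 0" "psi [a, b, c, c] = 0"
   "psi [a, b, a, c] = 0" "psi [a, b, c, b] = 0" "psi [a, b, c, a] = 0"
  unfolding psi_def dual_wedge_4 dual_wedge_3 by algebra+

text \<open>The basis vectors stand in the middle slots because the first slot is going to hold a
  torsion vector.\<close>

lemma psi_axis_less:
  "psi [v, axis 1 1, axis 2 1, w] =  - v $ 4 * w $ 7 - v $ 5 * w $ 6 + v $ 6 * w $ 5 + v $ 7 * w $ 4"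
  "psi [v, axis 1 1, axis 3 1, w] =  - v $ 4 * w $ 6 + v $ 5 * w $ 7 + v $ 6 * w $ 4 - v $ 7 * w $ 5"
  "psi [v, axis 1 1, axis 4 1, w] = v $ 2 * w $ 7 + v $ 3 * w $ 6 - v $ 6 * w $ 3 - v $ 7 * w $ 2"
  "psi [v, axis 1 1, axis 5 1, w] = v $ 2 * w $ 6 - v $ 3 * w $ 7 - v $ 6 * w $ 2 + v $ 7 * w $ 3"
  "psi [v, axis 1 1, axis 6 1, w] =  - v $ 2 * w $ 5 - v $ 3 * w $ 4 + v $ 4 * w $ 3 + v $ 5 * w $ 2"
  "psi [v, axis 1 1, axis 7 1, w] =  - v $ 2 * w $ 4 + v $ 3 * w $ 5 + v $ 4 * w $ 2 - v $ 5 * w $ 3"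
  "psi [v, axis 2 1, axis 3 1, w] = v $ 4 * w $ 5 - v $ 5 * w $ 4 + v $ 6 * w $ 7 - v $ 7 * w $ 6"
  "psi [v, axis 2 1, axis 4 1, w] =  - v $ 1 * w $ 7 - v $ 3 * w $ 5 + v $ 5 * w $ 3 + v $ 7 * w $ 1"
  "psi [v, axis 2 1, axis 5 1, w] =  - v $ 1 * w $ 6 + v $ 3 * w $ 4 - v $ 4 * w $ 3 + v $ 6 * w $ 1"
  "psi [v, axis 2 1, axis 6 1, w] = v $ 1 * w $ 5 - v $ 3 * w $ 7 - v $ 5 * w $ 1 + v $ 7 * w $ 3"
  "psi [v, axis 2 1, axis 7 1, w] = v $ 1 * w $ 4 + v $ 3 * w $ 6 - v $ 4 * w $ 1 - v $ 6 * w $ 3"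
  "psi [v, axis 3 1, axis 4 1, w] =  - v $ 1 * w $ 6 + v $ 2 * w $ 5 - v $ 5 * w $ 2 + v $ 6 * w $ 1"
  "psi [v, axis 3 1, axis 5 1, w] = v $ 1 * w $ 7 - v $ 2 * w $ 4 + v $ 4 * w $ 2 - v $ 7 * w $ 1"
  "psi [v, axis 3 1, axis 6 1, w] = v $ 1 * w $ 4 + v $ 2 * w $ 7 - v $ 4 * w $ 1 - v $ 7 * w $ 2"
  "psi [v, axis 3 1, axis 7 1, w] =  - v $ 1 * w $ 5 - v $ 2 * w $ 6 + v $ 5 * w $ 1 + v $ 6 * w $ 2"
  "psi [v, axis 4 1, axis 5 1, w] = v $ 2 * w $ 3 - v $ 3 * w $ 2 + v $ 6 * w $ 7 - v $ 7 * w $ 6"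
  "psi [v, axis 4 1, axis 6 1, w] =  - v $ 1 * w $ 3 + v $ 3 * w $ 1 - v $ 5 * w $ 7 + v $ 7 * w $ 5"
  "psi [v, axis 4 1, axis 7 1, w] =  - v $ 1 * w $ 2 + v $ 2 * w $ 1 + v $ 5 * w $ 6 - v $ 6 * w $ 5"
  "psi [v, axis 5 1, axis 6 1, w] =  - v $ 1 * w $ 2 + v $ 2 * w $ 1 + v $ 4 * w $ 7 - v $ 7 * w $ 4"
  "psi [v, axis 5 1, axis 7 1, w] = v $ 1 * w $ 3 - v $ 3 * w $ 1 - v $ 4 * w $ 6 + v $ 6 * w $ 4"
  "psi [v, axis 6 1, axis 7 1, w] = v $ 2 * w $ 3 - v $ 3 * w $ 2 + v $ 4 * w $ 5 - v $ 5 * w $ 4"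
  by ((simp only: psi_eq Let_def numeral_7_simps, algebra?)+)

lemmas psi_axis_axis = psi_axis_less psi_axis_less[THEN trans[OF psi_swap(2) arg_cong[where f = uminus]]] psi_repeat

lemma alternating3_perms:
  fixes f :: "'n \<Rightarrow> 'n \<Rightarrow> 'n \<Rightarrow> real"
  assumes "\<And>a b c. f b a c = - f a b c" and "\<And>a b c. f a c b = - f a b c"
  shows "f b a c = - f a b c \<and> f a c b = - f a b c \<and> f c b a = - f a b c \<and> f b c a = f a b c \<and> f c a b = f a b c"
  using assms by metis

lemma alternating3_repeat:
  fixes f :: "'n \<Rightarrow> 'n \<Rightarrow> 'n \<Rightarrow> real"
  assumes "\<And>a b c. f b a c = - f a b c" and "\<And>a b c. f a c b = - f a b c"
  shows "f a a c = 0" "f a c c = 0" "f a c a = 0"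
proof -
  show "f a a c = 0" using assms(1)[of a a c] by simp
  show "f a c c = 0" using assms(2)[of a c c] by simp
  show "f a c a = 0" using assms(2)[of a a c] assms(1)[of a a c] by simp
qed

text \<open>The triples listed are the 35 increasing ones; every other value is a signed copy of one
  of them or has a repeated index.\<close>

lemma alternating3_eq_0I:
  fixes f :: "7 \<Rightarrow> 7 \<Rightarrow> 7 \<Rightarrow> real"
  assumes f: "\<And>a b c. f b a c = - f a b c" "\<And>a b c. f a c b = - f a b c"
    and z: "f 1 2 3 = 0" "f 1 2 4 = 0" "f 1 2 5 = 0" "f 1 2 6 = 0" "f 1 2 7 = 0" "f 1 3 4 = 0"
     "f 1 3 5 = 0" "f 1 3 6 = 0" "f 1 3 7 = 0" "f 1 4 5 = 0" "f 1 4 6 = 0" "f 1 4 7 = 0"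
     "f 1 5 6 = 0" "f 1 5 7 = 0" "f 1 6 7 = 0" "f 2 3 4 = 0" "f 2 3 5 = 0" "f 2 3 6 = 0"
     "f 2 3 7 = 0" "f 2 4 5 = 0" "f 2 4 6 = 0" "f 2 4 7 = 0" "f 2 5 6 = 0" "f 2 5 7 = 0"
     "f 2 6 7 = 0" "f 3 4 5 = 0" "f 3 4 6 = 0" "f 3 4 7 = 0" "f 3 5 6 = 0" "f 3 5 7 = 0"
     "f 3 6 7 = 0" "f 4 5 6 = 0" "f 4 5 7 = 0" "f 4 6 7 = 0" "f 5 6 7 = 0"
  shows "f a b c = 0"
proof -
  note p = alternating3_perms[of f, OF f]
  note pz = p[of 2 1 3] p[of 2 1 4] p[of 2 1 5] p[of 2 1 6] p[of 2 1 7] p[of 3 1 4] p[of 3 1 5]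
     p[of 3 1 6] p[of 3 1 7] p[of 4 1 5] p[of 4 1 6] p[of 4 1 7] p[of 5 1 6] p[of 5 1 7]
     p[of 6 1 7] p[of 3 2 4] p[of 3 2 5] p[of 3 2 6] p[of 3 2 7] p[of 4 2 5] p[of 4 2 6]
     p[of 4 2 7] p[of 5 2 6] p[of 5 2 7] p[of 6 2 7] p[of 4 3 5] p[of 4 3 6] p[of 4 3 7]
     p[of 5 3 6] p[of 5 3 7] p[of 6 3 7] p[of 5 4 6] p[of 5 4 7] p[of 6 4 7] p[of 6 5 7]
  have "\<forall>a b c. f a b c = 0"
    unfolding forall_7 by (intro conjI; simp only: alternating3_repeat[of f, OF f] z pz minus_zero)
  then show ?thesis by blast
qed
lemmas index_simps = sum_7 phi_axis_axis psi_axis_axis axis_7 neq_7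
lemmas index_eval = index_simps numeral_7_simps

subsection \<open>The torsion of a first-order variation of \<open>\<phi>\<close>\<close>

text \<open>A variation \<open>f\<close> of \<open>phi\<close> with the metric held fixed varies
  \<open>psi\<close> by \<open>N\<close>, which must therefore stay alternating. Under G_2 the 35
  components of \<open>f\<close> split as 1 + 7 + 27, and the condition on \<open>N\<close> leaves
  only the part of dimension 7, the forms obtained by inserting a vector into
  \<open>psi\<close>.\<close>

lemma phi_variation_eq_psi:
  fixes f :: "7 \<Rightarrow> 7 \<Rightarrow> 7 \<Rightarrow> real"
  defines "N \<equiv> \<lambda>a b c d. (\<Sum>i\<in>UNIV. f a b i * phi [axis i 1, axis c 1, axis d 1]
      + phi [axis a 1, axis b 1, axis i 1] * f i c d)"
  assumes alt: "\<And>a b c. f b a c = - f a b c" "\<And>a b c. f a c b = - f a b c"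
    and N: "\<And>a b c d. N a c b d = - N a b c d"
  obtains T :: "real ^ 7" where "\<And>a b c. f a b c = psi [T, axis a 1, axis b 1, axis c 1]"
proof -
  note mid = N[unfolded N_def]
  note p = alternating3_perms[of f, OF alt]
  note canon = index_eval alternating3_repeat[of f, OF alt]
    p[of 2 1 3] p[of 2 1 4] p[of 2 1 5] p[of 2 1 6] p[of 2 1 7] p[of 3 1 4] p[of 3 1 5]
     p[of 3 1 6] p[of 3 1 7] p[of 4 1 5] p[of 4 1 6] p[of 4 1 7] p[of 5 1 6] p[of 5 1 7]
     p[of 6 1 7] p[of 3 2 4] p[of 3 2 5] p[of 3 2 6] p[of 3 2 7] p[of 4 2 5] p[of 4 2 6]
     p[of 4 2 7] p[of 5 2 6] p[of 5 2 7] p[of 6 2 7] p[of 4 3 5] p[of 4 3 6] p[of 4 3 7]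
     p[of 5 3 6] p[of 5 3 7] p[of 6 3 7] p[of 5 4 6] p[of 5 4 7] p[of 6 4 7] p[of 6 5 7]
  \<comment> \<open>For \<open>a = b\<close> and \<open>c = d\<close> the condition becomes
    \<open>N a c a c = 0\<close>, and the sum collapses to twice the component of \<open>f\<close>
    on a triple of \<open>phi\<close>, up to sign.\<close>
  have E0: "f 1 2 3 = 0" "f 1 4 5 = 0" "f 1 6 7 = 0" "f 2 4 6 = 0" "f 2 5 7 = 0" "f 3 4 7 = 0" "f 3 5 6 = 0"
    using mid[of 1 1 2 2, simplified canon] mid[of 1 1 4 4, simplified canon]
     mid[of 1 1 6 6, simplified canon] mid[of 2 2 4 4, simplified canon]
     mid[of 2 2 5 5, simplified canon] mid[of 3 3 4 4, simplified canon]
     mid[of 3 3 5 5, simplified canon] by linarith+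
  \<comment> \<open>\<open>E1\<close> to \<open>E7\<close> tie together the four triples that occur
    when the basis vector of that number is inserted into \<open>psi\<close>, leaving one free value
    in each group.\<close>
  have E1: "f 2 5 6 = f 2 4 7" "f 3 4 6 = f 2 4 7" "f 3 5 7 = - f 2 4 7"
    using mid[of 1 2 4 6, simplified canon] mid[of 1 2 5 7, simplified canon]
     mid[of 1 2 6 4, simplified canon] by linarith+
  have E2: "f 1 5 6 = f 1 4 7" "f 3 4 5 = f 1 4 7" "f 3 6 7 = f 1 4 7"
    using mid[of 1 1 4 6, simplified canon] mid[of 1 2 4 5, simplified canon]
     mid[of 1 2 6 7, simplified canon] by linarith+
  have E3: "f 1 5 7 = - f 1 4 6" "f 2 4 5 = - f 1 4 6" "f 2 6 7 = - f 1 4 6"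
    using mid[of 1 1 4 7, simplified canon] mid[of 1 2 4 4, simplified canon]
     mid[of 1 2 6 6, simplified canon] by linarith+
  have E4: "f 1 3 6 = f 1 2 7" "f 2 3 5 = - f 1 2 7" "f 5 6 7 = - f 1 2 7"
    using mid[of 1 1 2 6, simplified canon] mid[of 1 2 2 5, simplified canon]
     mid[of 1 4 6 7, simplified canon] by linarith+
  have E5: "f 1 3 7 = - f 1 2 6" "f 2 3 4 = f 1 2 6" "f 4 6 7 = f 1 2 6"
    using mid[of 1 1 2 7, simplified canon] mid[of 1 2 2 4, simplified canon]
     mid[of 1 4 6 6, simplified canon] by linarith+
  have E6: "f 1 3 4 = f 1 2 5" "f 2 3 7 = f 1 2 5" "f 4 5 7 = f 1 2 5"
    using mid[of 1 1 2 4, simplified canon] mid[of 1 2 2 7, simplified canon]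
     mid[of 1 4 4 7, simplified canon] by linarith+
  have E7: "f 1 3 5 = - f 1 2 4" "f 2 3 6 = - f 1 2 4" "f 4 5 6 = - f 1 2 4"
    using mid[of 1 1 2 5, simplified canon] mid[of 1 2 2 6, simplified canon]
     mid[of 1 4 4 6, simplified canon] by linarith+
  \<comment> \<open>Entry \<open>m\<close> is the representative of group \<open>m\<close>, with the
    sign that \<open>psi\<close> takes on \<open>m\<close> followed by that triple.\<close>
  define T where "T = (\<chi> m::7. if m = 1 then - f 2 4 7
      else if m = 2 then f 1 4 7
      else if m = 3 then f 1 4 6
      else if m = 4 then - f 1 2 7
      else if m = 5 then - f 1 2 6
      else if m = 6 then f 1 2 5
      else if m = 7 then f 1 2 4 else 0)"
  have T: "T $ 1 = - f 2 4 7" "T $ 2 = f 1 4 7" "T $ 3 = f 1 4 6" "T $ 4 = - f 1 2 7" "T $ 5 = - f 1 2 6"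
     "T $ 6 = f 1 2 5" "T $ 7 = f 1 2 4"
    unfolding T_def by (simp_all add: neq_7)
  have s: "f b a c - psi [T, axis b 1, axis a 1, axis c 1] = - (f a b c - psi [T, axis a 1, axis b 1, axis c 1])"
    "f a c b - psi [T, axis a 1, axis c 1, axis b 1] = - (f a b c - psi [T, axis a 1, axis b 1, axis c 1])" for a b c
    by (simp_all add: alt(1)[of b a c] alt(2)[of a c b] psi_swap(2)[of T "axis b 1"] psi_swap(3)[of T _ "axis c 1"])
  have "f a b c - psi [T, axis a 1, axis b 1, axis c 1] = 0" for a b c
    by (rule alternating3_eq_0I[OF s]) (simp_all add: index_simps T E0 E1 E2 E3 E4 E5 E6 E7)
  then have "f a b c = psi [T, axis a 1, axis b 1, axis c 1]" for a b c
    by (metis eq_iff_diff_eq_0)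
  then show ?thesis by (rule that)
qed

text \<open>\<open>phi\<close> spans the summand of dimension 1 among the three-forms, the
  insertions into \<open>psi\<close> span that of dimension 7, and the two are orthogonal.\<close>

lemma phi_psi_trace:
  "(\<Sum>a\<in>UNIV. \<Sum>b\<in>UNIV. \<Sum>c\<in>UNIV. phi [axis a 1, axis b 1, axis c 1] * psi [v, axis a 1, axis b 1, axis c 1]) = 0"
  by (simp add: index_simps)

text \<open>A basis vector inserted into \<open>psi\<close> leaves four index triples with
  coefficients 1 or -1, each counted in 6 orders.\<close>

lemma psi_norm:
  "(\<Sum>a\<in>UNIV. \<Sum>b\<in>UNIV. \<Sum>c\<in>UNIV. (psi [v, axis a 1, axis b 1, axis c 1])\<^sup>2) = 24 * (v \<bullet> v)"
  by (simp add: index_simps inner_vec_def power2_eq_square)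

section \<open>Torsion of a closed structure, in components\<close>

context
  fixes T :: "7 \<Rightarrow> real ^ 7"
  assumes closed: "\<And>l a b c. psi [T l, axis a 1, axis b 1, axis c 1] - psi [T a, axis l 1, axis b 1, axis c 1]
     + psi [T b, axis l 1, axis a 1, axis c 1] - psi [T c, axis l 1, axis a 1, axis b 1] = 0"
begin

text \<open>The 35 equations on the 49 entries: seven annul the diagonal, the other 28 give skewness
  and seven linear relations among three entries each. The 14 free entries are those of a two-form
  in the Lie algebra of G_2. All right-hand sides use entries above the diagonal, so the list
  rewrites to a normal form.\<close>

lemma closed_torsion:
  shows "T 1 $ 1 = 0" "T 2 $ 2 = 0" "T 3 $ 3 = 0" "T 4 $ 4 = 0" "T 5 $ 5 = 0" "T 6 $ 6 = 0"
     "T 7 $ 7 = 0" "T 3 $ 2 = - T 2 $ 3" "T 5 $ 4 = - T 4 $ 5" "T 7 $ 6 = - T 6 $ 7"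
     "T 6 $ 7 = - T 2 $ 3 - T 4 $ 5" "T 3 $ 1 = - T 1 $ 3" "T 6 $ 4 = - T 4 $ 6" "T 7 $ 5 = - T 5 $ 7"
     "T 5 $ 7 = - T 1 $ 3 + T 4 $ 6" "T 2 $ 1 = - T 1 $ 2" "T 7 $ 4 = - T 4 $ 7" "T 6 $ 5 = - T 5 $ 6"
     "T 5 $ 6 = T 1 $ 2 - T 4 $ 7" "T 5 $ 1 = - T 1 $ 5" "T 6 $ 2 = - T 2 $ 6" "T 7 $ 3 = - T 3 $ 7"
     "T 3 $ 7 = T 1 $ 5 + T 2 $ 6" "T 4 $ 1 = - T 1 $ 4" "T 7 $ 2 = - T 2 $ 7" "T 6 $ 3 = - T 3 $ 6"
     "T 3 $ 6 = - T 1 $ 4 - T 2 $ 7" "T 7 $ 1 = - T 1 $ 7" "T 4 $ 2 = - T 2 $ 4" "T 5 $ 3 = - T 3 $ 5"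
     "T 3 $ 5 = - T 1 $ 7 + T 2 $ 4" "T 6 $ 1 = - T 1 $ 6" "T 5 $ 2 = - T 2 $ 5" "T 4 $ 3 = - T 3 $ 4"
     "T 3 $ 4 = T 1 $ 6 - T 2 $ 5"
proof -
  \<comment> \<open>On the seven index sets of \<open>psi\<close> only the diagonal enters: each
    equation annuls a sum of four diagonal entries, and these seven sums are independent.\<close>
  show "T 1 $ 1 = 0" "T 2 $ 2 = 0" "T 3 $ 3 = 0" "T 4 $ 4 = 0" "T 5 $ 5 = 0" "T 6 $ 6 = 0" "T 7 $ 7 = 0"
    using closed[of 1 2 4 7, simplified index_eval] closed[of 1 2 5 6, simplified index_eval]
     closed[of 1 3 4 6, simplified index_eval] closed[of 1 3 5 7, simplified index_eval]
     closed[of 2 3 4 5, simplified index_eval] closed[of 2 3 6 7, simplified index_eval]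
     closed[of 4 5 6 7, simplified index_eval]
    by linarith+
  show "T 3 $ 2 = - T 2 $ 3" "T 5 $ 4 = - T 4 $ 5" "T 7 $ 6 = - T 6 $ 7" "T 6 $ 7 = - T 2 $ 3 - T 4 $ 5"
    using closed[of 1 2 4 6, simplified index_eval] closed[of 1 2 5 7, simplified index_eval]
     closed[of 1 3 4 7, simplified index_eval] closed[of 1 3 5 6, simplified index_eval]
    by linarith+
  show "T 3 $ 1 = - T 1 $ 3" "T 6 $ 4 = - T 4 $ 6" "T 7 $ 5 = - T 5 $ 7" "T 5 $ 7 = - T 1 $ 3 + T 4 $ 6"
    using closed[of 1 2 4 5, simplified index_eval] closed[of 1 2 6 7, simplified index_eval]
     closed[of 2 3 4 7, simplified index_eval] closed[of 2 3 5 6, simplified index_eval]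
    by linarith+
  show "T 2 $ 1 = - T 1 $ 2" "T 7 $ 4 = - T 4 $ 7" "T 6 $ 5 = - T 5 $ 6" "T 5 $ 6 = T 1 $ 2 - T 4 $ 7"
    using closed[of 1 3 4 5, simplified index_eval] closed[of 1 3 6 7, simplified index_eval]
     closed[of 2 3 4 6, simplified index_eval] closed[of 2 3 5 7, simplified index_eval]
    by linarith+
  show "T 5 $ 1 = - T 1 $ 5" "T 6 $ 2 = - T 2 $ 6" "T 7 $ 3 = - T 3 $ 7" "T 3 $ 7 = T 1 $ 5 + T 2 $ 6"
    using closed[of 1 2 3 4, simplified index_eval] closed[of 1 4 6 7, simplified index_eval]
     closed[of 2 4 5 7, simplified index_eval] closed[of 3 4 5 6, simplified index_eval]
    by linarith+
  show "T 4 $ 1 = - T 1 $ 4" "T 7 $ 2 = - T 2 $ 7" "T 6 $ 3 = - T 3 $ 6" "T 3 $ 6 = - T 1 $ 4 - T 2 $ 7"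
    using closed[of 1 2 3 5, simplified index_eval] closed[of 1 5 6 7, simplified index_eval]
     closed[of 2 4 5 6, simplified index_eval] closed[of 3 4 5 7, simplified index_eval]
    by linarith+
  show "T 7 $ 1 = - T 1 $ 7" "T 4 $ 2 = - T 2 $ 4" "T 5 $ 3 = - T 3 $ 5" "T 3 $ 5 = - T 1 $ 7 + T 2 $ 4"
    using closed[of 1 2 3 6, simplified index_eval] closed[of 1 4 5 6, simplified index_eval]
     closed[of 2 5 6 7, simplified index_eval] closed[of 3 4 6 7, simplified index_eval]
    by linarith+
  show "T 6 $ 1 = - T 1 $ 6" "T 5 $ 2 = - T 2 $ 5" "T 4 $ 3 = - T 3 $ 4" "T 3 $ 4 = T 1 $ 6 - T 2 $ 5"
    using closed[of 1 2 3 7, simplified index_eval] closed[of 1 4 5 7, simplified index_eval]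
     closed[of 2 4 6 7, simplified index_eval] closed[of 3 5 6 7, simplified index_eval]
    by linarith+
qed

text \<open>The factor 2 comes from contracting \<open>phi_contraction\<close> with a skew tensor
  that \<open>phi\<close> annihilates: contraction with \<open>psi\<close> in two slots then
  multiplies it by -2, and the order of the slots here reverses the sign. The proof evaluates the
  components.\<close>

lemma closed_torsion_divergence:
  shows "(\<Sum>m\<in>UNIV. psi [T m, axis m 1, axis j 1, axis k 1]) = 2 * T j $ k"
proof -
  note T = closed_torsion
  have "\<forall>j k. (\<Sum>m\<in>UNIV. psi [T m, axis m 1, axis j 1, axis k 1]) = 2 * T j $ k"
    unfolding forall_7
    by (intro conjI; simp add: index_simps T)
  then show ?thesis by blast
qed

lemma closed_torsion_phi:
  shows "(\<Sum>j\<in>UNIV. \<Sum>k\<in>UNIV. phi [axis a 1, axis j 1, axis k 1] * T j $ k) = 0"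
proof -
  note T = closed_torsion
  have "\<forall>a. (\<Sum>j\<in>UNIV. \<Sum>k\<in>UNIV. phi [axis a 1, axis j 1, axis k 1] * T j $ k) = 0"
    unfolding forall_7
    by (intro conjI; simp add: index_simps T)
  then show ?thesis by blast
qed

text \<open>\<open>N l\<close> is the covariant derivative of \<open>psi\<close> in direction
  \<open>l\<close>, written out by the Leibniz rule, and the hypothesis is the vanishing of its
  alternation. On the space of dimension 14 described by \<open>closed_torsion\<close> the
  alternation is injective.\<close>

lemma closed_torsion_coclosed:
  defines "N \<equiv> \<lambda>l a b c d. \<Sum>i\<in>UNIV. psi [T l, axis a 1, axis b 1, axis i 1] * phi [axis i 1, axis c 1, axis d 1]
      + phi [axis a 1, axis b 1, axis i 1] * psi [T l, axis i 1, axis c 1, axis d 1]"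
  assumes coclosed: "\<And>l a b c d. N l a b c d - N a l b c d + N b l a c d - N c l a b d + N d l a b c = 0"
  shows "T l = 0"
proof -
  note T = closed_torsion
  \<comment> \<open>Each block of three entries bound by one relation of
    \<open>closed_torsion\<close> is detected by three of the five-index equations.\<close>
  have Z1: "T 2 $ 3 = 0" "T 4 $ 5 = 0" "T 6 $ 7 = 0"
    using coclosed[of 1 2 3 4 5, unfolded N_def, simplified index_eval]
     coclosed[of 1 2 3 6 7, unfolded N_def, simplified index_eval]
     coclosed[of 1 4 5 6 7, unfolded N_def, simplified index_eval]
    T(8-11) by linarith+
  have Z2: "T 1 $ 3 = 0" "T 4 $ 6 = 0" "T 5 $ 7 = 0"
    using coclosed[of 1 2 3 4 6, unfolded N_def, simplified index_eval]
     coclosed[of 1 2 3 5 7, unfolded N_def, simplified index_eval]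
     coclosed[of 2 4 5 6 7, unfolded N_def, simplified index_eval]
    T(12-15) by linarith+
  have Z3: "T 1 $ 2 = 0" "T 4 $ 7 = 0" "T 5 $ 6 = 0"
    using coclosed[of 1 2 3 4 7, unfolded N_def, simplified index_eval]
     coclosed[of 1 2 3 5 6, unfolded N_def, simplified index_eval]
     coclosed[of 3 4 5 6 7, unfolded N_def, simplified index_eval]
    T(16-19) by linarith+
  have Z4: "T 1 $ 5 = 0" "T 2 $ 6 = 0" "T 3 $ 7 = 0"
    using coclosed[of 1 2 4 5 6, unfolded N_def, simplified index_eval]
     coclosed[of 1 3 4 5 7, unfolded N_def, simplified index_eval]
     coclosed[of 2 3 4 6 7, unfolded N_def, simplified index_eval]
    T(20-23) by linarith+
  have Z5: "T 1 $ 4 = 0" "T 2 $ 7 = 0" "T 3 $ 6 = 0"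
    using coclosed[of 1 2 4 5 7, unfolded N_def, simplified index_eval]
     coclosed[of 1 3 4 5 6, unfolded N_def, simplified index_eval]
     coclosed[of 2 3 5 6 7, unfolded N_def, simplified index_eval]
    T(24-27) by linarith+
  have Z6: "T 1 $ 7 = 0" "T 2 $ 4 = 0" "T 3 $ 5 = 0"
    using coclosed[of 1 2 4 6 7, unfolded N_def, simplified index_eval]
     coclosed[of 1 3 5 6 7, unfolded N_def, simplified index_eval]
     coclosed[of 2 3 4 5 6, unfolded N_def, simplified index_eval]
    T(28-31) by linarith+
  have Z7: "T 1 $ 6 = 0" "T 2 $ 5 = 0" "T 3 $ 4 = 0"
    using coclosed[of 1 2 5 6 7, unfolded N_def, simplified index_eval]
     coclosed[of 1 3 4 6 7, unfolded N_def, simplified index_eval]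
     coclosed[of 2 3 4 5 7, unfolded N_def, simplified index_eval]
    T(32-35) by linarith+
  have "\<forall>l. T l = 0"
    unfolding forall_7 vec_eq_iff
    by (simp add: T(1-7)) (simp add: T Z1 Z2 Z3 Z4 Z5 Z6 Z7)
  then show ?thesis by blast
qed

end

subsection \<open>Calculus of \<open>C\<^sup>k\<close> functions\<close>

lemma Ck_on_cong:
  assumes "open U" "\<And>x. x \<in> U \<Longrightarrow> f x = g x" "Ck_on k U f"
  shows "Ck_on k U g"
  using assms(2,3)
proof (induction k arbitrary: f g)
  case 0
  then show ?case using continuous_on_cong[of U U f g] by simp
next
  case (Suc k)
  have f: "f differentiable (at x)" "(f has_derivative frechet_derivative f (at x)) (at x)" if "x \<in> U" for x
    using Suc.prems(2) that by (simp_all add: frechet_derivative_works)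
  have g: "(g has_derivative frechet_derivative f (at x)) (at x)" if "x \<in> U" for x
    using f(2)[OF that] \<open>open U\<close> that Suc.prems(1) by (rule has_derivative_transform_within_open)
  have eq: "frechet_derivative f (at x) v = frechet_derivative g (at x) v" if "x \<in> U" for x v
    using frechet_derivative_at[OF g[OF that]] by simp
  have "Ck_on k U (\<lambda>x. frechet_derivative g (at x) v)" for v
    by (rule Suc.IH[OF eq]) (use Suc.prems(2) in simp_all)
  then show ?case using g by (auto simp: differentiable_def)
qed

lemma Ck_on_Suc_imp: "Ck_on (Suc k) U f \<Longrightarrow> Ck_on k U f"
proof (induction k arbitrary: f)
  case 0
  then show ?case
    by (auto intro!: continuous_at_imp_continuous_on differentiable_imp_continuous_within)
next
  case (Suc k)
  then show ?case by (metis Ck_on.simps(2))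
qed

lemma Ck_on_const [simp]: "Ck_on k U (\<lambda>x. c)"
  by (induction k arbitrary: c) auto

lemma frechet_derivative_eqI: "(f has_derivative f') (at x) \<Longrightarrow> frechet_derivative f (at x) v = f' v"
  using frechet_derivative_at by metis

lemma frechet_derivative_add:
  "f differentiable (at x) \<Longrightarrow> g differentiable (at x) \<Longrightarrow>
   frechet_derivative (\<lambda>x. f x + g x) (at x) v = frechet_derivative f (at x) v + frechet_derivative g (at x) v"
  by (intro frechet_derivative_eqI) (auto intro!: derivative_eq_intros simp: frechet_derivative_works)

lemma frechet_derivative_diff:
  "f differentiable (at x) \<Longrightarrow> g differentiable (at x) \<Longrightarrow>
   frechet_derivative (\<lambda>x. f x - g x) (at x) v = frechet_derivative f (at x) v - frechet_derivative g (at x) v"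
  by (intro frechet_derivative_eqI) (auto intro!: derivative_eq_intros simp: frechet_derivative_works)

lemma frechet_derivative_mult:
  fixes f g :: "'a::real_normed_vector \<Rightarrow> real"
  shows "f differentiable (at x) \<Longrightarrow> g differentiable (at x) \<Longrightarrow>
   frechet_derivative (\<lambda>x. f x * g x) (at x) v = frechet_derivative f (at x) v * g x + f x * frechet_derivative g (at x) v"
  by (rule frechet_derivative_eqI[where f' = "\<lambda>v. frechet_derivative f (at x) v * g x + f x * frechet_derivative g (at x) v", simplified])
     (auto intro!: derivative_eq_intros simp: frechet_derivative_works)

lemma frechet_derivative_sum:
  fixes f :: "'i \<Rightarrow> 'a::real_normed_vector \<Rightarrow> 'b::real_normed_vector"
  assumes "\<And>i. i \<in> I \<Longrightarrow> f i differentiable (at x)"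
  shows "frechet_derivative (\<lambda>x. \<Sum>i\<in>I. f i x) (at x) v = (\<Sum>i\<in>I. frechet_derivative (f i) (at x) v)"
  by (rule frechet_derivative_eqI)
    (use assms in \<open>auto intro!: has_derivative_sum simp: frechet_derivative_works\<close>)

lemma Ck_on_add:
  assumes "open U" shows "Ck_on k U f \<Longrightarrow> Ck_on k U g \<Longrightarrow> Ck_on k U (\<lambda>x. f x + g x)"
proof (induction k arbitrary: f g)
  case 0 then show ?case by (auto intro: continuous_intros)
next
  case (Suc k)
  have d: "f differentiable (at x)" "g differentiable (at x)" if "x \<in> U" for x
    using Suc.prems that by simp_all
  have "Ck_on k U (\<lambda>x. frechet_derivative f (at x) v + frechet_derivative g (at x) v)" for v
    using Suc.prems by (intro Suc.IH) simp_all
  then have "Ck_on k U (\<lambda>x. frechet_derivative (\<lambda>x. f x + g x) (at x) v)" for v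
    by (rule Ck_on_cong[OF assms, rotated]) (simp add: frechet_derivative_add d)
  then show ?case using d by simp
qed

lemma Ck_on_mult:
  fixes f g :: "'a::real_normed_vector \<Rightarrow> real"
  assumes "open U" shows "Ck_on k U f \<Longrightarrow> Ck_on k U g \<Longrightarrow> Ck_on k U (\<lambda>x. f x * g x)"
proof (induction k arbitrary: f g)
  case 0 then show ?case by (auto intro: continuous_intros)
next
  case (Suc k)
  have d: "f differentiable (at x)" "g differentiable (at x)" if "x \<in> U" for x
    using Suc.prems that by simp_all
  have "Ck_on k U (\<lambda>x. frechet_derivative f (at x) v * g x + f x * frechet_derivative g (at x) v)" for v
    using Suc.prems Ck_on_Suc_imp[OF Suc.prems(1)] Ck_on_Suc_imp[OF Suc.prems(2)]
    by (intro Ck_on_add[OF assms] Suc.IH) simp_all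
  then have "Ck_on k U (\<lambda>x. frechet_derivative (\<lambda>x. f x * g x) (at x) v)" for v
    by (rule Ck_on_cong[OF assms, rotated]) (simp add: frechet_derivative_mult d)
  then show ?case using d by simp
qed

lemma Ck_on_cmult:
  fixes f :: "'a::real_normed_vector \<Rightarrow> real"
  shows "open U \<Longrightarrow> Ck_on k U f \<Longrightarrow> Ck_on k U (\<lambda>x. c * f x)"
  by (rule Ck_on_mult) auto

lemma Ck_on_diff:
  fixes f g :: "'a::real_normed_vector \<Rightarrow> real"
  shows "open U \<Longrightarrow> Ck_on k U f \<Longrightarrow> Ck_on k U g \<Longrightarrow> Ck_on k U (\<lambda>x. f x - g x)"
  using Ck_on_add[of U k f "\<lambda>x. (-1) * g x"] Ck_on_cmult[of U k g "-1"] by simp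

lemma Ck_on_sum:
  assumes "open U" "\<And>i. i \<in> I \<Longrightarrow> Ck_on k U (f i)"
  shows "Ck_on k U (\<lambda>x. \<Sum>i\<in>I. f i x)"
  using assms(2) by (induction I rule: infinite_finite_induct) (auto intro: Ck_on_add[OF assms(1)])

lemma Ck_on_prod:
  fixes f :: "'i \<Rightarrow> 'a::real_normed_vector \<Rightarrow> real"
  assumes "open U" "\<And>i. i \<in> I \<Longrightarrow> Ck_on k U (f i)"
  shows "Ck_on k U (\<lambda>x. \<Prod>i\<in>I. f i x)"
  using assms(2) by (induction I rule: infinite_finite_induct) (auto intro: Ck_on_mult[OF assms(1)])

lemma Ck_on_power:
  fixes f :: "'a::real_normed_vector \<Rightarrow> real"
  assumes "open U" "Ck_on k U f"
  shows "Ck_on k U (\<lambda>x. f x ^ n)"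
  by (induction n) (auto intro: Ck_on_mult assms)

text \<open>Differentiation lowers the exponent, so the induction keeps \<open>r\<close> arbitrary.
  Real powers are needed for the roots by which the metric is extracted from determinants.\<close>

lemma Ck_on_powr:
  fixes f :: "'a::real_normed_vector \<Rightarrow> real"
  assumes "open U" and pos: "\<And>x. x \<in> U \<Longrightarrow> f x > 0"
  shows "Ck_on k U f \<Longrightarrow> Ck_on k U (\<lambda>x. f x powr r)"
proof (induction k arbitrary: r)
  case 0 then show ?case using pos by (auto intro!: continuous_intros simp: order_less_imp_not_eq2)
next
  case (Suc k)
  have d: "((\<lambda>x. f x powr r) has_derivative (\<lambda>v. r * f x powr (r - 1) * frechet_derivative f (at x) v)) (at x)"
    if "x \<in> U" for x
  proof -
    have "((\<lambda>y. y powr r) has_field_derivative r * f x powr (r - 1)) (at (f x))"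
      using pos[OF that] by (rule has_real_derivative_powr)
    moreover have "(f has_derivative frechet_derivative f (at x)) (at x)"
      using Suc.prems that by (auto simp: frechet_derivative_works)
    ultimately show ?thesis
      unfolding has_field_derivative_def by (rule has_derivative_compose[rotated])
  qed
  have C: "Ck_on k U (\<lambda>x. r * f x powr (r - 1) * frechet_derivative f (at x) v)" for v
    using Suc.prems Suc.IH[OF Ck_on_Suc_imp[OF Suc.prems]] by (intro Ck_on_mult[OF assms(1)]) simp_all
  have "Ck_on k U (\<lambda>x. frechet_derivative (\<lambda>x. f x powr r) (at x) v)" for v
    by (rule Ck_on_cong[OF assms(1) _ C[of v]]) (simp add: frechet_derivative_eqI[OF d])
  then show ?case using d by (auto simp: differentiable_def)
qed

lemma Ck_on_inverse:
  fixes f :: "'a::real_normed_vector \<Rightarrow> real"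
  assumes "open U" and pos: "\<And>x. x \<in> U \<Longrightarrow> f x > 0" and "Ck_on k U f"
  shows "Ck_on k U (\<lambda>x. inverse (f x))"
  by (rule Ck_on_cong[OF assms(1) _ Ck_on_powr[OF assms, of "-1"]])
    (use pos in \<open>auto simp: powr_minus order_less_imp_le\<close>)

lemma Ck_on_Suc_differentiable: "Ck_on (Suc k) U f \<Longrightarrow> x \<in> U \<Longrightarrow> f differentiable (at x)"
  by simp

lemma Ck_on_Suc_deriv: "Ck_on (Suc k) U f \<Longrightarrow> Ck_on k U (\<lambda>x. frechet_derivative f (at x) v)"
  by simp

text \<open>The mean value theorem is applied along \<open>v\<close> to the difference of
  \<open>f\<close> on two parallel segments, and then along \<open>w\<close>. The second difference
  itself is symmetric in \<open>v\<close> and \<open>w\<close>.\<close>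

lemma second_difference_mean_value:
  fixes f :: "'a::real_normed_vector \<Rightarrow> real"
  assumes "Ck_on 2 U f" and "h > 0"
    and inU: "\<And>s t. 0 \<le> s \<Longrightarrow> s \<le> h \<Longrightarrow> 0 \<le> t \<Longrightarrow> t \<le> h \<Longrightarrow> x + s *\<^sub>R v + t *\<^sub>R w \<in> U"
  shows "\<exists>s t. 0 < s \<and> s < h \<and> 0 < t \<and> t < h \<and>
    f (x + h *\<^sub>R v + h *\<^sub>R w) - f (x + h *\<^sub>R v) - f (x + h *\<^sub>R w) + f x =
    h * h * frechet_derivative (\<lambda>y. frechet_derivative f (at y) v) (at (x + s *\<^sub>R v + t *\<^sub>R w)) w"
proof -
  let ?D = "\<lambda>y. frechet_derivative f (at y) v"
  have C: "Ck_on (Suc (Suc 0)) U f" using assms(1) by (simp add: numeral_2_eq_2)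
  have f1: "f differentiable (at y)" if "y \<in> U" for y using C that by (rule Ck_on_Suc_differentiable)
  have f2: "?D differentiable (at y)" if "y \<in> U" for y
    using Ck_on_Suc_deriv[OF C] that by (rule Ck_on_Suc_differentiable)
  have der: "((\<lambda>t. g (a + t *\<^sub>R b)) has_real_derivative frechet_derivative g (at (a + t *\<^sub>R b)) b) (at t)"
    if "g differentiable (at (a + t *\<^sub>R b))" for g :: "'a \<Rightarrow> real" and a b t
  proof -
    have g: "(g has_derivative frechet_derivative g (at (a + t *\<^sub>R b))) (at (a + t *\<^sub>R b))"
      using that by (simp add: frechet_derivative_works)
    have "((\<lambda>t. a + t *\<^sub>R b) has_derivative (\<lambda>s. s *\<^sub>R b)) (at t)"
      by (auto intro!: derivative_eq_intros)
    from has_derivative_compose[OF this g] linear_frechet_derivative[OF that]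
    show ?thesis
      unfolding has_field_derivative_def by (simp add: linear_cmul mult_commute_abs)
  qed
  have "((\<lambda>s. f (x + h *\<^sub>R w + s *\<^sub>R v) - f (x + s *\<^sub>R v)) has_real_derivative
       ?D (x + h *\<^sub>R w + s *\<^sub>R v) - ?D (x + s *\<^sub>R v)) (at s)" if "0 \<le> s" "s \<le> h" for s
    using that inU[of s h] inU[of s 0] \<open>h > 0\<close>
    by (intro DERIV_diff der f1) (auto simp: algebra_simps)
  then obtain s where s: "0 < s" "s < h"
    "(f (x + h *\<^sub>R w + h *\<^sub>R v) - f (x + h *\<^sub>R v)) - (f (x + h *\<^sub>R w + 0 *\<^sub>R v) - f (x + 0 *\<^sub>R v))
     = (h - 0) * (?D (x + h *\<^sub>R w + s *\<^sub>R v) - ?D (x + s *\<^sub>R v))"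
    using MVT2[OF \<open>h > 0\<close>, of "\<lambda>s. f (x + h *\<^sub>R w + s *\<^sub>R v) - f (x + s *\<^sub>R v)"
       "\<lambda>s. ?D (x + h *\<^sub>R w + s *\<^sub>R v) - ?D (x + s *\<^sub>R v)"] by blast
  have "((\<lambda>t. ?D (x + s *\<^sub>R v + t *\<^sub>R w)) has_real_derivative
       frechet_derivative ?D (at (x + s *\<^sub>R v + t *\<^sub>R w)) w) (at t)" if "0 \<le> t" "t \<le> h" for t
    using that s inU[of s t] by (intro der f2) auto
  then obtain t where t: "0 < t" "t < h"
    "?D (x + s *\<^sub>R v + h *\<^sub>R w) - ?D (x + s *\<^sub>R v + 0 *\<^sub>R w)
     = (h - 0) * frechet_derivative ?D (at (x + s *\<^sub>R v + t *\<^sub>R w)) w"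
    using MVT2[OF \<open>h > 0\<close>, of "\<lambda>t. ?D (x + s *\<^sub>R v + t *\<^sub>R w)"
       "\<lambda>t. frechet_derivative ?D (at (x + s *\<^sub>R v + t *\<^sub>R w)) w"] by blast
  show ?thesis
    using s t by (intro exI[of _ s] exI[of _ t]) (simp add: add_ac mult.assoc)
qed

text \<open>One second difference equals both mixed derivatives, taken at two points near
  \<open>x\<close>. Were their values at \<open>x\<close> different, continuity would keep them
  apart at these points as well.\<close>

lemma frechet_derivative_commute:
  fixes f :: "'a::real_normed_vector \<Rightarrow> real"
  assumes "open U" "Ck_on 2 U f" "x \<in> U"
  shows "frechet_derivative (\<lambda>y. frechet_derivative f (at y) v) (at x) w =
    frechet_derivative (\<lambda>y. frechet_derivative f (at y) w) (at x) v"
proof (rule ccontr)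
  let ?F = "\<lambda>v w y. frechet_derivative (\<lambda>y. frechet_derivative f (at y) v) (at y) w"
  assume "?F v w x \<noteq> ?F w v x"
  then have e: "\<bar>?F v w x - ?F w v x\<bar> / 2 > 0" (is "?e > 0") by simp
  have "Ck_on (Suc (Suc 0)) U f" using assms(2) by (simp add: numeral_2_eq_2)
  then have cont: "isCont (?F v w) x" for v w
    using assms(1,3) by (auto simp: continuous_on_eq_continuous_at)
  obtain d1 where d1: "d1 > 0" "\<And>y. dist y x < d1 \<Longrightarrow> dist (?F v w y) (?F v w x) < ?e"
    using cont[of v w] e unfolding continuous_at_eps_delta dist_real_def dist_norm by blast
  obtain d2 where d2: "d2 > 0" "\<And>y. dist y x < d2 \<Longrightarrow> dist (?F w v y) (?F w v x) < ?e"
    using cont[of w v] e unfolding continuous_at_eps_delta dist_real_def dist_norm by blast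
  obtain d3 where d3: "d3 > 0" "ball x d3 \<subseteq> U"
    using assms(1,3) openE by blast
  define d where "d = min d1 (min d2 d3)"
  \<comment> \<open>Both steps together stay within \<open>d / 2\<close>; the summand 1 avoids a
    division by zero.\<close>
  define h where "h = d / (2 * (norm v + norm w + 1))"
  have d: "d > 0" using d1 d2 d3 by (simp add: d_def)
  have n: "norm v + norm w + 1 > 0" by (smt (verit) norm_ge_zero)
  have h: "h > 0" using d n by (simp add: h_def)
  have near: "dist (x + s *\<^sub>R v + t *\<^sub>R w) x < d" if "0 \<le> s" "s \<le> h" "0 \<le> t" "t \<le> h" for s t
  proof -
    have "dist (x + s *\<^sub>R v + t *\<^sub>R w) x \<le> norm (s *\<^sub>R v) + norm (t *\<^sub>R w)"
      by (metis add.assoc add_diff_cancel_left' dist_norm norm_triangle_ineq)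
    also have "\<dots> \<le> h * norm v + h * norm w"
      using that by (intro add_mono) (auto intro!: mult_right_mono)
    also have "\<dots> \<le> h * (norm v + norm w + 1)" using h by (simp add: algebra_simps)
    also have "\<dots> = d / 2" using n by (simp add: h_def field_simps)
    finally show ?thesis using d by simp
  qed
  have inU: "x + s *\<^sub>R v + t *\<^sub>R w \<in> U" if "0 \<le> s" "s \<le> h" "0 \<le> t" "t \<le> h" for s t
    using near[OF that] d3(2) by (auto simp: d_def dist_commute subset_iff)
  obtain s t where st: "0 < s" "s < h" "0 < t" "t < h"
    "f (x + h *\<^sub>R v + h *\<^sub>R w) - f (x + h *\<^sub>R v) - f (x + h *\<^sub>R w) + f x =
      h * h * ?F v w (x + s *\<^sub>R v + t *\<^sub>R w)"
    using second_difference_mean_value[OF assms(2) h inU] by blast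
  have inU': "x + s *\<^sub>R w + t *\<^sub>R v \<in> U" if "0 \<le> s" "s \<le> h" "0 \<le> t" "t \<le> h" for s t
    using inU[of t s] that by (simp add: add_ac)
  obtain s' t' where st': "0 < s'" "s' < h" "0 < t'" "t' < h"
    "f (x + h *\<^sub>R w + h *\<^sub>R v) - f (x + h *\<^sub>R w) - f (x + h *\<^sub>R v) + f x =
      h * h * ?F w v (x + s' *\<^sub>R w + t' *\<^sub>R v)"
    using second_difference_mean_value[OF assms(2) h inU'] by blast
  have "h * h * ?F v w (x + s *\<^sub>R v + t *\<^sub>R w) = h * h * ?F w v (x + s' *\<^sub>R w + t' *\<^sub>R v)"
    using st(5) st'(5)[unfolded add.assoc[of x] add.commute[of "h *\<^sub>R w"], folded add.assoc]
    by (simp only: add.assoc)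
  then have eq: "?F v w (x + s *\<^sub>R v + t *\<^sub>R w) = ?F w v (x + t' *\<^sub>R v + s' *\<^sub>R w)"
    using h by (simp add: add_ac)
  have "dist (?F v w (x + s *\<^sub>R v + t *\<^sub>R w)) (?F v w x) < ?e"
    using near[of s t] st by (intro d1) (auto simp: d_def)
  moreover have "dist (?F w v (x + t' *\<^sub>R v + s' *\<^sub>R w)) (?F w v x) < ?e"
    using near[of t' s'] st' by (intro d2) (auto simp: d_def)
  \<comment> \<open>One number cannot lie within half the gap of both values.\<close>
  moreover have False if "\<bar>c - a\<bar> < \<bar>a - b\<bar> / 2" "\<bar>c - b\<bar> < \<bar>a - b\<bar> / 2" for a b c :: real
    using that by (auto simp: abs_if field_simps split: if_splits)
  ultimately show False using eq unfolding dist_real_def by metis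
qed

subsection \<open>Smoothness of the associated metric\<close>

definition outer :: "real ^ 'n \<Rightarrow> real ^ 'n \<Rightarrow> real ^ 'n ^ 'n" where
  "outer x y = (\<chi> i j. x $ i * y $ j)"

lemma outer_mult_vec: "outer x y *v w = (y \<bullet> w) *\<^sub>R x"
  by (simp add: outer_def matrix_vector_mult_def vec_eq_iff inner_vec_def sum_distrib_left mult_ac)

text \<open>Adding multiples of row \<open>k\<close> to other rows preserves the determinant, and
  for empty \<open>S\<close> Cramer's rule gives the entry of \<open>y\<close>.\<close>

lemma det_rows_axis_replaced:
  fixes x y :: "real ^ 'n"
  assumes "k \<notin> S"
  shows "det ((\<chi> i. if i = k then y else if i \<in> S then axis i 1 + x $ i *s y else axis i 1) :: real ^ 'n ^ 'n) = y $ k"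
  using finite[of S] assms
proof (induction S rule: finite_induct)
  case empty
  have "(\<Sum>i\<in>UNIV. y $ i *s row i (mat 1 :: real ^ 'n ^ 'n)) = y"
    by (simp add: vec_eq_iff row_def mat_def if_distrib cong: if_cong)
  moreover have "row i (mat 1 :: real ^ 'n ^ 'n) = axis i 1" for i
    by (auto simp add: vec_eq_iff row_def mat_def axis_def)
  ultimately show ?case
    using cramer_lemma_transpose[of k y "mat 1 :: real ^ 'n ^ 'n"] by (simp cong: if_cong)
next
  case (insert j S)
  let ?A = "(\<chi> i. if i = k then y else if i \<in> S then axis i 1 + x $ i *s y else axis i 1) :: real ^ 'n ^ 'n"
  have "(\<chi> i. if i = k then y else if i \<in> insert j S then axis i 1 + x $ i *s y else axis i 1) =
     (\<chi> i. if i = j then row j ?A + x $ j *s row k ?A else row i ?A)"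
    using insert by (auto simp: vec_eq_iff row_def)
  then show ?case
    using insert det_row_operation[of j k ?A "x $ j"] by auto
qed

text \<open>The outer product enters row by row. By linearity in row \<open>k\<close> each new
  contribution is a multiple of a determinant from \<open>det_rows_axis_replaced\<close>.\<close>

lemma det_mat_1_plus_outer:
  fixes x y :: "real ^ 'n"
  shows "det (mat 1 + outer x y) = 1 + x \<bullet> y"
proof -
  have "det ((\<chi> i. if i \<in> S then axis i 1 + x $ i *s y else axis i 1) :: real ^ 'n ^ 'n) = 1 + (\<Sum>i\<in>S. x $ i * y $ i)" for S :: "'n set"
    using finite[of S]
  proof (induction S rule: finite_induct)
    case empty
    have "(\<chi> i. axis i 1) = (mat 1 :: real ^ 'n ^ 'n)" by (auto simp: vec_eq_iff mat_def axis_def)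
    then show ?case by simp
  next
    case (insert k S)
    let ?r = "\<lambda>i. if i \<in> S then axis i 1 + x $ i *s y else axis i 1"
    have "(\<chi> i. if i \<in> insert k S then axis i 1 + x $ i *s y else axis i 1) =
      (\<chi> i. if i = k then axis k 1 + x $ k *s y else ?r i)"
      by (auto simp: vec_eq_iff)
    moreover have "(\<chi> i. if i = k then axis k 1 else ?r i) = (\<chi> i. ?r i)"
      using insert by (auto simp: vec_eq_iff)
    moreover have "det (\<chi> i. if i = k then x $ k *s y else ?r i) = x $ k * y $ k"
      using det_row_mul[of k "x $ k" "\<lambda>_. y" ?r] det_rows_axis_replaced[OF insert(2), of y x] by simp
    ultimately show ?case
      using insert det_row_add[of k "\<lambda>_. axis k 1" "\<lambda>_. x $ k *s y" ?r] by simp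
  qed
  from this[of UNIV] have "det (\<chi> i. axis i 1 + x $ i *s y) = 1 + x \<bullet> y"
    by (simp add: inner_vec_def)
  moreover have "(\<chi> i. axis i 1 + x $ i *s y) = mat 1 + outer x y"
    by (auto simp: vec_eq_iff mat_def axis_def outer_def)
  ultimately show ?thesis by simp
qed

lemma matrix_eqI_inner:
  fixes A B :: "real ^ 'n ^ 'n"
  assumes "\<And>v w. v \<bullet> (A *v w) = v \<bullet> (B *v w)"
  shows "A = B"
  by (metis assms matrix_eq vector_eq_ldot)

lemma inner_congruence:
  fixes A P :: "real ^ 'n ^ 'n"
  shows "v \<bullet> ((transpose P ** A ** P) *v w) = (P *v v) \<bullet> (A *v (P *v w))"
proof -
  have "v \<bullet> (transpose P *v y) = (P *v v) \<bullet> y" for y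
    using dot_lmul_matrix[of v "transpose P" y] by (simp add: vector_transpose_matrix)
  then show ?thesis by (simp add: matrix_vector_mul_assoc[symmetric])
qed

lemma phi_linear: "phi [a + b, c, d] = phi [a, c, d] + phi [b, c, d]" "phi [r *\<^sub>R a, c, d] = r * phi [a, c, d]"
  "phi [c, a + b, d] = phi [c, a, d] + phi [c, b, d]" "phi [c, r *\<^sub>R a, d] = r * phi [c, a, d]"
  "phi [c, d, a + b] = phi [c, d, a] + phi [c, d, b]" "phi [c, d, r *\<^sub>R a] = r * phi [c, d, a]"
  unfolding phi_def dual_wedge_3 by (simp_all add: algebra_simps)

definition cross_matrix :: "real ^ 7 \<Rightarrow> real ^ 7 ^ 7" where
  "cross_matrix b = (\<chi> i j. phi [b, axis i 1, axis j 1])"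

lemma linear_expand:
  fixes f :: "real ^ 'n \<Rightarrow> real"
  assumes "linear f"
  shows "f v = (\<Sum>i\<in>UNIV. v $ i * f (axis i 1))"
  using linear_sum[OF assms, of "\<lambda>i. v $ i *\<^sub>R axis i 1" UNIV] basis_expansion[of v]
  by (simp add: linear_cmul[OF assms] scalar_mult_eq_scaleR)

lemma linear_phi: "linear (\<lambda>v. phi [v, a, b])" "linear (\<lambda>v. phi [a, v, b])" "linear (\<lambda>v. phi [a, b, v])"
  by (auto intro!: linearI simp: phi_linear)

lemma cross_matrix_nth: "(cross_matrix b *v w) $ i = phi [b, axis i 1, w]"
  by (simp add: cross_matrix_def matrix_vector_mult_def linear_expand[OF linear_phi(3), of b _ w] mult.commute)

lemma inner_cross_matrix: "v \<bullet> (cross_matrix b *v w) = phi [b, v, w]"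
  by (simp add: inner_vec_def cross_matrix_nth linear_expand[OF linear_phi(2), of b v w])

text \<open>The double cross product formula: \<open>b\<close> occurs twice among the arguments of
  \<open>phi_contraction\<close>, so the \<open>psi\<close> term drops out.\<close>

lemma cross_matrix_square: "cross_matrix b *v (cross_matrix b *v w) = (b \<bullet> w) *\<^sub>R b - (b \<bullet> b) *\<^sub>R w"
proof -
  have "v \<bullet> (cross_matrix b *v (cross_matrix b *v w)) = v \<bullet> ((b \<bullet> w) *\<^sub>R b - (b \<bullet> b) *\<^sub>R w)" for v
  proof -
    have c: "phi [b, axis i 1, w] = phi [axis i 1, w, b]" for i
      using phi_swap(1)[of b "axis i 1" w] phi_swap(2)[of "axis i 1" b w] by simp
    have "v \<bullet> (cross_matrix b *v (cross_matrix b *v w)) = (\<Sum>i\<in>UNIV. phi [b, v, axis i 1] * phi [axis i 1, w, b])"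
      unfolding inner_cross_matrix linear_expand[OF linear_phi(3), of b v "cross_matrix b *v w"]
      by (simp add: c cross_matrix_nth mult.commute)
    also have "\<dots> = (b \<bullet> w) * (v \<bullet> b) - (b \<bullet> b) * (v \<bullet> w)"
      by (simp add: phi_contraction)
    finally show ?thesis by (simp add: inner_diff_right mult.commute)
  qed
  then show ?thesis by (metis vector_eq_ldot)
qed


lemma det_scaleR_matrix: "det (c *\<^sub>R A) = c ^ CARD('n) * det (A :: real ^ 'n ^ 'n)"
proof -
  have "c *\<^sub>R A = (\<chi> i. c *s row i A)" by (simp add: vec_eq_iff row_def)
  moreover have "(\<chi> i. row i A) = A" by (simp add: vec_eq_iff row_def)
  ultimately show ?thesis using det_rows_mul[of "\<lambda>_. c" "\<lambda>i. row i A"] by simp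
qed

text \<open>
  A shear along \<open>b\<close>, of determinant 1, replaces \<open>\<eta>\<close> by a multiple of \<open>b\<close>. The resulting matrix \<open>K\<close>
  has \<open>K K\<^sup>T\<close> equal to a multiple of a rank-one perturbation of the identity.
\<close>
lemma det_cross_matrix_plus_outer:
  assumes "\<eta> \<bullet> b \<noteq> 0"
  shows "(det (cross_matrix b + outer \<eta> \<eta>))\<^sup>2 = (\<eta> \<bullet> b) ^ 4 * (b \<bullet> b) ^ 4"
proof -
  let ?n = "b \<bullet> b" and ?c = "\<eta> \<bullet> b"
  let ?M = "cross_matrix b"
  have n: "?n \<noteq> 0" using assms by auto
  \<comment> \<open>The value for which \<open>l *\<^sub>R b - \<eta>\<close> is orthogonal to
    \<open>b\<close>, so that the shear \<open>P\<close> has determinant 1.\<close>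
  define l where "l = ?c / ?n"
  define P where "P = mat 1 + outer b ((1 / ?c) *\<^sub>R (l *\<^sub>R b - \<eta>))"
  have "det P = 1"
    unfolding P_def det_mat_1_plus_outer using assms n
    by (simp add: l_def inner_diff_right inner_commute[of b \<eta>] diff_divide_distrib)
  define K where "K = ?M + outer (l *\<^sub>R b) (l *\<^sub>R b)"
  have Pv: "P *v v = v + (((l *\<^sub>R b - \<eta>) \<bullet> v) / ?c) *\<^sub>R b" for v
    by (simp add: P_def matrix_vector_mult_add_rdistrib outer_mult_vec)
  have "K = transpose P ** (?M + outer \<eta> \<eta>) ** P"
  proof (rule matrix_eqI_inner)
    fix v w
    have e: "\<eta> \<bullet> (P *v v) = l * (b \<bullet> v)" for v
      using assms by (simp add: Pv inner_add_right inner_diff_left)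
    have "v \<bullet> ((transpose P ** (?M + outer \<eta> \<eta>) ** P) *v w) =
       phi [b, P *v v, P *v w] + (\<eta> \<bullet> (P *v v)) * (\<eta> \<bullet> (P *v w))"
      unfolding inner_congruence
      by (simp add: matrix_vector_mult_add_rdistrib inner_add_right inner_cross_matrix outer_mult_vec inner_commute)
    also have "phi [b, P *v v, P *v w] = phi [b, v, w]"
      unfolding Pv by (simp add: phi_linear)
    finally show "v \<bullet> (K *v w) = v \<bullet> ((transpose P ** (?M + outer \<eta> \<eta>) ** P) *v w)"
      by (simp add: e K_def matrix_vector_mult_add_rdistrib inner_add_right inner_cross_matrix outer_mult_vec inner_commute)
  qed
  then have dK: "det K = det (?M + outer \<eta> \<eta>)"
    using \<open>det P = 1\<close> by (simp add: det_mul)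
  have Kt: "transpose K = outer (l *\<^sub>R b) (l *\<^sub>R b) - ?M"
    unfolding vec_eq_iff
  proof (intro allI)
    fix i j
    have "?M $ j $ i = - (?M $ i $ j)"
      using phi_swap(2)[of b "axis i 1" "axis j 1"] by (simp add: cross_matrix_def)
    then show "transpose K $ i $ j = (outer (l *\<^sub>R b) (l *\<^sub>R b) - ?M) $ i $ j"
      by (simp add: K_def transpose_def outer_def)
  qed
  have mb: "?M *v b = 0"
    by (simp add: vec_eq_iff cross_matrix_nth)
  have bm: "b \<bullet> (?M *v w) = 0" for w
    by (simp add: inner_cross_matrix)
  have "K ** transpose K = ?n *\<^sub>R (mat 1 + outer b ((l ^ 4 - 1 / ?n) *\<^sub>R b))"
  proof (rule matrix_eqI_inner)
    fix v w
    have "transpose K *v w = (l\<^sup>2 * (b \<bullet> w)) *\<^sub>R b - ?M *v w"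
      by (simp add: Kt matrix_vector_mult_diff_rdistrib outer_mult_vec power2_eq_square mult_ac)
    then have "K *v (transpose K *v w) = - (?M *v (?M *v w)) + (l\<^sup>2 * (l\<^sup>2 * (b \<bullet> w)) * ?n) *\<^sub>R b"
      by (simp add: K_def matrix_vector_mult_add_rdistrib outer_mult_vec matrix_vector_mult_diff_distrib
          matrix_vector_mult_scaleR mb bm inner_diff_right power2_eq_square mult_ac)
    also have "\<dots> = ?n *\<^sub>R w + (l^4 * ?n * (b \<bullet> w) - b \<bullet> w) *\<^sub>R b"
      by (simp add: cross_matrix_square algebra_simps power2_eq_square power4_eq_xxxx)
    also have "\<dots> = (?n *\<^sub>R (mat 1 + outer b ((l ^ 4 - 1 / ?n) *\<^sub>R b))) *v w"
      using n by (simp add: scaleR_matrix_vector_assoc[symmetric] matrix_vector_mult_add_rdistrib outer_mult_vec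
          algebra_simps)
    finally show "v \<bullet> ((K ** transpose K) *v w) =
        v \<bullet> ((?n *\<^sub>R (mat 1 + outer b ((l ^ 4 - 1 / ?n) *\<^sub>R b))) *v w)"
      by (simp add: matrix_vector_mul_assoc[symmetric])
  qed
  then have "(det K)\<^sup>2 = det (?n *\<^sub>R (mat 1 + outer b ((l ^ 4 - 1 / ?n) *\<^sub>R b)))"
    by (metis det_mul det_transpose power2_eq_square)
  also have "\<dots> = ?n ^ 7 * (1 + (l ^ 4 - 1 / ?n) * ?n)"
    by (simp add: det_scaleR_matrix det_mat_1_plus_outer)
  also have "\<dots> = ?n ^ 8 * l ^ 4"
    using n by (simp add: field_simps eval_nat_numeral)
  also have "\<dots> = ?c ^ 4 * ?n ^ 4"
    using n by (simp add: l_def field_simps eval_nat_numeral)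
  finally show ?thesis using dK by simp
qed


lemma Ck_on_det:
  fixes F :: "'a::real_normed_vector \<Rightarrow> real ^ 'n ^ 'n"
  assumes "open U" "\<And>i j. Ck_on k U (\<lambda>x. F x $ i $ j)"
  shows "Ck_on k U (\<lambda>x. det (F x))"
  unfolding det_def using assms by (intro Ck_on_sum Ck_on_mult Ck_on_prod) auto

text \<open>The structure in one coordinate domain. \<open>u\<close> is a frame at each point
  separately; smoothness is given for \<open>s\<close> and has to be derived for
  \<open>g\<close>.\<close>

locale g2_domain =
  fixes U :: "(real ^ 7) set" and s :: "real ^ 7 \<Rightarrow> (real ^ 7) list \<Rightarrow> real"
    and g :: "real ^ 7 \<Rightarrow> real ^ 7 ^ 7" and u :: "real ^ 7 \<Rightarrow> real ^ 7 \<Rightarrow> real ^ 7"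
  assumes open_U: "open U"
    and smooth_s: "Ck_on k U (\<lambda>x. s x [a, b, c])"
    and linear_u: "x \<in> U \<Longrightarrow> linear (u x)"
    and bij_u: "x \<in> U \<Longrightarrow> bij (u x)"
    and s_eq: "x \<in> U \<Longrightarrow> s x [a, b, c] = phi [u x a, u x b, u x c]"
    and g_eq: "x \<in> U \<Longrightarrow> g x $ i $ j = u x (axis i 1) \<bullet> u x (axis j 1)"
begin

lemma g_inner: "x \<in> U \<Longrightarrow> a \<bullet> (g x *v b) = u x a \<bullet> u x b"
proof -
  assume x: "x \<in> U"
  have "linear (\<lambda>b. u x a \<bullet> u x b)" for a
    using linear_compose[OF linear_u[OF x] bounded_linear.linear[OF bounded_linear_inner_right]] by (simp add: o_def)
  note e = linear_expand[OF this]
  have "u x a \<bullet> u x b = (\<Sum>i\<in>UNIV. a $ i * (\<Sum>j\<in>UNIV. b $ j * (u x (axis j 1) \<bullet> u x (axis i 1))))"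
    using e[of a b] e[of b a] by (subst inner_commute, subst e, subst inner_commute, subst e) (simp add: inner_commute)
  then show ?thesis
    by (simp add: inner_vec_def matrix_vector_mult_def g_eq[OF x] inner_commute mult.commute)
qed

text \<open>By \<open>det_g\<close> this is the Riemannian volume density, the square root of
  \<open>det (g x)\<close>.\<close>

definition density :: "real ^ 7 \<Rightarrow> real" where
  "density x = \<bar>det (matrix (u x))\<bar>"

lemma density_pos: "x \<in> U \<Longrightarrow> density x > 0"
  using invertible_eq_bij[of "matrix (u x)"] invertible_det_nz[of "matrix (u x)"]
    bij_u[of x] linear_u[of x]
  by (auto simp: density_def matrix_works)

text \<open>
  The form does not give the metric polynomially, but \<open>det (s(a, \<cdot>, \<cdot>) + a \<otimes> a)\<close>, where \<open>a\<close> also serves as a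
  covector, is a polynomial in \<open>s\<close> whose square is a power of \<open>|det u| |u a|\<^sup>2\<close> up to a constant.
\<close>
lemma density_norm_smooth:
  "Ck_on k U (\<lambda>x. density x * (u x a \<bullet> u x a))"
proof (cases "a = 0")
  case True
  have "u x 0 = 0" if "x \<in> U" for x using linear_u[OF that] by (rule linear_0)
  then show ?thesis
    using True by (intro Ck_on_cong[OF open_U _ Ck_on_const[of k U 0]]) simp
next
  case False
  define N where "N x = (\<chi> i j. s x [a, axis i 1, axis j 1] + a $ i * a $ j)" for x
  define f where "f x = (det (N x))\<^sup>2" for x
  have fC: "Ck_on k U f"
    unfolding f_def by (intro Ck_on_power Ck_on_det open_U) (auto simp: N_def intro!: Ck_on_add open_U smooth_s)
  have f: "f x = (density x) ^ 4 * (a \<bullet> a) ^ 4 * (u x a \<bullet> u x a) ^ 4" if x: "x \<in> U" for x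
  proof -
    let ?u = "matrix (u x)"
    have u: "?u *v v = u x v" for v using linear_u[OF x] by (simp add: matrix_works)
    have "invertible (transpose ?u)"
      using density_pos[OF x] by (simp add: invertible_det_nz density_def)
    \<comment> \<open>\<open>\<eta>\<close> is the covector \<open>a\<close> carried over by the
      frame; it makes \<open>N x\<close> congruent to the matrix of
      \<open>det_cross_matrix_plus_outer\<close>.\<close>
    then obtain \<eta> where \<eta>: "transpose ?u *v \<eta> = a"
      by (metis invertible_eq_bij bij_pointE)
    have \<eta>u: "\<eta> \<bullet> u x v = a \<bullet> v" for v
      by (metis \<eta> dot_lmul_matrix transpose_matrix_vector u)
    have "N x = transpose ?u ** (cross_matrix (u x a) + outer \<eta> \<eta>) ** ?u"
    proof (rule matrix_eqI_inner)
      fix v w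
      have "linear (\<lambda>w. phi [u x a, v, u x w])" "linear (\<lambda>w. phi [u x a, u x w, v])" for v
        using linear_compose[OF linear_u[OF x] linear_phi(3)] linear_compose[OF linear_u[OF x] linear_phi(2)]
        by (simp_all add: o_def)
      note e = linear_expand[OF this(1)] linear_expand[OF this(2)]
      have "(\<Sum>i\<in>UNIV. \<Sum>j\<in>UNIV. v $ i * (w $ j * phi [u x a, u x (axis i 1), u x (axis j 1)])) =
         phi [u x a, u x v, u x w]"
        by (subst e(2), subst e(1)) (simp add: sum_distrib_left)
      moreover have "(\<Sum>i\<in>UNIV. \<Sum>j\<in>UNIV. v $ i * (w $ j * (a $ i * a $ j))) = (a \<bullet> v) * (a \<bullet> w)"
        by (simp add: inner_vec_def sum_product mult_ac)
      ultimately have "v \<bullet> (N x *v w) = phi [u x a, u x v, u x w] + (a \<bullet> v) * (a \<bullet> w)"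
        by (simp add: inner_vec_def matrix_vector_mult_def N_def s_eq[OF x] sum_distrib_left algebra_simps sum.distrib)
      then show "v \<bullet> (N x *v w) = v \<bullet> ((transpose ?u ** (cross_matrix (u x a) + outer \<eta> \<eta>) ** ?u) *v w)"
        unfolding inner_congruence u
        by (simp add: matrix_vector_mult_add_rdistrib inner_add_right inner_cross_matrix outer_mult_vec \<eta>u
            inner_commute[of "u x v"])
    qed
    then have "det (N x) = (det ?u)\<^sup>2 * det (cross_matrix (u x a) + outer \<eta> \<eta>)"
      by (simp add: det_mul power2_eq_square)
    moreover have "(density x) ^ 4 = (det ?u) ^ 4"
      by (simp add: density_def power_even_abs)
    ultimately show ?thesis
      using det_cross_matrix_plus_outer[of \<eta> "u x a"] False
      by (simp add: f_def power_mult_distrib \<eta>u flip: power_mult)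
  qed
  have u0: "u x a \<bullet> u x a > 0" if "x \<in> U" for x
    using linear_injective_0[OF linear_u[OF that]] bij_u[OF that] False by (auto simp: bij_def)
  have fpos: "f x > 0" if "x \<in> U" for x
    using f[OF that] density_pos[OF that] u0[OF that] False by simp
  \<comment> \<open>Positivity singles out the fourth root. The constant
    \<open>a \<bullet> a\<close> is divided off afterwards.\<close>
  have "f x powr (1/4) = density x * (a \<bullet> a) * (u x a \<bullet> u x a)" if x: "x \<in> U" for x
  proof -
    have "f x = (density x * (a \<bullet> a) * (u x a \<bullet> u x a)) ^ 4"
      by (simp add: f[OF x] power_mult_distrib)
    moreover have "density x * (a \<bullet> a) * (u x a \<bullet> u x a) > 0"
      using density_pos[OF x] u0[OF x] False by simp
    ultimately show ?thesis
      by (simp add: powr_powr flip: powr_numeral)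
  qed
  then show ?thesis
    using False
    by (intro Ck_on_cong[OF open_U _ Ck_on_cmult[OF open_U Ck_on_powr[OF open_U fpos fC, of "1/4"], of "1 / (a \<bullet> a)"]])
      simp_all
qed

text \<open>Polarization of the quadratic form in \<open>density_norm_smooth\<close>.\<close>

lemma density_g_smooth: "Ck_on k U (\<lambda>x. density x * g x $ i $ j)"
proof -
  let ?q = "\<lambda>a x. density x * (u x a \<bullet> u x a)"
  let ?e = "axis i 1 :: real ^ 7" and ?f = "axis j 1 :: real ^ 7"
  have "Ck_on k U (\<lambda>x. (1/2) * (?q (?e + ?f) x - ?q ?e x - ?q ?f x))"
    by (intro Ck_on_cmult Ck_on_diff density_norm_smooth open_U)
  then show ?thesis
    by (rule Ck_on_cong[OF open_U, rotated])
      (simp add: g_eq linear_add[OF linear_u] inner_add_left inner_add_right inner_commute field_simps)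
qed

lemma det_g: "x \<in> U \<Longrightarrow> det (g x) = (density x)\<^sup>2"
proof -
  assume x: "x \<in> U"
  have u: "matrix (u x) *v v = u x v" for v
    using linear_u[OF x] by (simp add: matrix_works)
  have "g x = transpose (matrix (u x)) ** mat 1 ** matrix (u x)"
    by (rule matrix_eqI_inner, subst inner_congruence) (simp add: g_inner[OF x] u)
  then show ?thesis by (simp add: density_def det_mul power2_eq_square)
qed

text \<open>In dimension 7 the scaling contributes the seventh power of the density and
  \<open>det (g x)\<close> its square, so the density is the ninth root of a smooth positive
  determinant.\<close>

lemma density_smooth: "Ck_on k U density"
proof -
  let ?W = "\<lambda>x. det (density x *\<^sub>R g x)"
  have W: "?W x = density x ^ 9" if "x \<in> U" for x
    by (simp add: det_scaleR_matrix det_g[OF that] flip: power_add)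
  have C: "Ck_on k U ?W"
    by (rule Ck_on_det[OF open_U]) (simp add: density_g_smooth)
  have pos: "?W x > 0" if "x \<in> U" for x using W[OF that] density_pos[OF that] by simp
  have eq: "?W x powr (1/9) = density x" if "x \<in> U" for x
    unfolding W[OF that] using density_pos[OF that] by (simp add: powr_powr flip: powr_numeral)
  show ?thesis
    by (rule Ck_on_cong[OF open_U eq Ck_on_powr[OF open_U pos C]])
qed

lemma g_smooth: "Ck_on k U (\<lambda>x. g x $ i $ j)"
  by (rule Ck_on_cong[OF open_U _ Ck_on_mult[OF open_U density_g_smooth Ck_on_inverse[OF open_U density_pos density_smooth], of k i j]])
    (use density_pos in force)+

end

subsection \<open>The Levi-Civita connection in coordinates\<close>

abbreviation dderiv :: "('a::real_normed_vector \<Rightarrow> 'b::real_normed_vector) \<Rightarrow> 'a \<Rightarrow> 'a \<Rightarrow> 'b" where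
  "dderiv f x v \<equiv> frechet_derivative f (at x) v"

lemma sum_rotate3: "(\<Sum>k\<in>A. \<Sum>i\<in>B. \<Sum>j\<in>C. f k i j) = (\<Sum>i\<in>B. \<Sum>j\<in>C. \<Sum>k\<in>A. f k i j)"
  by (subst sum.swap) (intro sum.cong refl sum.swap)

lemma sum_rotate4:
  "(\<Sum>k\<in>A. \<Sum>i\<in>B. \<Sum>j\<in>C. \<Sum>l\<in>D. f k i j l) = (\<Sum>i\<in>B. \<Sum>j\<in>C. \<Sum>l\<in>D. \<Sum>k\<in>A. f k i j l)"
  by (subst sum.swap) (intro sum.cong refl sum_rotate3)

lemma frechet_derivative_linear_dir:
  assumes "f differentiable (at x)"
  shows "dderiv f x (v + w) = dderiv f x v + dderiv f x w"
    "dderiv f x (c *\<^sub>R v) = c *\<^sub>R dderiv f x v"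
  using linear_frechet_derivative[OF assms] by (simp_all add: linear_add linear_cmul)

lemma linear_frechet_derivative_param:
  fixes f :: "real ^ 'm \<Rightarrow> 'v::real_vector \<Rightarrow> real"
  assumes "open U" "x \<in> U" and lin: "\<And>y. y \<in> U \<Longrightarrow> linear (f y)"
    and d: "\<And>a. (\<lambda>y. f y a) differentiable (at x)"
  shows "linear (\<lambda>a. dderiv (\<lambda>y. f y a) x v)"
proof (rule linearI)
  fix a b
  have "frechet_derivative (\<lambda>y. f y a + f y b) (at x) = frechet_derivative (\<lambda>y. f y (a + b)) (at x)"
    by (rule frechet_derivative_transform_within_open[OF differentiable_add[OF d d] assms(1,2)])
      (simp add: linear_add[OF lin])
  then show "dderiv (\<lambda>y. f y (a + b)) x v =
      dderiv (\<lambda>y. f y a) x v + dderiv (\<lambda>y. f y b) x v"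
    using frechet_derivative_add[OF d d, of a b v] by simp
next
  fix r a
  have d': "(\<lambda>y. r * f y a) differentiable (at x)"
    using differentiable_mult[OF _ d, of "\<lambda>_. r" a] by simp
  have "frechet_derivative (\<lambda>y. r * f y a) (at x) = frechet_derivative (\<lambda>y. f y (r *\<^sub>R a)) (at x)"
    by (rule frechet_derivative_transform_within_open[OF d' assms(1,2)])
      (simp add: linear_cmul[OF lin])
  then show "dderiv (\<lambda>y. f y (r *\<^sub>R a)) x v = r *\<^sub>R dderiv (\<lambda>y. f y a) x v"
    using frechet_derivative_mult[OF _ d, of "\<lambda>_. r" a v] by simp
qed

definition vector_deriv :: "(real ^ 'n \<Rightarrow> real ^ 'm) \<Rightarrow> real ^ 'n \<Rightarrow> real ^ 'n \<Rightarrow> real ^ 'm" where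
  "vector_deriv Z x v = (\<chi> i. dderiv (\<lambda>y. Z y $ i) x v)"

lemma linear_apply_Ck:
  fixes F :: "'a::real_normed_vector \<Rightarrow> real ^ 'n \<Rightarrow> real"
  assumes "open U" "\<And>y. y \<in> U \<Longrightarrow> linear (F y)"
    and "\<And>i. Ck_on k U (\<lambda>y. F y (axis i 1))" "\<And>i. Ck_on k U (\<lambda>y. Z y $ i)"
  shows "Ck_on k U (\<lambda>y. F y (Z y))"
proof (rule Ck_on_cong[OF assms(1)])
  show "(\<Sum>i\<in>UNIV. Z y $ i * F y (axis i 1)) = F y (Z y)" if "y \<in> U" for y
    by (rule linear_expand[OF assms(2)[OF that], symmetric])
  show "Ck_on k U (\<lambda>y. \<Sum>i\<in>UNIV. Z y $ i * F y (axis i 1))"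
    by (intro Ck_on_sum Ck_on_mult assms)
qed

text \<open>The product rule for a varying linear map applied to a varying vector; expansion over
  the basis reduces it to products of real functions.\<close>

lemma frechet_derivative_linear_apply:
  fixes F :: "real ^ 'm \<Rightarrow> real ^ 'n \<Rightarrow> real"
  assumes "open U" "x \<in> U" "\<And>y. y \<in> U \<Longrightarrow> linear (F y)"
    and F: "\<And>i. (\<lambda>y. F y (axis i 1)) differentiable (at x)" and Z: "\<And>i. (\<lambda>y. Z y $ i) differentiable (at x)"
  shows "dderiv (\<lambda>y. F y (Z y)) x v =
    dderiv (\<lambda>y. F y (Z x)) x v + F x (vector_deriv Z x v)"
proof -
  have tr: "dderiv (\<lambda>y. F y (W y)) x v =
      dderiv (\<lambda>y. \<Sum>i\<in>UNIV. W y $ i * F y (axis i 1)) x v"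
    if "\<And>i. (\<lambda>y. W y $ i) differentiable (at x)" for W
  proof -
    have d: "(\<lambda>y. \<Sum>i\<in>UNIV. W y $ i * F y (axis i 1)) differentiable (at x)"
      using that F by (intro differentiable_sum differentiable_mult) auto
    have "frechet_derivative (\<lambda>y. \<Sum>i\<in>UNIV. W y $ i * F y (axis i 1)) (at x) = frechet_derivative (\<lambda>y. F y (W y)) (at x)"
      by (rule frechet_derivative_transform_within_open[OF d assms(1,2)]) (rule linear_expand[OF assms(3), symmetric])
    then show ?thesis by simp
  qed
  have a: "dderiv (\<lambda>y. F y (Z y)) x v =
      (\<Sum>i\<in>UNIV. dderiv (\<lambda>y. Z y $ i) x v * F x (axis i 1) +
        Z x $ i * dderiv (\<lambda>y. F y (axis i 1)) x v)"
    using F Z by (subst tr) (simp_all add: frechet_derivative_sum frechet_derivative_mult differentiable_mult)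
  have b: "dderiv (\<lambda>y. F y (Z x)) x v =
      (\<Sum>i\<in>UNIV. Z x $ i * dderiv (\<lambda>y. F y (axis i 1)) x v)"
    using F by (subst tr) (simp_all add: frechet_derivative_sum frechet_derivative_mult differentiable_mult)
  show ?thesis
    unfolding a b linear_expand[OF assms(3)[OF assms(2)], of "vector_deriv Z x v"]
    by (simp add: sum.distrib vector_deriv_def)
qed

locale metric_domain =
  fixes U :: "(real ^ 'n) set" and g :: "real ^ 'n \<Rightarrow> real ^ 'n ^ 'n"
  assumes open_U: "open U"
    and g_smooth: "Ck_on k U (\<lambda>x. g x $ i $ j)"
    and g_sym: "x \<in> U \<Longrightarrow> g x $ i $ j = g x $ j $ i"
    and det_g_pos: "x \<in> U \<Longrightarrow> det (g x) > 0"
begin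

definition G :: "real ^ 'n \<Rightarrow> real ^ 'n \<Rightarrow> real ^ 'n \<Rightarrow> real" where
  "G x a b = a \<bullet> (g x *v b)"

text \<open>The covariant derivative in direction \<open>v\<close> of the vector field with constant
  coordinates \<open>w\<close>.\<close>

definition Gamma :: "real ^ 'n \<Rightarrow> real ^ 'n \<Rightarrow> real ^ 'n \<Rightarrow> real ^ 'n" where
  "Gamma x v w = (\<chi> k. \<Sum>i\<in>UNIV. \<Sum>j\<in>UNIV. v $ i * w $ j * christoffel g k i j x)"

abbreviation P where "P x \<equiv> matrix_inv (g x)"

lemma Ck_differentiable: "(\<And>k. Ck_on k U f) \<Longrightarrow> x \<in> U \<Longrightarrow> f differentiable (at x)"
  using Ck_on_Suc_differentiable by blast

lemma G_linear: "linear (\<lambda>a. G x a b)" "linear (\<lambda>b. G x a b)"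
  by (auto intro!: linearI simp: G_def inner_add_left inner_add_right matrix_vector_right_distrib matrix_vector_mult_scaleR)

lemma G_sym: "x \<in> U \<Longrightarrow> G x a b = G x b a"
proof -
  assume "x \<in> U"
  then have "transpose (g x) = g x" by (simp add: transpose_def vec_eq_iff g_sym)
  then show ?thesis
    unfolding G_def by (metis dot_lmul_matrix inner_commute vector_transpose_matrix)
qed

lemma G_expand: "G x a b = (\<Sum>i\<in>UNIV. \<Sum>j\<in>UNIV. a $ i * b $ j * g x $ i $ j)"
  by (simp add: G_def inner_vec_def matrix_vector_mult_def sum_distrib_left mult_ac)

lemma G_smooth: "Ck_on k U (\<lambda>x. G x a b)"
  unfolding G_expand by (intro Ck_on_sum Ck_on_cmult open_U g_smooth)

lemma P_g:
  assumes "x \<in> U"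
  shows "P x ** g x = mat 1" "g x ** P x = mat 1"
proof -
  have "invertible (g x)" using det_g_pos[OF assms] by (simp add: invertible_det_nz)
  then have "g x ** P x = mat 1 \<and> P x ** g x = mat 1"
    unfolding invertible_def matrix_inv_def by (rule someI_ex)
  then show "P x ** g x = mat 1" "g x ** P x = mat 1" by auto
qed

lemma P_sym: "x \<in> U \<Longrightarrow> P x $ i $ j = P x $ j $ i"
proof -
  assume x: "x \<in> U"
  have tg: "transpose (g x) = g x" using x by (simp add: transpose_def vec_eq_iff g_sym)
  have "transpose (P x) ** g x = transpose (g x ** P x)"
    by (simp add: matrix_transpose_mul tg)
  then have tP: "transpose (P x) ** g x = mat 1" by (simp add: P_g[OF x] transpose_mat)
  have "transpose (P x) = transpose (P x) ** (g x ** P x)" by (simp add: P_g[OF x])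
  also have "\<dots> = P x" by (simp only: matrix_mul_assoc tP matrix_mul_lid)
  finally have "transpose (P x) = P x" .
  then have "transpose (P x) $ i $ j = P x $ i $ j" by simp
  then show ?thesis by (simp add: transpose_def)
qed

text \<open>Cramer's rule: each entry is a determinant of smooth functions divided by the positive
  function \<open>det (g x)\<close>.\<close>

lemma P_smooth: "Ck_on k U (\<lambda>x. P x $ i $ j)"
proof -
  let ?N = "\<lambda>x. (\<chi> a b. if b = i then axis j 1 $ a else g x $ a $ b) :: real ^ 'n ^ 'n"
  have eq: "det (?N x) * inverse (det (g x)) = P x $ i $ j" if x: "x \<in> U" for x
  proof -
    have "g x *v (P x *v axis j 1) = axis j 1"
      using P_g[OF x] by (simp add: matrix_vector_mul_assoc)
    then have "P x *v axis j 1 = (\<chi> k. det (\<chi> a b. if b = k then axis j 1 $ a else g x $ a $ b) / det (g x))"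
      using cramer[of "g x" "P x *v axis j 1" "axis j 1"] det_g_pos[OF x] by simp
    moreover have "(P x *v axis j 1) $ i = P x $ i $ j"
      by (simp add: matrix_vector_mul_component inner_axis)
    ultimately show ?thesis by (simp add: divide_inverse)
  qed
  have "Ck_on k U (\<lambda>x. ?N x $ a $ b)" for a b
    by (cases "b = i") (simp_all add: g_smooth)
  then show ?thesis
    by (intro Ck_on_cong[OF open_U eq] Ck_on_mult Ck_on_inverse Ck_on_det open_U g_smooth det_g_pos) auto
qed

lemma christoffel_smooth: "Ck_on k U (christoffel g a i j)"
  unfolding christoffel_def[abs_def] pderivative_def[abs_def]
  by (intro Ck_on_cmult Ck_on_sum Ck_on_mult Ck_on_add Ck_on_diff open_U P_smooth Ck_on_Suc_deriv g_smooth)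

lemma Gamma_smooth: "Ck_on k U (\<lambda>x. Gamma x v w $ i)"
  unfolding Gamma_def by (simp, intro Ck_on_cmult Ck_on_sum open_U christoffel_smooth)

lemma Gamma_linear: "linear (\<lambda>v. Gamma x v w)" "linear (\<lambda>w. Gamma x v w)"
  by (auto intro!: linearI simp: Gamma_def vec_eq_iff algebra_simps sum.distrib sum_distrib_left)

lemma G_deriv_expand:
  assumes "x \<in> U"
  shows "dderiv (\<lambda>y. G y a b) x v =
    (\<Sum>i\<in>UNIV. \<Sum>j\<in>UNIV. \<Sum>l\<in>UNIV. v $ i * a $ j * b $ l * pderivative i (\<lambda>y. g y $ j $ l) x)"
proof -
  have d: "(\<lambda>y. G y a b) differentiable (at x)" "(\<lambda>y. g y $ i $ j) differentiable (at x)" for a b i j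
    using Ck_differentiable assms G_smooth g_smooth by blast+
  have e: "dderiv (\<lambda>y. G y a b) x w =
    (\<Sum>j\<in>UNIV. \<Sum>l\<in>UNIV. a $ j * b $ l * dderiv (\<lambda>y. g y $ j $ l) x w)" for w
    unfolding G_expand using d(2)
    by (simp add: frechet_derivative_sum frechet_derivative_mult differentiable_mult differentiable_sum)
  show ?thesis
    by (subst linear_expand[OF linear_frechet_derivative[OF d(1)[of a b]], of v], unfold e)
      (simp add: pderivative_def sum_distrib_left mult_ac)
qed

text \<open>Koszul's formula for fields with constant coordinates, whose Lie brackets
  vanish.\<close>

lemma koszul:
  assumes x: "x \<in> U"
  shows "2 * G x (Gamma x v a) b = dderiv (\<lambda>y. G y a b) x v
     + dderiv (\<lambda>y. G y v b) x a - dderiv (\<lambda>y. G y v a) x b"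
proof -
  let ?C = "\<lambda>i j l. pderivative i (\<lambda>y. g y $ j $ l) x + pderivative j (\<lambda>y. g y $ i $ l) x
         - pderivative l (\<lambda>y. g y $ i $ j) x"
  have Pg: "(\<Sum>k\<in>UNIV. P x $ k $ l * (g x *v b) $ k) = b $ l" for l
  proof -
    have "(\<Sum>k\<in>UNIV. P x $ k $ l * (g x *v b) $ k) = (P x *v (g x *v b)) $ l"
      by (simp add: matrix_vector_mult_def P_sym[OF x, of _ l])
    then show ?thesis using P_g[OF x] by (simp add: matrix_vector_mul_assoc)
  qed
  have "2 * G x (Gamma x v a) b =
     (\<Sum>k\<in>UNIV. (\<Sum>i\<in>UNIV. \<Sum>j\<in>UNIV. \<Sum>l\<in>UNIV. v $ i * a $ j * (P x $ k $ l * ?C i j l)) * (g x *v b) $ k)"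
    by (simp add: G_def inner_vec_def Gamma_def christoffel_def sum_distrib_left sum_distrib_right mult_ac)
  also have "\<dots> = (\<Sum>i\<in>UNIV. \<Sum>j\<in>UNIV. \<Sum>l\<in>UNIV. v $ i * a $ j * ?C i j l * (\<Sum>k\<in>UNIV. P x $ k $ l * (g x *v b) $ k))"
    unfolding sum_distrib_right sum_distrib_left
    by (subst sum_rotate4) (simp add: mult_ac)
  also have "\<dots> = (\<Sum>i\<in>UNIV. \<Sum>j\<in>UNIV. \<Sum>l\<in>UNIV. v $ i * a $ j * b $ l * ?C i j l)"
    unfolding Pg by (simp add: mult_ac)
  also have "\<dots> = (\<Sum>i\<in>UNIV. \<Sum>j\<in>UNIV. \<Sum>l\<in>UNIV. v $ i * a $ j * b $ l * pderivative i (\<lambda>y. g y $ j $ l) x)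
    + (\<Sum>i\<in>UNIV. \<Sum>j\<in>UNIV. \<Sum>l\<in>UNIV. v $ i * a $ j * b $ l * pderivative j (\<lambda>y. g y $ i $ l) x)
    - (\<Sum>i\<in>UNIV. \<Sum>j\<in>UNIV. \<Sum>l\<in>UNIV. v $ i * a $ j * b $ l * pderivative l (\<lambda>y. g y $ i $ j) x)"
    by (simp add: sum.distrib sum_subtractf algebra_simps)
  also have "(\<Sum>i\<in>UNIV. \<Sum>j\<in>UNIV. \<Sum>l\<in>UNIV. v $ i * a $ j * b $ l * pderivative j (\<lambda>y. g y $ i $ l) x)
    = dderiv (\<lambda>y. G y v b) x a"
    unfolding G_deriv_expand[OF x] by (subst sum.swap) (simp add: mult_ac)
  also have "(\<Sum>i\<in>UNIV. \<Sum>j\<in>UNIV. \<Sum>l\<in>UNIV. v $ i * a $ j * b $ l * pderivative l (\<lambda>y. g y $ i $ j) x)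
    = dderiv (\<lambda>y. G y v a) x b"
    unfolding G_deriv_expand[OF x]
    by (subst sum_rotate3[symmetric]) (simp add: mult_ac)
  finally show ?thesis by (simp add: G_deriv_expand[OF x])
qed

lemma G_sym_deriv: "x \<in> U \<Longrightarrow> dderiv (\<lambda>y. G y a b) x v = dderiv (\<lambda>y. G y b a) x v"
  by (subst frechet_derivative_transform_within_open[OF Ck_differentiable[OF G_smooth] open_U, of x a b "\<lambda>y. G y b a"])
    (auto intro: G_sym)

lemma G_nondegenerate: "x \<in> U \<Longrightarrow> (\<And>b. G x a b = G x a' b) \<Longrightarrow> a = a'"
proof -
  assume x: "x \<in> U" and e: "\<And>b. G x a b = G x a' b"
  have "a \<bullet> c = a' \<bullet> c" for c
    using e[of "P x *v c"] P_g[OF x] by (simp add: G_def matrix_vector_mul_assoc)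
  then show ?thesis by (metis vector_eq_rdot)
qed

lemma Gamma_sym: 
  assumes x: "x \<in> U" shows "Gamma x v w = Gamma x w v"
proof (rule G_nondegenerate[OF x])
  fix b
  show "G x (Gamma x v w) b = G x (Gamma x w v) b"
    using koszul[OF x, of v w b] koszul[OF x, of w v b] G_sym_deriv[OF x, of v w b] by linarith
qed

text \<open>In the sum of the Koszul formulas for \<open>v, a, b\<close> and \<open>v, b, a\<close>
  the derivatives along \<open>a\<close> and \<open>b\<close> cancel.\<close>

lemma metric_compatible:
  assumes x: "x \<in> U"
  shows "dderiv (\<lambda>y. G y a b) x v = G x (Gamma x v a) b + G x a (Gamma x v b)"
  using koszul[OF x, of v a b] koszul[OF x, of v b a] G_sym[OF x, of a "Gamma x v b"] G_sym_deriv[OF x, of a b v]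
  by linarith

end

section \<open>The inverse metric and traces with it\<close>

context metric_domain begin

lemma G_axis: "G x (axis i 1) (axis j 1) = g x $ i $ j"
  by (simp add: G_def inner_axis' matrix_vector_mult_basis column_def)

lemma G_P:
  assumes "x \<in> U"
  shows "(\<Sum>k\<in>UNIV. G x w (axis k 1) * P x $ k $ j) = w $ j" "(\<Sum>k\<in>UNIV. P x $ j $ k * G x (axis k 1) w) = w $ j"
proof -
  have "(\<Sum>k\<in>UNIV. P x $ j $ k * G x (axis k 1) w) = (P x *v (g x *v w)) $ j"
    by (simp add: G_def inner_axis' matrix_vector_mult_def[of "P x"])
  then show "(\<Sum>k\<in>UNIV. P x $ j $ k * G x (axis k 1) w) = w $ j"
    using P_g[OF assms] by (simp add: matrix_vector_mul_assoc)
  then show "(\<Sum>k\<in>UNIV. G x w (axis k 1) * P x $ k $ j) = w $ j"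
    by (simp add: G_sym[OF assms, of w] P_sym[OF assms, of _ j] mult.commute)
qed

text \<open>The inverse metric is parallel. Differentiating \<open>g y ** P y = mat 1\<close> and
  inserting metric compatibility determines \<open>g\<close> times the derivative of
  \<open>P\<close>; multiplication by \<open>P\<close> isolates that derivative.\<close>

lemma P_deriv:
  assumes x: "x \<in> U"
  shows "dderiv (\<lambda>y. P y $ i $ j) x v =
    - (\<Sum>m\<in>UNIV. Gamma x v (axis m 1) $ i * P x $ m $ j) - (\<Sum>m\<in>UNIV. P x $ i $ m * Gamma x v (axis m 1) $ j)"
proof -
  let ?D = "\<lambda>f. dderiv f x v"
  have d: "(\<lambda>y. g y $ a $ k) differentiable (at x)" "(\<lambda>y. P y $ a $ k) differentiable (at x)" for a k
    by (rule Ck_on_Suc_differentiable[OF g_smooth x], rule Ck_on_Suc_differentiable[OF P_smooth x])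
  have "(\<Sum>k\<in>UNIV. ?D (\<lambda>y. g y $ a $ k) * P x $ k $ j + g x $ a $ k * ?D (\<lambda>y. P y $ k $ j)) = 0" for a
  proof -
    have dd: "(\<lambda>y. \<Sum>k\<in>UNIV. g y $ a $ k * P y $ k $ j) differentiable (at x)"
      by (simp add: differentiable_sum differentiable_mult d)
    have m: "(\<Sum>k\<in>UNIV. g y $ a $ k * P y $ k $ j) = (mat 1 :: real ^ 'n ^ 'n) $ a $ j" if "y \<in> U" for y
    proof -
      have "(g y ** P y) $ a $ j = (mat 1 :: real ^ 'n ^ 'n) $ a $ j" by (simp only: P_g(2)[OF that])
      then show ?thesis by (simp add: matrix_matrix_mult_def)
    qed
    have "frechet_derivative (\<lambda>y. \<Sum>k\<in>UNIV. g y $ a $ k * P y $ k $ j) (at x)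
        = frechet_derivative (\<lambda>y. (mat 1 :: real ^ 'n ^ 'n) $ a $ j) (at x)"
      by (rule frechet_derivative_transform_within_open[OF dd open_U x m])
    then have "?D (\<lambda>y. \<Sum>k\<in>UNIV. g y $ a $ k * P y $ k $ j) = 0" by simp
    moreover have "?D (\<lambda>y. \<Sum>k\<in>UNIV. g y $ a $ k * P y $ k $ j) =
        (\<Sum>k\<in>UNIV. ?D (\<lambda>y. g y $ a $ k) * P x $ k $ j + g x $ a $ k * ?D (\<lambda>y. P y $ k $ j))"
      by (simp add: frechet_derivative_sum frechet_derivative_mult d differentiable_mult)
    ultimately show ?thesis by simp
  qed
  then have "(\<Sum>k\<in>UNIV. g x $ a $ k * ?D (\<lambda>y. P y $ k $ j)) =
      - (\<Sum>k\<in>UNIV. ?D (\<lambda>y. g y $ a $ k) * P x $ k $ j)" for a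
    by (simp add: sum.distrib eq_neg_iff_add_eq_0 add.commute)
  moreover have "?D (\<lambda>y. g y $ a $ k) = G x (Gamma x v (axis a 1)) (axis k 1) + G x (axis a 1) (Gamma x v (axis k 1))" for a k
    using metric_compatible[OF x, of "axis a 1" "axis k 1" v] by (simp add: G_axis)
  ultimately have e: "(\<Sum>k\<in>UNIV. g x $ a $ k * ?D (\<lambda>y. P y $ k $ j)) =
      - Gamma x v (axis a 1) $ j - (\<Sum>k\<in>UNIV. G x (axis a 1) (Gamma x v (axis k 1)) * P x $ k $ j)" for a
    by (simp add: distrib_right sum.distrib G_P[OF x])
  have "?D (\<lambda>y. P y $ i $ j) = (P x *v (g x *v (\<chi> k. ?D (\<lambda>y. P y $ k $ j)))) $ i"
    using P_g[OF x] by (simp add: matrix_vector_mul_assoc)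
  also have "\<dots> = (\<Sum>a\<in>UNIV. P x $ i $ a * (\<Sum>k\<in>UNIV. g x $ a $ k * ?D (\<lambda>y. P y $ k $ j)))"
    by (simp add: matrix_vector_mult_def)
  also have "\<dots> = - (\<Sum>a\<in>UNIV. P x $ i $ a * Gamma x v (axis a 1) $ j)
     - (\<Sum>a\<in>UNIV. P x $ i $ a * (\<Sum>k\<in>UNIV. G x (axis a 1) (Gamma x v (axis k 1)) * P x $ k $ j))"
    unfolding e by (simp add: right_diff_distrib sum_subtractf sum_negf)
  also have "(\<Sum>a\<in>UNIV. P x $ i $ a * (\<Sum>k\<in>UNIV. G x (axis a 1) (Gamma x v (axis k 1)) * P x $ k $ j))
     = (\<Sum>k\<in>UNIV. (\<Sum>a\<in>UNIV. P x $ i $ a * G x (axis a 1) (Gamma x v (axis k 1))) * P x $ k $ j)"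
    unfolding sum_distrib_left sum_distrib_right by (subst sum.swap) (simp add: mult_ac)
  finally show ?thesis by (simp add: G_P[OF x])
qed

text \<open>The trace over a coordinate basis: \<open>P\<close> is smooth, in contrast to pointwise
  chosen orthonormal frames, so this form of the trace can be differentiated.\<close>

definition contract :: "(real ^ 'n \<Rightarrow> real ^ 'n \<Rightarrow> real ^ 'n \<Rightarrow> real) \<Rightarrow> real ^ 'n \<Rightarrow> real" where
  "contract F x = (\<Sum>i\<in>UNIV. \<Sum>j\<in>UNIV. P x $ i $ j * F x (axis i 1) (axis j 1))"

lemma contract_smooth:
  assumes "\<And>i j. Ck_on k U (\<lambda>x. F x (axis i 1) (axis j 1))"
  shows "Ck_on k U (contract F)"
  unfolding contract_def[abs_def] by (intro Ck_on_sum Ck_on_mult open_U P_smooth assms)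

text \<open>Traces commute with covariant differentiation because \<open>P\<close> is parallel: its
  derivative supplies exactly the correction terms for the two slots of \<open>F\<close>.\<close>

lemma contract_deriv:
  assumes x: "x \<in> U"
    and lin: "\<And>a. linear (F x a)" "\<And>b. linear (\<lambda>a. F x a b)"
    and diff: "\<And>i j. (\<lambda>y. F y (axis i 1) (axis j 1)) differentiable (at x)"
  shows "dderiv (contract F) x v =
    (\<Sum>i\<in>UNIV. \<Sum>j\<in>UNIV. P x $ i $ j *
      (dderiv (\<lambda>y. F y (axis i 1) (axis j 1)) x v
       - F x (Gamma x v (axis i 1)) (axis j 1) - F x (axis i 1) (Gamma x v (axis j 1))))"
proof -
  let ?F = "\<lambda>i j. F x (axis i 1) (axis j 1)" and ?Ga = "\<lambda>m i. Gamma x v (axis m 1) $ i"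
  have d: "(\<lambda>y. P y $ a $ k) differentiable (at x)" for a k
    by (rule Ck_on_Suc_differentiable[OF P_smooth x])
  have "dderiv (contract F) x v =
    (\<Sum>i\<in>UNIV. \<Sum>j\<in>UNIV. dderiv (\<lambda>y. P y $ i $ j) x v * ?F i j
      + P x $ i $ j * dderiv (\<lambda>y. F y (axis i 1) (axis j 1)) x v)"
    unfolding contract_def[abs_def]
    by (simp add: frechet_derivative_sum frechet_derivative_mult d diff differentiable_mult differentiable_sum)
  also have "\<dots> = (\<Sum>i\<in>UNIV. \<Sum>j\<in>UNIV. P x $ i $ j * dderiv (\<lambda>y. F y (axis i 1) (axis j 1)) x v)
     - (\<Sum>i\<in>UNIV. \<Sum>j\<in>UNIV. \<Sum>m\<in>UNIV. ?Ga m i * P x $ m $ j * ?F i j)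
     - (\<Sum>i\<in>UNIV. \<Sum>j\<in>UNIV. \<Sum>m\<in>UNIV. P x $ i $ m * ?Ga m j * ?F i j)"
    by (simp add: P_deriv[OF x] sum.distrib sum_subtractf sum_negf algebra_simps sum_distrib_left)
  also have "(\<Sum>i\<in>UNIV. \<Sum>j\<in>UNIV. \<Sum>m\<in>UNIV. ?Ga m i * P x $ m $ j * ?F i j)
     = (\<Sum>m\<in>UNIV. \<Sum>j\<in>UNIV. P x $ m $ j * F x (Gamma x v (axis m 1)) (axis j 1))"
    unfolding linear_expand[OF lin(2), of "Gamma x v _"] sum_distrib_left
    by (subst sum_rotate3[symmetric], rule sum.cong[OF refl], subst sum.swap) (simp add: mult_ac)
  also have "(\<Sum>i\<in>UNIV. \<Sum>j\<in>UNIV. \<Sum>m\<in>UNIV. P x $ i $ m * ?Ga m j * ?F i j)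
     = (\<Sum>i\<in>UNIV. \<Sum>m\<in>UNIV. P x $ i $ m * F x (axis i 1) (Gamma x v (axis m 1)))"
    unfolding linear_expand[OF lin(1), of _ "Gamma x v _"] sum_distrib_left
    by (rule sum.cong[OF refl], subst sum.swap) (simp add: mult_ac)
  finally show ?thesis
    by (simp add: right_diff_distrib sum_subtractf)
qed

end

subsection \<open>Curvature and the Ricci identity\<close>

lemma vector_deriv_linear:
  assumes "\<And>i. (\<lambda>y. Z y $ i) differentiable (at x)"
  shows "linear (vector_deriv Z x)"
  by (rule linearI) (simp_all add: vector_deriv_def vec_eq_iff frechet_derivative_linear_dir[OF assms])

context metric_domain begin

lemma Gamma_diff: "x \<in> U \<Longrightarrow> (\<lambda>y. Gamma y v w $ i) differentiable (at x)"
  by (rule Ck_on_Suc_differentiable[OF Gamma_smooth])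

lemma G_diff: "x \<in> U \<Longrightarrow> (\<lambda>y. G y a b) differentiable (at x)"
  by (rule Ck_on_Suc_differentiable[OF G_smooth])

definition DGamma :: "real ^ 'n \<Rightarrow> real ^ 'n \<Rightarrow> real ^ 'n \<Rightarrow> real ^ 'n \<Rightarrow> real ^ 'n" where
  "DGamma x v w z = vector_deriv (\<lambda>y. Gamma y w z) x v"

lemma DGamma_linear:
  assumes "x \<in> U"
  shows "linear (\<lambda>v. DGamma x v w z)" "linear (\<lambda>w. DGamma x v w z)" "linear (\<lambda>z. DGamma x v w z)"
proof -
  note d = Gamma_diff[OF assms]
  show "linear (\<lambda>v. DGamma x v w z)"
    unfolding DGamma_def using vector_deriv_linear[OF d] .
  show "linear (\<lambda>w. DGamma x v w z)"
    by (rule linearI) (simp_all add: DGamma_def vector_deriv_def vec_eq_iff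
      linear_add[OF Gamma_linear(1)] linear_cmul[OF Gamma_linear(1)] frechet_derivative_add
      frechet_derivative_mult d)
  show "linear (\<lambda>z. DGamma x v w z)"
    by (rule linearI) (simp_all add: DGamma_def vector_deriv_def vec_eq_iff
      linear_add[OF Gamma_linear(2)] linear_cmul[OF Gamma_linear(2)] frechet_derivative_add
      frechet_derivative_mult d)
qed

lemma DGamma_sym:
  assumes x: "x \<in> U" shows "DGamma x v w z = DGamma x v z w"
proof -
  have "frechet_derivative (\<lambda>y. Gamma y w z $ i) (at x) = frechet_derivative (\<lambda>y. Gamma y z w $ i) (at x)" for i
    by (rule frechet_derivative_transform_within_open[OF Gamma_diff[OF x] open_U x]) (simp add: Gamma_sym)
  then show ?thesis by (simp add: DGamma_def vector_deriv_def)
qed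

text \<open>Curvature on fields with constant coordinates, for which the bracket term is
  absent.\<close>

definition R :: "real ^ 'n \<Rightarrow> real ^ 'n \<Rightarrow> real ^ 'n \<Rightarrow> real ^ 'n \<Rightarrow> real ^ 'n" where
  "R x v w z = DGamma x v w z - DGamma x w v z + Gamma x v (Gamma x w z) - Gamma x w (Gamma x v z)"

lemma R_linear:
  assumes "x \<in> U"
  shows "linear (\<lambda>v. R x v w z)" "linear (\<lambda>w. R x v w z)" "linear (\<lambda>z. R x v w z)"
  by (rule linearI; simp add: R_def linear_add[OF DGamma_linear(1)[OF assms]] linear_add[OF DGamma_linear(2)[OF assms]]
      linear_add[OF DGamma_linear(3)[OF assms]] linear_add[OF Gamma_linear(1)] linear_add[OF Gamma_linear(2)]
      linear_cmul[OF DGamma_linear(1)[OF assms]] linear_cmul[OF DGamma_linear(2)[OF assms]]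
      linear_cmul[OF DGamma_linear(3)[OF assms]] linear_cmul[OF Gamma_linear(1)] linear_cmul[OF Gamma_linear(2)]
      algebra_simps)+

lemma R_swap: "R x w v z = - R x v w z"
  by (simp add: R_def)

lemma bianchi: "x \<in> U \<Longrightarrow> R x v w z + R x w z v + R x z v w = 0"
  by (simp add: R_def DGamma_sym[of x v z w] DGamma_sym[of x w z v] DGamma_sym[of x z w v]
      Gamma_sym[of x z v] Gamma_sym[of x w v] Gamma_sym[of x z w])

lemma Gamma_axis: "Gamma x (axis i 1) (axis j 1) $ l = christoffel g l i j x"
proof -
  have "Gamma x (axis i 1) (axis j 1) $ l =
     (\<Sum>i'\<in>UNIV. \<Sum>j'\<in>UNIV. if j' = j then if i' = i then christoffel g l i' j' x else 0 else 0)"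
    unfolding Gamma_def vec_lambda_beta by (intro sum.cong refl) (simp add: axis_def)
  then show ?thesis by simp
qed

lemma riemann_eq_R: "riemann g l k i j x = R x (axis i 1) (axis j 1) (axis k 1) $ l"
proof -
  have "Gamma x (axis i 1) w $ l = (\<Sum>m\<in>UNIV. w $ m * christoffel g l i m x)" for i w
  proof -
    have "linear (\<lambda>w. Gamma x (axis i 1) w $ l)"
      by (rule linearI) (simp_all add: linear_add[OF Gamma_linear(2)] linear_cmul[OF Gamma_linear(2)])
    from linear_expand[OF this, of w] show ?thesis by (simp add: Gamma_axis)
  qed
  then show ?thesis
    by (simp add: riemann_def R_def DGamma_def vector_deriv_def Gamma_axis pderivative_def
        sum_subtractf mult.commute)
qed

lemma ricci_matrix_eq_R: "ricci_matrix g x $ j $ k = (\<Sum>i\<in>UNIV. R x (axis i 1) (axis j 1) (axis k 1) $ i)"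
  by (simp add: ricci_matrix_def riemann_eq_R)

text \<open>The second derivatives of \<open>G y a b\<close> along \<open>v\<close> and
  \<open>w\<close> commute. Expanded by metric compatibility, their difference is the left-hand
  side, since the terms with one \<open>Gamma\<close> on each argument are symmetric in
  \<open>v\<close> and \<open>w\<close>.\<close>

lemma R_skew:
  assumes x: "x \<in> U"
  shows "G x (R x w v a) b + G x a (R x w v b) = 0"
proof -
  have "dderiv (\<lambda>y. dderiv (\<lambda>y. G y a b) y v) x w =
      G x (Gamma x w (Gamma x v a)) b + G x (Gamma x v a) (Gamma x w b) + G x (DGamma x w v a) b
    + G x (Gamma x w a) (Gamma x v b) + G x a (Gamma x w (Gamma x v b)) + G x a (DGamma x w v b)" for v w
  proof -
    let ?D = "\<lambda>f. dderiv f x w"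
    have d1: "(\<lambda>y. G y (Gamma y v a) b) differentiable (at x)" for a b
      by (rule Ck_on_Suc_differentiable[OF linear_apply_Ck[OF open_U, where F = "\<lambda>y a. G y a b"] x])
        (simp_all add: G_linear G_smooth Gamma_smooth)
    have d2: "(\<lambda>y. G y a (Gamma y v b)) differentiable (at x)" for a b
      by (rule Ck_on_Suc_differentiable[OF linear_apply_Ck[OF open_U, where F = "\<lambda>y b. G y a b"] x])
        (simp_all add: G_linear G_smooth Gamma_smooth)
    have "(\<lambda>y. G y (Gamma y v a) b + G y a (Gamma y v b)) differentiable (at x)"
      by (intro differentiable_add d1 d2)
    then have "?D (\<lambda>y. dderiv (\<lambda>y. G y a b) y v) = ?D (\<lambda>y. G y (Gamma y v a) b + G y a (Gamma y v b))"
      using frechet_derivative_transform_within_open[OF _ open_U x,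
        of "\<lambda>y. G y (Gamma y v a) b + G y a (Gamma y v b)" "\<lambda>y. dderiv (\<lambda>y. G y a b) y v"]
      by (simp add: metric_compatible)
    also have "\<dots> = ?D (\<lambda>y. G y (Gamma y v a) b) + ?D (\<lambda>y. G y a (Gamma y v b))"
      by (rule frechet_derivative_add[OF d1 d2])
    also have "?D (\<lambda>y. G y (Gamma y v a) b) = ?D (\<lambda>y. G y (Gamma x v a) b) + G x (DGamma x w v a) b"
      unfolding DGamma_def
      by (rule frechet_derivative_linear_apply[OF open_U x, where F = "\<lambda>y a. G y a b"])
        (simp_all add: G_linear G_diff Gamma_diff x)
    also have "?D (\<lambda>y. G y a (Gamma y v b)) = ?D (\<lambda>y. G y a (Gamma x v b)) + G x a (DGamma x w v b)"
      unfolding DGamma_def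
      by (rule frechet_derivative_linear_apply[OF open_U x, where F = "\<lambda>y b. G y a b"])
        (simp_all add: G_linear G_diff Gamma_diff x)
    finally show ?thesis by (simp add: metric_compatible[OF x])
  qed
  note e = this[of v w] this[of w v]
  have "dderiv (\<lambda>y. dderiv (\<lambda>y. G y a b) y v) x w =
     dderiv (\<lambda>y. dderiv (\<lambda>y. G y a b) y w) x v"
    by (rule frechet_derivative_commute[OF open_U G_smooth x])
  then show ?thesis
    unfolding e R_def by (simp add: linear_add[OF G_linear(1)] linear_add[OF G_linear(2)]
      linear_diff[OF G_linear(1)] linear_diff[OF G_linear(2)])
qed

section \<open>Covariant derivatives of trilinear forms\<close>

definition smooth_trilinear :: "(real ^ 'n \<Rightarrow> real ^ 'n \<Rightarrow> real ^ 'n \<Rightarrow> real ^ 'n \<Rightarrow> real) \<Rightarrow> bool" where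
  "smooth_trilinear S \<longleftrightarrow> (\<forall>a b c k. Ck_on k U (\<lambda>x. S x a b c)) \<and>
     (\<forall>x\<in>U. \<forall>b c. linear (\<lambda>a. S x a b c) \<and> linear (\<lambda>a. S x b a c) \<and> linear (\<lambda>a. S x b c a))"

definition nabla :: "(real ^ 'n \<Rightarrow> real ^ 'n \<Rightarrow> real ^ 'n \<Rightarrow> real ^ 'n \<Rightarrow> real) \<Rightarrow>
    real ^ 'n \<Rightarrow> real ^ 'n \<Rightarrow> real ^ 'n \<Rightarrow> real ^ 'n \<Rightarrow> real ^ 'n \<Rightarrow> real" where
  "nabla S x v a b c = dderiv (\<lambda>y. S y a b c) x v
     - S x (Gamma x v a) b c - S x a (Gamma x v b) c - S x a b (Gamma x v c)"

text \<open>\<open>w\<close> is the direction of the later differentiation. The term with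
  \<open>Gamma x w v\<close> treats \<open>v\<close> as a further tensor slot; without it the result
  would not be tensorial.\<close>

definition nabla2 :: "(real ^ 'n \<Rightarrow> real ^ 'n \<Rightarrow> real ^ 'n \<Rightarrow> real ^ 'n \<Rightarrow> real) \<Rightarrow>
    real ^ 'n \<Rightarrow> real ^ 'n \<Rightarrow> real ^ 'n \<Rightarrow> real ^ 'n \<Rightarrow> real ^ 'n \<Rightarrow> real ^ 'n \<Rightarrow> real" where
  "nabla2 S x w v a b c = dderiv (\<lambda>y. nabla S y v a b c) x w
     - nabla S x (Gamma x w v) a b c
     - nabla S x v (Gamma x w a) b c - nabla S x v a (Gamma x w b) c - nabla S x v a b (Gamma x w c)"

context
  fixes S assumes S: "smooth_trilinear S"
begin

lemma S_smooth: "Ck_on k U (\<lambda>x. S x a b c)"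
  using S by (simp add: smooth_trilinear_def)

lemma S_diff: "x \<in> U \<Longrightarrow> (\<lambda>y. S y a b c) differentiable (at x)"
  by (rule Ck_on_Suc_differentiable[OF S_smooth])

lemma S_linear:
  assumes "x \<in> U"
  shows "linear (\<lambda>a. S x a b c)" "linear (\<lambda>b. S x a b c)" "linear (\<lambda>c. S x a b c)"
  using S assms by (simp_all add: smooth_trilinear_def)

lemma S_Gamma_smooth:
  "Ck_on k U (\<lambda>y. S y (Gamma y v a) b c)" "Ck_on k U (\<lambda>y. S y a (Gamma y v b) c)"
  "Ck_on k U (\<lambda>y. S y a b (Gamma y v c))"
  by (rule linear_apply_Ck[OF open_U, where F = "\<lambda>y a. S y a b c"], simp_all add: S_linear S_smooth Gamma_smooth)
    (rule linear_apply_Ck[OF open_U, where F = "\<lambda>y b. S y a b c"], simp_all add: S_linear S_smooth Gamma_smooth,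
     rule linear_apply_Ck[OF open_U, where F = "\<lambda>y c. S y a b c"], simp_all add: S_linear S_smooth Gamma_smooth)

lemma nabla_smooth: "Ck_on k U (\<lambda>x. nabla S x v a b c)"
  unfolding nabla_def
  by (intro Ck_on_diff open_U S_Gamma_smooth Ck_on_Suc_deriv S_smooth)

lemma nabla_diff: "x \<in> U \<Longrightarrow> (\<lambda>y. nabla S y v a b c) differentiable (at x)"
  by (rule Ck_on_Suc_differentiable[OF nabla_smooth])

lemma nabla_linear:
  assumes x: "x \<in> U"
  shows "linear (\<lambda>v. nabla S x v a b c)" "linear (\<lambda>a. nabla S x v a b c)"
    "linear (\<lambda>b. nabla S x v a b c)" "linear (\<lambda>c. nabla S x v a b c)"
proof -
  have D: "linear (\<lambda>a. dderiv (\<lambda>y. S y a b c) x v)"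
    "linear (\<lambda>a. dderiv (\<lambda>y. S y b a c) x v)"
    "linear (\<lambda>a. dderiv (\<lambda>y. S y b c a) x v)" for b c v
    by (rule linear_frechet_derivative_param[OF open_U x]; simp add: S_linear S_diff x)+
  note lin = linear_add[OF S_linear(1)[OF x]] linear_add[OF S_linear(2)[OF x]] linear_add[OF S_linear(3)[OF x]]
    linear_cmul[OF S_linear(1)[OF x]] linear_cmul[OF S_linear(2)[OF x]] linear_cmul[OF S_linear(3)[OF x]]
    linear_add[OF Gamma_linear(1)] linear_add[OF Gamma_linear(2)] linear_cmul[OF Gamma_linear(1)] linear_cmul[OF Gamma_linear(2)]
    linear_add[OF D(1)] linear_add[OF D(2)] linear_add[OF D(3)]
    linear_cmul[OF D(1)] linear_cmul[OF D(2)] linear_cmul[OF D(3)] frechet_derivative_linear_dir[OF S_diff[OF x]]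
  show "linear (\<lambda>v. nabla S x v a b c)" "linear (\<lambda>a. nabla S x v a b c)"
    "linear (\<lambda>b. nabla S x v a b c)" "linear (\<lambda>c. nabla S x v a b c)"
    by (rule linearI; simp add: nabla_def lin algebra_simps)+
qed

lemma nabla_deriv:
  assumes x: "x \<in> U"
  shows "dderiv (\<lambda>y. nabla S y v a b c) x w =
    dderiv (\<lambda>y. dderiv (\<lambda>y. S y a b c) y v) x w
    - dderiv (\<lambda>y. S y (Gamma x v a) b c) x w - S x (DGamma x w v a) b c
    - dderiv (\<lambda>y. S y a (Gamma x v b) c) x w - S x a (DGamma x w v b) c
    - dderiv (\<lambda>y. S y a b (Gamma x v c)) x w - S x a b (DGamma x w v c)"
proof -
  let ?D = "\<lambda>f. dderiv f x w"
  have 1: "?D (\<lambda>y. S y (Gamma y v a) b c) = ?D (\<lambda>y. S y (Gamma x v a) b c) + S x (DGamma x w v a) b c"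
    unfolding DGamma_def
    by (rule frechet_derivative_linear_apply[OF open_U x, where F = "\<lambda>y a. S y a b c"])
      (simp_all add: S_linear S_diff Gamma_diff x)
  have 2: "?D (\<lambda>y. S y a (Gamma y v b) c) = ?D (\<lambda>y. S y a (Gamma x v b) c) + S x a (DGamma x w v b) c"
    unfolding DGamma_def
    by (rule frechet_derivative_linear_apply[OF open_U x, where F = "\<lambda>y b. S y a b c"])
      (simp_all add: S_linear S_diff Gamma_diff x)
  have 3: "?D (\<lambda>y. S y a b (Gamma y v c)) = ?D (\<lambda>y. S y a b (Gamma x v c)) + S x a b (DGamma x w v c)"
    unfolding DGamma_def
    by (rule frechet_derivative_linear_apply[OF open_U x, where F = "\<lambda>y c. S y a b c"])
      (simp_all add: S_linear S_diff Gamma_diff x)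
  note d = Ck_on_Suc_differentiable[OF S_Gamma_smooth(1) x] Ck_on_Suc_differentiable[OF S_Gamma_smooth(2) x]
    Ck_on_Suc_differentiable[OF S_Gamma_smooth(3) x]
    Ck_on_Suc_differentiable[OF Ck_on_Suc_deriv[OF S_smooth] x]
  show ?thesis
    unfolding nabla_def
    by (simp add: frechet_derivative_diff d differentiable_diff 1 2 3)
qed

text \<open>Second coordinate derivatives commute and \<open>Gamma x w v\<close> is symmetric in its
  directions. What survives is the curvature acting as a derivation on the three slots, with a minus
  sign because forms are dual to vectors.\<close>

lemma ricci_identity:
  assumes x: "x \<in> U"
  shows "nabla2 S x w v a b c - nabla2 S x v w a b c =
    - S x (R x w v a) b c - S x a (R x w v b) c - S x a b (R x w v c)"
proof -
  have "dderiv (\<lambda>y. dderiv (\<lambda>y. S y a b c) y v) x w =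
     dderiv (\<lambda>y. dderiv (\<lambda>y. S y a b c) y w) x v"
    by (rule frechet_derivative_commute[OF open_U S_smooth x])
  then show ?thesis
    unfolding nabla2_def nabla_deriv[OF x] nabla_def[of S x v "Gamma x w a"] nabla_def[of S x v _ "Gamma x w b"]
      nabla_def[of S x v _ _ "Gamma x w c"] nabla_def[of S x w "Gamma x v a"] nabla_def[of S x w _ "Gamma x v b"]
      nabla_def[of S x w _ _ "Gamma x v c"]  R_def
    by (simp add: linear_add[OF S_linear(1)[OF x]] linear_add[OF S_linear(2)[OF x]] linear_add[OF S_linear(3)[OF x]]
       linear_diff[OF S_linear(1)[OF x]] linear_diff[OF S_linear(2)[OF x]] linear_diff[OF S_linear(3)[OF x]] Gamma_sym[OF x, of w v])
qed

end
end

subsection \<open>Contractions in orthonormal frames\<close>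

lemma linear_compose_real:
  fixes f :: "'a::real_vector \<Rightarrow> 'b::real_vector" and L :: "'b \<Rightarrow> real"
  assumes "linear L" "linear f"
  shows "linear (\<lambda>a. L (f a))"
  using linear_compose[OF assms(2,1)] by (simp add: o_def)

lemma linear_mult_const: "linear f \<Longrightarrow> linear (\<lambda>a. f a * (c::real))" "linear f \<Longrightarrow> linear (\<lambda>a. (c::real) * f a)"
  by (auto intro!: linearI simp: linear_add linear_cmul algebra_simps)

context metric_domain begin

text \<open>Orthonormality stated through the inverse metric, the form in which a frame replaces
  \<open>P\<close> inside a trace.\<close>

definition frame :: "real ^ 'n \<Rightarrow> ('n \<Rightarrow> real ^ 'n) \<Rightarrow> bool" where
  "frame x E \<longleftrightarrow> (\<forall>i j. P x $ i $ j = (\<Sum>m\<in>UNIV. E m $ i * E m $ j))"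

lemma sum_P_frame:
  assumes "frame x E" "\<And>a. linear (B a)" "\<And>b. linear (\<lambda>a. B a b)"
  shows "(\<Sum>i\<in>UNIV. \<Sum>j\<in>UNIV. P x $ i $ j * B (axis i 1) (axis j 1)) = (\<Sum>m\<in>UNIV. B (E m) (E m))"
proof -
  have "(\<Sum>m\<in>UNIV. B (E m) (E m)) = (\<Sum>m\<in>UNIV. \<Sum>i\<in>UNIV. \<Sum>j\<in>UNIV. E m $ i * E m $ j * B (axis i 1) (axis j 1))"
    by (subst linear_expand[OF assms(3)], subst linear_expand[OF assms(2)]) (simp add: sum_distrib_left mult_ac)
  also have "\<dots> = (\<Sum>i\<in>UNIV. \<Sum>j\<in>UNIV. P x $ i $ j * B (axis i 1) (axis j 1))"
    using assms(1) by (subst sum_rotate3) (simp add: frame_def sum_distrib_right)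
  finally show ?thesis by simp
qed

lemma contract_frame:
  assumes "frame x E" "\<And>a. linear (F x a)" "\<And>b. linear (\<lambda>a. F x a b)"
  shows "contract F x = (\<Sum>m\<in>UNIV. F x (E m) (E m))"
  unfolding contract_def by (rule sum_P_frame[OF assms])

definition smooth_bilinear :: "(real ^ 'n \<Rightarrow> real ^ 'n \<Rightarrow> real ^ 'n \<Rightarrow> real) \<Rightarrow> bool" where
  "smooth_bilinear F \<longleftrightarrow> (\<forall>a b k. Ck_on k U (\<lambda>x. F x a b)) \<and>
    (\<forall>x\<in>U. \<forall>a. linear (\<lambda>b. F x a b) \<and> linear (\<lambda>b. F x b a))"

lemma smooth_bilinearD:
  assumes "smooth_bilinear F"
  shows "Ck_on k U (\<lambda>x. F x a b)" "x \<in> U \<Longrightarrow> linear (\<lambda>b. F x a b)" "x \<in> U \<Longrightarrow> linear (\<lambda>a. F x a b)"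
    "x \<in> U \<Longrightarrow> (\<lambda>x. F x a b) differentiable (at x)"
proof -
  show C: "Ck_on k U (\<lambda>x. F x a b)" for k using assms by (simp add: smooth_bilinear_def)
  show "x \<in> U \<Longrightarrow> (\<lambda>x. F x a b) differentiable (at x)"
    by (rule Ck_on_Suc_differentiable[OF C])
qed (use assms in \<open>simp_all add: smooth_bilinear_def\<close>)

text \<open>The expression traced in \<open>contract_deriv\<close> is bilinear, so \<open>P\<close>
  may be replaced by a frame at \<open>x\<close>. The frame vectors stay constant while
  \<open>y\<close> moves.\<close>

lemma contract_deriv_frame:
  assumes F: "smooth_bilinear F" and x: "x \<in> U" and E: "frame x E"
  shows "dderiv (contract F) x v =
    (\<Sum>m\<in>UNIV. dderiv (\<lambda>y. F y (E m) (E m)) x v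
       - F x (Gamma x v (E m)) (E m) - F x (E m) (Gamma x v (E m)))"
proof -
  note FD = smooth_bilinearD[OF F]
  let ?B = "\<lambda>a b. dderiv (\<lambda>y. F y a b) x v - F x (Gamma x v a) b - F x a (Gamma x v b)"
  have D: "linear (\<lambda>b. dderiv (\<lambda>y. F y a b) x v)" "linear (\<lambda>a. dderiv (\<lambda>y. F y a b) x v)" for a b
    by (rule linear_frechet_derivative_param[OF open_U x]; simp add: FD x)+
  have "linear (?B a)" "linear (\<lambda>a. ?B a b)" for a b
    by (intro linear_compose_sub D FD(2,3) x linear_compose_real[OF FD(2)[OF x] Gamma_linear(2)]
        linear_compose_real[OF FD(3)[OF x] Gamma_linear(2)])+
  from sum_P_frame[OF E this] show ?thesis
    by (subst contract_deriv[OF x]) (simp_all add: FD x)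
qed

lemma contract_bilinear:
  assumes "\<And>a b. smooth_bilinear (\<lambda>y p q. H y a b p q)" "\<And>p q. smooth_bilinear (\<lambda>y a b. H y a b p q)"
  shows "smooth_bilinear (\<lambda>y a b. contract (\<lambda>y p q. H y a b p q) y)"
proof -
  have C: "Ck_on k U (\<lambda>y. contract (\<lambda>y p q. H y a b p q) y)" for a b k
    by (rule contract_smooth) (rule smooth_bilinearD(1)[OF assms(1)])
  have "linear (\<lambda>b. contract (\<lambda>y p q. H y a b p q) y)" "linear (\<lambda>b. contract (\<lambda>y p q. H y b a p q) y)" if "y \<in> U" for a y
    unfolding contract_def
    by (intro linear_compose_sum ballI linear_mult_const smooth_bilinearD(2,3)[OF assms(2)] that)+
  with C show ?thesis by (simp add: smooth_bilinear_def)
qed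

section \<open>Triple traces, as in the inner product of two trilinear forms\<close>

context
  fixes W :: "real ^ 'n \<Rightarrow> real ^ 'n \<Rightarrow> real ^ 'n \<Rightarrow> real ^ 'n \<Rightarrow> real ^ 'n \<Rightarrow> real ^ 'n \<Rightarrow> real ^ 'n \<Rightarrow> real"
    and x :: "real ^ 'n" and E :: "'n \<Rightarrow> real ^ 'n"
  assumes W: "\<And>p q r t. smooth_bilinear (\<lambda>y a b. W y a b p q r t)"
     "\<And>p q r t. smooth_bilinear (\<lambda>y a b. W y p q a b r t)"
     "\<And>p q r t. smooth_bilinear (\<lambda>y a b. W y p q r t a b)"
    and x: "x \<in> U" and E: "frame x E"
begin

lemma contract2_bilinear: "smooth_bilinear (\<lambda>y c d. contract (\<lambda>y e f. W y a b c d e f) y)"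
  by (rule contract_bilinear; rule W)

lemma contract3_bilinear:
  "smooth_bilinear (\<lambda>y a b. contract (\<lambda>y c d. contract (\<lambda>y e f. W y a b c d e f) y) y)"
  by (rule contract_bilinear, rule contract2_bilinear, rule contract_bilinear; rule W)

lemma contract1_frame:
  "contract (\<lambda>y e f. W y a b c d e f) x = (\<Sum>k\<in>UNIV. W x a b c d (E k) (E k))"
  by (rule contract_frame[OF E]) (rule smooth_bilinearD(2,3)[OF W(3) x])+

lemma contract2_frame:
  "contract (\<lambda>y c d. contract (\<lambda>y e f. W y a b c d e f) y) x
     = (\<Sum>j\<in>UNIV. \<Sum>k\<in>UNIV. W x a b (E j) (E j) (E k) (E k))"
  by (subst contract_frame[OF E]) (rule smooth_bilinearD(2,3)[OF contract2_bilinear x],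
    rule smooth_bilinearD(2,3)[OF contract2_bilinear x], simp add: contract1_frame)

lemma contract3_frame:
  "contract (\<lambda>y a b. contract (\<lambda>y c d. contract (\<lambda>y e f. W y a b c d e f) y) y) x =
    (\<Sum>i\<in>UNIV. \<Sum>j\<in>UNIV. \<Sum>k\<in>UNIV. W x (E i) (E i) (E j) (E j) (E k) (E k))"
  by (subst contract_frame[OF E]) (rule smooth_bilinearD(2,3)[OF contract3_bilinear x],
    rule smooth_bilinearD(2,3)[OF contract3_bilinear x], simp add: contract2_frame)

lemma contract3_deriv:
  "dderiv (contract (\<lambda>y a b. contract (\<lambda>y c d. contract (\<lambda>y e f. W y a b c d e f) y) y)) x v =
    (\<Sum>i\<in>UNIV. \<Sum>j\<in>UNIV. \<Sum>k\<in>UNIV. dderiv (\<lambda>y. W y (E i) (E i) (E j) (E j) (E k) (E k)) x v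
       - W x (Gamma x v (E i)) (E i) (E j) (E j) (E k) (E k) - W x (E i) (Gamma x v (E i)) (E j) (E j) (E k) (E k)
       - W x (E i) (E i) (Gamma x v (E j)) (E j) (E k) (E k) - W x (E i) (E i) (E j) (Gamma x v (E j)) (E k) (E k)
       - W x (E i) (E i) (E j) (E j) (Gamma x v (E k)) (E k) - W x (E i) (E i) (E j) (E j) (E k) (Gamma x v (E k)))"
  unfolding contract_deriv_frame[OF contract3_bilinear x E] contract_deriv_frame[OF contract2_bilinear x E]
    contract_deriv_frame[OF W(3) x E] contract1_frame contract2_frame
  by (simp add: sum_subtractf)

end

lemma trace_frame:
  assumes x: "x \<in> U" and E: "frame x E" and L: "linear L"
  shows "(\<Sum>i\<in>UNIV. L (axis i 1) $ i) = (\<Sum>m\<in>UNIV. G x (L (E m)) (E m))"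
proof -
  have "(\<Sum>m\<in>UNIV. G x (L (E m)) (E m)) = (\<Sum>i\<in>UNIV. \<Sum>j\<in>UNIV. P x $ i $ j * G x (L (axis i 1)) (axis j 1))"
    by (rule sum_P_frame[OF E, symmetric]) (rule G_linear, rule linear_compose_real[OF G_linear(1) L])
  also have "\<dots> = (\<Sum>i\<in>UNIV. \<Sum>j\<in>UNIV. G x (L (axis i 1)) (axis j 1) * P x $ j $ i)"
    by (intro sum.cong refl) (metis P_sym[OF x] mult.commute)
  finally show ?thesis by (simp add: G_P[OF x])
qed

end

subsection \<open>The covariant derivative of a \<open>G\<^sub>2\<close>-structure\<close>

lemma frechet_derivative_neg_eq:
  fixes f h :: "'a::real_normed_vector \<Rightarrow> real"
  assumes "open U" "x \<in> U" "\<And>y. y \<in> U \<Longrightarrow> f y = - h y" "h differentiable (at x)"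
  shows "dderiv f x v = - dderiv h x v"
proof -
  have "frechet_derivative (\<lambda>y. - h y) (at x) = frechet_derivative f (at x)"
    by (rule frechet_derivative_transform_within_open[OF differentiable_minus[OF assms(4)] assms(1,2)])
      (simp add: assms(3))
  moreover have "dderiv (\<lambda>y. - h y) x v = - dderiv h x v"
    by (rule frechet_derivative_eqI) (use assms(4) in \<open>auto intro!: derivative_eq_intros simp: frechet_derivative_works\<close>)
  ultimately show ?thesis by simp
qed

context g2_domain begin

sublocale metric: metric_domain U g
proof
  show "g x $ i $ j = g x $ j $ i" if "x \<in> U" for x i j
    by (simp add: g_eq[OF that] inner_commute)
  show "0 < det (g x)" if "x \<in> U" for x
    using density_pos[OF that] by (simp add: det_g[OF that])
qed (rule open_U, rule g_smooth)

abbreviation "\<Gamma> \<equiv> metric.Gamma"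

lemma G_eq: "x \<in> U \<Longrightarrow> metric.G x a b = u x a \<bullet> u x b"
  unfolding metric.G_def by (rule g_inner)

text \<open>The standard basis pulled back by \<open>u x\<close>; like \<open>u\<close>, it need not
  be continuous in \<open>x\<close>.\<close>

definition E :: "real ^ 7 \<Rightarrow> 7 \<Rightarrow> real ^ 7" where
  "E x m = inv (u x) (axis m 1)"

lemma u_E: "x \<in> U \<Longrightarrow> u x (E x m) = axis m 1"
  unfolding E_def using bij_u[of x] by (simp add: bij_is_surj surj_f_inv_f)

lemma E_expand: "x \<in> U \<Longrightarrow> v = (\<Sum>m\<in>UNIV. u x v $ m *\<^sub>R E x m)"
proof -
  assume x: "x \<in> U"
  have "u x v = u x (\<Sum>m\<in>UNIV. u x v $ m *\<^sub>R E x m)"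
    using basis_expansion[of "u x v"]
    by (simp add: linear_sum[OF linear_u[OF x]] linear_cmul[OF linear_u[OF x]] u_E[OF x] scalar_mult_eq_scaleR)
  then show ?thesis using bij_is_inj[OF bij_u[OF x]] by (rule injD[rotated])
qed

lemma frame_E:
  assumes x: "x \<in> U"
  shows "metric.frame x (E x)"
proof -
  define Q where "Q = (\<chi> i j. \<Sum>m\<in>UNIV. E x m $ i * E x m $ j)"
  have Qw: "Q *v w = (\<Sum>m\<in>UNIV. (E x m \<bullet> w) *\<^sub>R E x m)" for w
    unfolding vec_eq_iff Q_def matrix_vector_mult_def inner_vec_def
    by (simp add: sum_distrib_left sum_distrib_right mult_ac) (subst sum.swap, simp)
  have "g x ** Q = mat 1"
  proof (rule matrix_eqI_inner)
    fix v w
    have "v \<bullet> ((g x ** Q) *v w) = u x v \<bullet> u x (Q *v w)"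
      by (simp add: matrix_vector_mul_assoc[symmetric] g_inner[OF x])
    also have "u x (Q *v w) = (\<Sum>m\<in>UNIV. (E x m \<bullet> w) *\<^sub>R axis m 1)"
      by (simp add: Qw linear_sum[OF linear_u[OF x]] linear_cmul[OF linear_u[OF x]] u_E[OF x])
    also have "u x v \<bullet> \<dots> = (\<Sum>m\<in>UNIV. u x v $ m *\<^sub>R E x m) \<bullet> w"
      by (simp add: inner_sum_right inner_sum_left inner_axis mult.commute)
    also have "\<dots> = v \<bullet> (mat 1 *v w)"
      using E_expand[OF x, of v] by simp
    finally show "v \<bullet> ((g x ** Q) *v w) = v \<bullet> (mat 1 *v w)" .
  qed
  then have "metric.P x ** (g x ** Q) = metric.P x" by simp
  then have "Q = metric.P x" by (simp add: matrix_mul_assoc metric.P_g[OF x])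
  then show ?thesis by (simp add: metric.frame_def Q_def vec_eq_iff)
qed

definition S :: "real ^ 7 \<Rightarrow> real ^ 7 \<Rightarrow> real ^ 7 \<Rightarrow> real ^ 7 \<Rightarrow> real" where
  "S x a b c = s x [a, b, c]"

lemma S_eq: "x \<in> U \<Longrightarrow> S x a b c = phi [u x a, u x b, u x c]"
  by (simp add: S_def s_eq)

lemma S_trilinear: "metric.smooth_trilinear S"
  unfolding metric.smooth_trilinear_def
proof (intro conjI allI ballI)
  show "Ck_on k U (\<lambda>x. S x a b c)" for a b c k by (simp add: S_def smooth_s)
  fix x b c assume x: "x \<in> U"
  note l = linear_u[OF x]
  show "linear (\<lambda>a. S x a b c)" "linear (\<lambda>a. S x b a c)" "linear (\<lambda>a. S x b c a)"
    by (rule linearI; simp add: S_eq[OF x] linear_add[OF l] linear_cmul[OF l] phi_linear)+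
qed

lemmas S_smooth = metric.S_smooth[OF S_trilinear] and S_diff = metric.S_diff[OF S_trilinear]
  and S_linear = metric.S_linear[OF S_trilinear]

abbreviation "N \<equiv> metric.nabla S"
abbreviation "K \<equiv> metric.nabla2 S"

lemmas N_smooth = metric.nabla_smooth[OF S_trilinear] and N_diff = metric.nabla_diff[OF S_trilinear]
  and N_linear = metric.nabla_linear[OF S_trilinear]

lemma S_swap: "x \<in> U \<Longrightarrow> S x b a c = - S x a b c" "x \<in> U \<Longrightarrow> S x a c b = - S x a b c"
  by (simp_all add: S_eq phi_swap(1)[of "u x b" "u x a"] phi_swap(2)[of _ "u x c" "u x b"])

lemma N_swap:
  assumes x: "x \<in> U"
  shows "N x v b a c = - N x v a b c" "N x v a c b = - N x v a b c"
proof -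
  have "dderiv (\<lambda>y. S y b a c) x v = - dderiv (\<lambda>y. S y a b c) x v"
    by (rule frechet_derivative_neg_eq[OF open_U x S_swap(1) S_diff[OF x]])
  then show "N x v b a c = - N x v a b c"
    unfolding metric.nabla_def
    by (simp add: S_swap(1)[OF x, of b "\<Gamma> x v a"] S_swap(1)[OF x, of "\<Gamma> x v b"] S_swap(1)[OF x, of b a "\<Gamma> x v c"])
  have "dderiv (\<lambda>y. S y a c b) x v = - dderiv (\<lambda>y. S y a b c) x v"
    by (rule frechet_derivative_neg_eq[OF open_U x S_swap(2) S_diff[OF x]])
  then show "N x v a c b = - N x v a b c"
    unfolding metric.nabla_def
    by (simp add: S_swap(2)[OF x, of a c "\<Gamma> x v b"] S_swap(2)[OF x, of a "\<Gamma> x v c"] S_swap(2)[OF x, of "\<Gamma> x v a" c b])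
qed

definition Psi :: "real ^ 7 \<Rightarrow> real ^ 7 \<Rightarrow> real ^ 7 \<Rightarrow> real ^ 7 \<Rightarrow> real ^ 7 \<Rightarrow> real" where
  "Psi x a b c d = psi [u x a, u x b, u x c, u x d]"

lemma SS_bilinear: "metric.smooth_bilinear (\<lambda>y p q. S y a b p * S y q c d)"
  unfolding metric.smooth_bilinear_def
  by (intro conjI allI ballI Ck_on_mult open_U S_smooth linear_mult_const S_linear)

lemma contract_SS:
  assumes x: "x \<in> U"
  shows "metric.contract (\<lambda>y p q. S y a b p * S y q c d) x = (\<Sum>m\<in>UNIV. S x a b (E x m) * S x (E x m) c d)"
  by (rule metric.contract_frame[OF frame_E[OF x]])
    (intro linear_mult_const S_linear x)+

text \<open>This builds \<open>Psi\<close> from \<open>S\<close>, the metric and its inverse, and so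
  makes it smooth although it is defined through \<open>u\<close>.\<close>

lemma Psi_eq_contract:
  assumes x: "x \<in> U"
  shows "Psi x a b c d = metric.contract (\<lambda>y p q. S y a b p * S y q c d) x
    - metric.G x a c * metric.G x b d + metric.G x a d * metric.G x b c"
  unfolding contract_SS[OF x]
  using phi_contraction[of "u x a" "u x b" "u x c" "u x d"]
  by (simp add: Psi_def S_eq[OF x] u_E[OF x] G_eq[OF x])

lemma Psi_smooth: "Ck_on k U (\<lambda>x. Psi x a b c d)"
proof -
  have "Ck_on k U (\<lambda>x. metric.contract (\<lambda>y p q. S y a b p * S y q c d) x
    - metric.G x a c * metric.G x b d + metric.G x a d * metric.G x b c)"
    by (intro Ck_on_add Ck_on_diff Ck_on_mult open_U metric.G_smooth metric.contract_smooth S_smooth)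
  then show ?thesis
    by (rule Ck_on_cong[OF open_U, rotated]) (simp add: Psi_eq_contract)
qed

lemma Psi_diff: "x \<in> U \<Longrightarrow> (\<lambda>x. Psi x a b c d) differentiable (at x)"
  by (rule Ck_on_Suc_differentiable[OF Psi_smooth])

definition nabla_Psi :: "real ^ 7 \<Rightarrow> real ^ 7 \<Rightarrow> real ^ 7 \<Rightarrow> real ^ 7 \<Rightarrow> real ^ 7 \<Rightarrow> real ^ 7 \<Rightarrow> real" where
  "nabla_Psi x v a b c d = dderiv (\<lambda>y. Psi y a b c d) x v
     - Psi x (\<Gamma> x v a) b c d - Psi x a (\<Gamma> x v b) c d - Psi x a b (\<Gamma> x v c) d - Psi x a b c (\<Gamma> x v d)"

text \<open>The Leibniz rule applied to \<open>Psi_eq_contract\<close>; the metric terms contribute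
  nothing because the metric is parallel.\<close>

lemma nabla_Psi_eq:
  assumes x: "x \<in> U"
  shows "nabla_Psi x v a b c d =
    (\<Sum>m\<in>UNIV. N x v a b (E x m) * S x (E x m) c d + S x a b (E x m) * N x v (E x m) c d)"
proof -
  let ?D = "\<lambda>f. dderiv f x v"
  let ?F = "\<lambda>a b c d. metric.contract (\<lambda>y p q. S y a b p * S y q c d)"
  have dF: "?F a b c d differentiable (at x)"
    by (rule Ck_on_Suc_differentiable[OF metric.contract_smooth x]) (intro Ck_on_mult open_U S_smooth)
  note dG = metric.G_diff[OF x]
  have "frechet_derivative (\<lambda>y. ?F a b c d y - metric.G y a c * metric.G y b d + metric.G y a d * metric.G y b c) (at x)
     = frechet_derivative (\<lambda>y. Psi y a b c d) (at x)"
    by (rule frechet_derivative_transform_within_open[OF _ open_U x])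
      (simp_all add: Psi_eq_contract dF dG differentiable_mult)
  then have "?D (\<lambda>y. Psi y a b c d) = ?D (\<lambda>y. ?F a b c d y - metric.G y a c * metric.G y b d + metric.G y a d * metric.G y b c)"
    by simp
  also have "\<dots> = ?D (?F a b c d) - (?D (\<lambda>y. metric.G y a c) * metric.G x b d + metric.G x a c * ?D (\<lambda>y. metric.G y b d))
    + (?D (\<lambda>y. metric.G y a d) * metric.G x b c + metric.G x a d * ?D (\<lambda>y. metric.G y b c))"
    by (simp add: frechet_derivative_add frechet_derivative_diff frechet_derivative_mult dF dG differentiable_mult)
  finally have 1: "?D (\<lambda>y. Psi y a b c d) = \<dots>" .
  have "?D (?F a b c d) = (\<Sum>m\<in>UNIV. ?D (\<lambda>y. S y a b (E x m) * S y (E x m) c d)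
      - S x a b (\<Gamma> x v (E x m)) * S x (E x m) c d - S x a b (E x m) * S x (\<Gamma> x v (E x m)) c d)"
    by (rule metric.contract_deriv_frame[OF SS_bilinear x frame_E[OF x]])
  also have "\<dots> = (\<Sum>m\<in>UNIV. N x v a b (E x m) * S x (E x m) c d + S x a b (E x m) * N x v (E x m) c d)
     + (\<Sum>m\<in>UNIV. S x (\<Gamma> x v a) b (E x m) * S x (E x m) c d) + (\<Sum>m\<in>UNIV. S x a (\<Gamma> x v b) (E x m) * S x (E x m) c d)
     + (\<Sum>m\<in>UNIV. S x a b (E x m) * S x (E x m) (\<Gamma> x v c) d) + (\<Sum>m\<in>UNIV. S x a b (E x m) * S x (E x m) c (\<Gamma> x v d))"
    unfolding sum.distrib[symmetric]
    by (rule sum.cong[OF refl])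
      (simp add: frechet_derivative_mult S_diff[OF x] metric.nabla_def algebra_simps)
  finally have 2: "?D (?F a b c d) = \<dots>" .
  show ?thesis
    unfolding nabla_Psi_def 1 2 Psi_eq_contract[OF x] contract_SS[OF x] metric.metric_compatible[OF x]
    by (simp add: algebra_simps)
qed

lemma Psi_swap: 
  "Psi x b a c d = - Psi x a b c d" "Psi x a c b d = - Psi x a b c d" "Psi x a b d c = - Psi x a b c d"
  unfolding Psi_def by (rule psi_swap)+

lemma nabla_Psi_swap:
  assumes x: "x \<in> U"
  shows "nabla_Psi x v a c b d = - nabla_Psi x v a b c d"
proof -
  have "dderiv (\<lambda>y. Psi y a c b d) x v = - dderiv (\<lambda>y. Psi y a b c d) x v"
    by (rule frechet_derivative_neg_eq[OF open_U x Psi_swap(2) Psi_diff[OF x]])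
  then show ?thesis
    unfolding nabla_Psi_def
    by (simp add: Psi_swap(2)[of x a c "\<Gamma> x v b"] Psi_swap(2)[of x a "\<Gamma> x v c" b] Psi_swap(2)[of x _ c b])
qed

lemma torsion_exists:
  assumes x: "x \<in> U"
  shows "\<exists>T. \<forall>a b c. N x v (E x a) (E x b) (E x c) = psi [T, axis a 1, axis b 1, axis c 1]"
proof -
  have e: "(\<Sum>i\<in>UNIV. N x v (E x a) (E x b) (E x i) * phi [axis i 1, axis c 1, axis d 1]
      + phi [axis a 1, axis b 1, axis i 1] * N x v (E x i) (E x c) (E x d)) = nabla_Psi x v (E x a) (E x b) (E x c) (E x d)"
    for a b c d
    by (simp add: nabla_Psi_eq[OF x] S_eq[OF x] u_E[OF x])
  obtain T where "\<And>a b c. N x v (E x a) (E x b) (E x c) = psi [T, axis a 1, axis b 1, axis c 1]"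
    by (rule phi_variation_eq_psi[where f = "\<lambda>a b c. N x v (E x a) (E x b) (E x c)"])
      (rule N_swap[OF x], rule N_swap[OF x], unfold e, rule nabla_Psi_swap[OF x], blast)
  then show ?thesis by blast
qed

end

subsection \<open>Index computations\<close>

abbreviation ph :: "7 \<Rightarrow> 7 \<Rightarrow> 7 \<Rightarrow> real" where
  "ph i j k \<equiv> phi [axis i 1, axis j 1, axis k 1]"

abbreviation ps :: "7 \<Rightarrow> 7 \<Rightarrow> 7 \<Rightarrow> 7 \<Rightarrow> real" where
  "ps i j k l \<equiv> psi [axis i 1, axis j 1, axis k 1, axis l 1]"

lemma ph_contraction2: "(\<Sum>j\<in>UNIV. \<Sum>k\<in>UNIV. ph i j k * ph n j k) = (if i = n then 6 else 0)"
proof -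
  have "\<forall>i n. (\<Sum>j\<in>UNIV. \<Sum>k\<in>UNIV. ph i j k * ph n j k) = (if i = n then 6 else 0)"
    unfolding forall_7 by (intro conjI; simp add: sum_7 phi_axis_axis axis_7 neq_7)
  then show ?thesis by blast
qed

lemma ph_contraction1:
  "(\<Sum>k\<in>UNIV. ph i j k * ph m n k) =
     (if i = m \<and> j = n then 1 else 0) - (if i = n \<and> j = m then 1 else 0) + ps i j m n"
proof -
  have rot: "ph m n k = ph k m n" for k
    using phi_swap(2)[of "axis m 1" "axis n 1" "axis k 1"] phi_swap(1)[of "axis m 1" "axis k 1" "axis n 1"] by simp
  have "(\<Sum>k\<in>UNIV. ph i j k * ph m n k) = (\<Sum>k\<in>UNIV. ph i j k * ph k m n)"
    by (intro sum.cong refl arg_cong2[where f = "(*)"] rot)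
  moreover have "(axis a 1 :: real ^ 7) \<bullet> axis b 1 = (if a = b then 1 else 0)" for a b :: 7
    by (simp only: inner_axis_axis) simp
  ultimately show ?thesis
    unfolding phi_contraction
    by (cases "i = m"; cases "j = n"; cases "i = n"; cases "j = m";
        simp only: if_True if_False simp_thms mult_1_left mult_zero_left mult_zero_right mult_1_right)
qed

text \<open>Averaging over cyclic renamings of the summed indices leaves \<open>q\<close> fixed and
  turns \<open>r\<close> into its Bianchi sum.\<close>

lemma alternating_sum_bianchi:
  fixes r q :: "'i::finite \<Rightarrow> 'i \<Rightarrow> 'i \<Rightarrow> real"
  assumes "\<And>a b c. r a b c + r b c a + r c a b = 0" "\<And>a b c. q b c a = q a b c"
  shows "(\<Sum>a\<in>UNIV. \<Sum>b\<in>UNIV. \<Sum>c\<in>UNIV. q a b c * r a b c) = 0"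
proof -
  let ?s = "\<Sum>a\<in>UNIV. \<Sum>b\<in>UNIV. \<Sum>c\<in>UNIV. q a b c * r a b c"
  have 1: "?s = (\<Sum>a\<in>UNIV. \<Sum>b\<in>UNIV. \<Sum>c\<in>UNIV. q a b c * r b c a)"
    by (subst sum_rotate3[symmetric]) (simp add: assms(2))
  have 2: "?s = (\<Sum>a\<in>UNIV. \<Sum>b\<in>UNIV. \<Sum>c\<in>UNIV. q a b c * r c a b)"
    by (subst sum_rotate3) (simp add: assms(2)[symmetric])
  have "3 * ?s = (\<Sum>a\<in>UNIV. \<Sum>b\<in>UNIV. \<Sum>c\<in>UNIV. q a b c * (r a b c + r b c a + r c a b))"
    using 1 2 by (simp add: distrib_left sum.distrib)
  then show ?thesis by (simp add: assms(1))
qed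

text \<open>Four Bianchi identities, one for each choice of the index in last position, are combined
  by means of the two skew symmetries.\<close>

lemma pair_symmetry:
  fixes r :: "'i \<Rightarrow> 'i \<Rightarrow> 'i \<Rightarrow> 'i \<Rightarrow> real"
  assumes "\<And>a b c d. r b a c d = - r a b c d" "\<And>a b c d. r a b d c = - r a b c d"
    "\<And>a b c d. r a b c d + r b c a d + r c a b d = 0"
  shows "r a b c d = r c d a b"
  using assms(3)[of a b c d] assms(3)[of b c d a] assms(3)[of c d a b] assms(3)[of d a b c]
    assms(1,2)[of a b c d] assms(1,2)[of b c a d] assms(1,2)[of c a b d] assms(1,2)[of b c d a]
    assms(1,2)[of c d b a] assms(1,2)[of d b c a] assms(1,2)[of c d a b] assms(1,2)[of d a c b]
    assms(1,2)[of a c d b] assms(1,2)[of d a b c] assms(1,2)[of a b d c] assms(1,2)[of b d a c]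
  by linarith

text \<open>
  Here \<open>h\<close> and \<open>\<kappa>\<close> are the components of \<open>\<nabla>\<phi>\<close> and \<open>\<nabla>\<nabla>\<phi>\<close>, and \<open>r a b c d\<close> is \<open>\<langle>R(e\<^sub>a, e\<^sub>b) e\<^sub>c, e\<^sub>d\<rangle>\<close>. The
  hypotheses \<open>trace\<close> and \<open>div\<close> are the derivatives of \<open>\<langle>\<phi>, \<nabla>\<^sub>l \<phi>\<rangle> = 0\<close> and of \<open>\<phi>\<^sub>p\<^sub>j\<^sub>k (div \<phi>)\<^sub>j\<^sub>k = 0\<close>.
\<close>
lemma scalar_curvature_formula_index:
  fixes h :: "7 \<Rightarrow> 7 \<Rightarrow> 7 \<Rightarrow> 7 \<Rightarrow> real" and \<kappa> :: "7 \<Rightarrow> 7 \<Rightarrow> 7 \<Rightarrow> 7 \<Rightarrow> 7 \<Rightarrow> real"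
    and r :: "7 \<Rightarrow> 7 \<Rightarrow> 7 \<Rightarrow> 7 \<Rightarrow> real"
  assumes trace: "\<And>v l. (\<Sum>i\<in>UNIV. \<Sum>j\<in>UNIV. \<Sum>k\<in>UNIV. h v i j k * h l i j k + ph i j k * \<kappa> v l i j k) = 0"
    and div: "\<And>v p. (\<Sum>m\<in>UNIV. \<Sum>j\<in>UNIV. \<Sum>k\<in>UNIV. h v p j k * h m m j k + ph p j k * \<kappa> v m m j k) = 0"
    and closed: "\<And>w a b c d. \<kappa> w a b c d - \<kappa> w b a c d + \<kappa> w c a b d - \<kappa> w d a b c = 0"
    and ricci: "\<And>w v a b c. \<kappa> w v a b c - \<kappa> v w a b c = - (\<Sum>n\<in>UNIV. r w v a n * ph n b c)
       - (\<Sum>n\<in>UNIV. r w v b n * ph a n c) - (\<Sum>n\<in>UNIV. r w v c n * ph a b n)"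
    and skew: "\<And>a b c d. r b a c d = - r a b c d" "\<And>a b c d. r a b d c = - r a b c d"
    and bianchi: "\<And>a b c d. r a b c d + r b c a d + r c a b d = 0"
  shows "12 * (\<Sum>i\<in>UNIV. \<Sum>m\<in>UNIV. r m i i m) =
     3 * (\<Sum>j\<in>UNIV. \<Sum>k\<in>UNIV. (\<Sum>m\<in>UNIV. h m m j k)\<^sup>2)
     - (\<Sum>l\<in>UNIV. \<Sum>i\<in>UNIV. \<Sum>j\<in>UNIV. \<Sum>k\<in>UNIV. (h l i j k)\<^sup>2)"
proof -
  let ?Scal = "\<Sum>i\<in>UNIV. \<Sum>m\<in>UNIV. r m i i m"
  \<comment> \<open>In \<open>Y\<close> the index of the outer derivative is traced with a slot of
    the form; commuting the two derivatives turns this into the derivative of a divergence.\<close>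
  define Y where "Y = (\<Sum>m\<in>UNIV. \<Sum>i\<in>UNIV. \<Sum>j\<in>UNIV. \<Sum>k\<in>UNIV. ph i j k * \<kappa> m i m j k)"
  have ph1: "ph j i k = - ph i j k" for i j k by (rule phi_swap)
  have ph2: "ph i k j = - ph i j k" for i j k by (rule phi_swap)
  have rot: "ph j k i = ph i j k" for i j k using ph1[of j i k] ph2[of j i k] by simp
  \<comment> \<open>Closedness moves the inner derivative index into the form. By alternation of
    \<open>ph\<close> the three resulting terms agree, hence the factor 3.\<close>
  have "(\<Sum>m\<in>UNIV. \<Sum>i\<in>UNIV. \<Sum>j\<in>UNIV. \<Sum>k\<in>UNIV. ph i j k * \<kappa> m m i j k) =
    (\<Sum>m\<in>UNIV. \<Sum>i\<in>UNIV. \<Sum>j\<in>UNIV. \<Sum>k\<in>UNIV. ph i j k * \<kappa> m i m j k - ph i j k * \<kappa> m j m i k + ph i j k * \<kappa> m k m i j)"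
    (is "?X = _")
  proof (intro sum.cong refl)
    fix m i j k
    have "\<kappa> m m i j k = \<kappa> m i m j k - \<kappa> m j m i k + \<kappa> m k m i j" using closed[of m m i j k] by linarith
    then show "ph i j k * \<kappa> m m i j k = ph i j k * \<kappa> m i m j k - ph i j k * \<kappa> m j m i k + ph i j k * \<kappa> m k m i j"
      by (simp only: right_diff_distrib distrib_left)
  qed
  also have "\<dots> = Y - (\<Sum>m\<in>UNIV. \<Sum>i\<in>UNIV. \<Sum>j\<in>UNIV. \<Sum>k\<in>UNIV. ph i j k * \<kappa> m j m i k)
      + (\<Sum>m\<in>UNIV. \<Sum>i\<in>UNIV. \<Sum>j\<in>UNIV. \<Sum>k\<in>UNIV. ph i j k * \<kappa> m k m i j)"
    by (simp add: Y_def sum.distrib sum_subtractf)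
  also have "(\<Sum>m\<in>UNIV. \<Sum>i\<in>UNIV. \<Sum>j\<in>UNIV. \<Sum>k\<in>UNIV. ph i j k * \<kappa> m j m i k) = - Y"
  proof -
    have m: "ph i j k * x = - (ph j i k * x)" for i j k x
      by (simp only: ph1[of j i k] mult_minus_left minus_minus)
    have "(\<Sum>m\<in>UNIV. \<Sum>i\<in>UNIV. \<Sum>j\<in>UNIV. \<Sum>k\<in>UNIV. ph i j k * \<kappa> m j m i k) =
      (\<Sum>m\<in>UNIV. \<Sum>j\<in>UNIV. \<Sum>i\<in>UNIV. \<Sum>k\<in>UNIV. ph i j k * \<kappa> m j m i k)"
      by (rule sum.cong[OF refl], rule sum.swap)
    also have "\<dots> = (\<Sum>m\<in>UNIV. \<Sum>j\<in>UNIV. \<Sum>i\<in>UNIV. \<Sum>k\<in>UNIV. - (ph j i k * \<kappa> m j m i k))"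
      by (intro sum.cong refl m)
    finally show ?thesis by (simp only: Y_def sum_negf)
  qed
  also have "(\<Sum>m\<in>UNIV. \<Sum>i\<in>UNIV. \<Sum>j\<in>UNIV. \<Sum>k\<in>UNIV. ph i j k * \<kappa> m k m i j) = Y"
    unfolding Y_def
    by (rule sum.cong[OF refl], subst sum_rotate3[symmetric]) (simp only: rot)
  finally have XY: "?X = 3 * Y" by simp
  have "(\<Sum>l\<in>UNIV. \<Sum>i\<in>UNIV. \<Sum>j\<in>UNIV. \<Sum>k\<in>UNIV. h l i j k * h l i j k + ph i j k * \<kappa> l l i j k) = 0"
    by (simp only: trace sum.neutral_const)
  then have H: "(\<Sum>l\<in>UNIV. \<Sum>i\<in>UNIV. \<Sum>j\<in>UNIV. \<Sum>k\<in>UNIV. (h l i j k)\<^sup>2) = - (3 * Y)"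
    unfolding XY[symmetric] by (simp add: sum.distrib power2_eq_square)
  \<comment> \<open>The curvature acting on the three slots of the form. The values are -6, 1 and 1
    times \<open>?Scal\<close>, so \<open>Y\<close> is 4 times \<open>?Scal\<close> minus the
    squared norm of the divergence.\<close>
  define Z1 where "Z1 = (\<Sum>m\<in>UNIV. \<Sum>i\<in>UNIV. \<Sum>j\<in>UNIV. \<Sum>k\<in>UNIV. \<Sum>n\<in>UNIV. ph i j k * (r m i m n * ph n j k))"
  define Z2 where "Z2 = (\<Sum>m\<in>UNIV. \<Sum>i\<in>UNIV. \<Sum>j\<in>UNIV. \<Sum>k\<in>UNIV. \<Sum>n\<in>UNIV. ph i j k * (r m i j n * ph m n k))"
  define Z3 where "Z3 = (\<Sum>m\<in>UNIV. \<Sum>i\<in>UNIV. \<Sum>j\<in>UNIV. \<Sum>k\<in>UNIV. \<Sum>n\<in>UNIV. ph i j k * (r m i k n * ph m j n))"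
  have "Y = (\<Sum>m\<in>UNIV. \<Sum>i\<in>UNIV. \<Sum>j\<in>UNIV. \<Sum>k\<in>UNIV. ph i j k * \<kappa> i m m j k - ph i j k * (\<Sum>n\<in>UNIV. r m i m n * ph n j k)
     - ph i j k * (\<Sum>n\<in>UNIV. r m i j n * ph m n k) - ph i j k * (\<Sum>n\<in>UNIV. r m i k n * ph m j n))"
    unfolding Y_def
  proof (intro sum.cong refl)
    fix m i j k
    have "\<kappa> m i m j k = \<kappa> i m m j k - (\<Sum>n\<in>UNIV. r m i m n * ph n j k)
       - (\<Sum>n\<in>UNIV. r m i j n * ph m n k) - (\<Sum>n\<in>UNIV. r m i k n * ph m j n)"
      using ricci[of m i m j k] by linarith
    then show "ph i j k * \<kappa> m i m j k = ph i j k * \<kappa> i m m j k - ph i j k * (\<Sum>n\<in>UNIV. r m i m n * ph n j k)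
       - ph i j k * (\<Sum>n\<in>UNIV. r m i j n * ph m n k) - ph i j k * (\<Sum>n\<in>UNIV. r m i k n * ph m j n)"
      by (simp only: right_diff_distrib)
  qed
  then have Y: "Y = (\<Sum>m\<in>UNIV. \<Sum>i\<in>UNIV. \<Sum>j\<in>UNIV. \<Sum>k\<in>UNIV. ph i j k * \<kappa> i m m j k) - Z1 - Z2 - Z3"
    by (simp add: Z1_def Z2_def Z3_def sum_subtractf sum_distrib_left)
  have D: "(\<Sum>m\<in>UNIV. \<Sum>i\<in>UNIV. \<Sum>j\<in>UNIV. \<Sum>k\<in>UNIV. ph i j k * \<kappa> i m m j k) =
    - (\<Sum>j\<in>UNIV. \<Sum>k\<in>UNIV. (\<Sum>m\<in>UNIV. h m m j k)\<^sup>2)"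
  proof -
    have "(\<Sum>m\<in>UNIV. \<Sum>i\<in>UNIV. \<Sum>j\<in>UNIV. \<Sum>k\<in>UNIV. ph i j k * \<kappa> i m m j k) =
      (\<Sum>i\<in>UNIV. \<Sum>m\<in>UNIV. \<Sum>j\<in>UNIV. \<Sum>k\<in>UNIV. ph i j k * \<kappa> i m m j k)" by (rule sum.swap)
    moreover have "(\<Sum>i\<in>UNIV. \<Sum>m\<in>UNIV. \<Sum>j\<in>UNIV. \<Sum>k\<in>UNIV. h i i j k * h m m j k + ph i j k * \<kappa> i m m j k) = 0"
      by (simp only: div sum.neutral_const)
    moreover have "(\<Sum>i\<in>UNIV. \<Sum>m\<in>UNIV. \<Sum>j\<in>UNIV. \<Sum>k\<in>UNIV. h i i j k * h m m j k)
       = (\<Sum>j\<in>UNIV. \<Sum>k\<in>UNIV. \<Sum>i\<in>UNIV. \<Sum>m\<in>UNIV. h i i j k * h m m j k)"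
      by (subst sum_rotate4[symmetric, of _ UNIV], subst (2) sum_rotate4[symmetric], simp)
    moreover have "\<dots> = (\<Sum>j\<in>UNIV. \<Sum>k\<in>UNIV. (\<Sum>m\<in>UNIV. h m m j k)\<^sup>2)"
      by (simp add: power2_eq_square sum_product)
    ultimately show ?thesis by (simp add: sum.distrib)
  qed
  have rmm: "r m m j n = 0" for m j n using skew(1)[of m m j n] by simp
  have scal: "(\<Sum>m\<in>UNIV. \<Sum>i\<in>UNIV. r m i m i) = - ?Scal"
  proof -
    have "(\<Sum>m\<in>UNIV. \<Sum>i\<in>UNIV. r m i m i) = (\<Sum>i\<in>UNIV. \<Sum>m\<in>UNIV. r m i m i)" by (rule sum.swap)
    also have "\<dots> = (\<Sum>i\<in>UNIV. \<Sum>m\<in>UNIV. - r m i i m)" by (intro sum.cong refl skew(2))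
    finally show ?thesis by (simp add: sum_negf)
  qed
  have Z1: "Z1 = - 6 * ?Scal"
  proof -
    have "Z1 = (\<Sum>m\<in>UNIV. \<Sum>i\<in>UNIV. \<Sum>n\<in>UNIV. r m i m n * (\<Sum>j\<in>UNIV. \<Sum>k\<in>UNIV. ph i j k * ph n j k))"
    proof -
      have m: "ph i j k * (r m i m n * ph n j k) = r m i m n * (ph i j k * ph n j k)" for i j k m n by simp
      have "Z1 = (\<Sum>m\<in>UNIV. \<Sum>i\<in>UNIV. \<Sum>n\<in>UNIV. \<Sum>j\<in>UNIV. \<Sum>k\<in>UNIV. ph i j k * (r m i m n * ph n j k))"
        unfolding Z1_def by (rule sum.cong[OF refl], rule sum.cong[OF refl], rule sum_rotate3[symmetric])
      then show ?thesis by (simp only: m sum_distrib_left)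
    qed
    also have "\<dots> = (\<Sum>m\<in>UNIV. \<Sum>i\<in>UNIV. \<Sum>n\<in>UNIV. if i = n then 6 * r m i m n else 0)"
      unfolding ph_contraction2 by (intro sum.cong refl) simp
    also have "\<dots> = 6 * (\<Sum>m\<in>UNIV. \<Sum>i\<in>UNIV. r m i m i)"
      by (simp add: sum_distrib_left)
    finally show ?thesis by (simp add: scal)
  qed
  have Z2: "Z2 = ?Scal"
  proof -
    have "Z2 = (\<Sum>m\<in>UNIV. \<Sum>i\<in>UNIV. \<Sum>j\<in>UNIV. \<Sum>n\<in>UNIV. r m i j n * (\<Sum>k\<in>UNIV. ph i j k * ph m n k))"
    proof -
      have m: "ph i j k * (r m i j n * ph m n k) = r m i j n * (ph i j k * ph m n k)" for i j k m n by simp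
      have "Z2 = (\<Sum>m\<in>UNIV. \<Sum>i\<in>UNIV. \<Sum>j\<in>UNIV. \<Sum>n\<in>UNIV. \<Sum>k\<in>UNIV. ph i j k * (r m i j n * ph m n k))"
        unfolding Z2_def by (rule sum.cong[OF refl], rule sum.cong[OF refl], rule sum.cong[OF refl], rule sum.swap)
      then show ?thesis by (simp only: m sum_distrib_left)
    qed
    \<comment> \<open>The first delta term meets \<open>r m m j n = 0\<close>, the second leaves a
      trace, and the \<open>ps\<close> term is going to vanish by the Bianchi identity.\<close>
    also have "\<dots> = (\<Sum>m\<in>UNIV. \<Sum>i\<in>UNIV. \<Sum>j\<in>UNIV. \<Sum>n\<in>UNIV.
       ps i j m n * r m i j n - (if i = n then if j = m then r m i j n else 0 else 0))"
      unfolding ph_contraction1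
    proof (intro sum.cong refl)
      fix m i j n
      have "r m i j n * (if i = m \<and> j = n then 1 else 0) = 0" by (cases "i = m") (simp_all add: rmm)
      moreover have "r m i j n * (if i = n \<and> j = m then 1 else 0) = (if i = n then if j = m then r m i j n else 0 else 0)"
        by simp
      ultimately show "r m i j n * ((if i = m \<and> j = n then 1 else 0) - (if i = n \<and> j = m then 1 else 0) + ps i j m n) =
        ps i j m n * r m i j n - (if i = n then if j = m then r m i j n else 0 else 0)"
        by (simp only: distrib_left right_diff_distrib) (simp only: mult.commute[of "ps i j m n"] diff_0 add.commute[of _ "r m i j n * ps i j m n"] diff_conv_add_uminus)
    qed
    also have "\<dots> = (\<Sum>m\<in>UNIV. \<Sum>i\<in>UNIV. \<Sum>j\<in>UNIV. \<Sum>n\<in>UNIV. ps i j m n * r m i j n)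
       - (\<Sum>m\<in>UNIV. \<Sum>i\<in>UNIV. r m i m i)"
      by (simp add: sum_subtractf)
    also have "(\<Sum>m\<in>UNIV. \<Sum>i\<in>UNIV. \<Sum>j\<in>UNIV. \<Sum>n\<in>UNIV. ps i j m n * r m i j n) =
       (\<Sum>n\<in>UNIV. \<Sum>m\<in>UNIV. \<Sum>i\<in>UNIV. \<Sum>j\<in>UNIV. ps i j m n * r m i j n)"
      by (rule sum_rotate4[symmetric])
    also have "\<dots> = 0"
    proof (rule sum.neutral, rule ballI)
      fix n
      have "ps j m i n = ps i j m n" for m i j
        using psi_swap(2)[of "axis j 1" "axis m 1" "axis i 1" "axis n 1"] psi_swap(1)[of "axis j 1" "axis i 1" "axis m 1" "axis n 1"]
        by simp
      then show "(\<Sum>m\<in>UNIV. \<Sum>i\<in>UNIV. \<Sum>j\<in>UNIV. ps i j m n * r m i j n) = 0"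
        by (intro alternating_sum_bianchi[where r = "\<lambda>m i j. r m i j n"] bianchi)
    qed
    finally show ?thesis by (simp add: scal)
  qed
  have Z3: "Z3 = Z2"
  proof -
    have m: "ph i j k * (x * ph m j n) = ph i k j * (x * ph m n j)" for i j k m n x
      by (simp only: ph2[of i k j] ph2[of m j n] mult_minus_left mult_minus_right)
    have "Z3 = (\<Sum>m\<in>UNIV. \<Sum>i\<in>UNIV. \<Sum>k\<in>UNIV. \<Sum>j\<in>UNIV. \<Sum>n\<in>UNIV. ph i j k * (r m i k n * ph m j n))"
      unfolding Z3_def by (rule sum.cong[OF refl], rule sum.cong[OF refl], rule sum.swap)
    also have "\<dots> = Z2"
      unfolding Z2_def by (intro sum.cong refl m)
    finally show ?thesis .
  qed
  show ?thesis using H Y D Z1 Z2 Z3 by simp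
qed

text \<open>The hypothesis \<open>stab\<close> says that the curvature endomorphisms annihilate \<open>\<phi>\<close>.\<close>
lemma ricci_flat_index:
  fixes r :: "7 \<Rightarrow> 7 \<Rightarrow> 7 \<Rightarrow> 7 \<Rightarrow> real"
  assumes stab: "\<And>w v a b c. (\<Sum>n\<in>UNIV. r w v a n * ph n b c) + (\<Sum>n\<in>UNIV. r w v b n * ph a n c)
       + (\<Sum>n\<in>UNIV. r w v c n * ph a b n) = 0"
    and skew: "\<And>a b c d. r b a c d = - r a b c d" "\<And>a b c d. r a b d c = - r a b c d"
    and bianchi: "\<And>a b c d. r a b c d + r b c a d + r c a b d = 0"
  shows "(\<Sum>i\<in>UNIV. r i v k i) = 0"
proof -
  let ?Q = "\<Sum>i\<in>UNIV. r i v i k"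
  have ph2: "ph i k j = - ph i j k" for i j k by (rule phi_swap)
  have rnn: "r i v n n = 0" for i n using skew(2)[of i v n n] by simp
  \<comment> \<open>The stabilizer equation is traced over \<open>w = a = i\<close> and paired with
    \<open>ph k b c\<close>. Its three parts are 6, -1 and -1 times \<open>?Q\<close>, so 4 times
    \<open>?Q\<close> vanishes.\<close>
  define A where "A = (\<Sum>i\<in>UNIV. \<Sum>b\<in>UNIV. \<Sum>c\<in>UNIV. \<Sum>n\<in>UNIV. ph k b c * (r i v i n * ph n b c))"
  define B where "B = (\<Sum>i\<in>UNIV. \<Sum>b\<in>UNIV. \<Sum>c\<in>UNIV. \<Sum>n\<in>UNIV. ph k b c * (r i v b n * ph i n c))"
  define C where "C = (\<Sum>i\<in>UNIV. \<Sum>b\<in>UNIV. \<Sum>c\<in>UNIV. \<Sum>n\<in>UNIV. ph k b c * (r i v c n * ph i b n))"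
  have "(\<Sum>i\<in>UNIV. \<Sum>b\<in>UNIV. \<Sum>c\<in>UNIV. ph k b c * ((\<Sum>n\<in>UNIV. r i v i n * ph n b c) + (\<Sum>n\<in>UNIV. r i v b n * ph i n c)
       + (\<Sum>n\<in>UNIV. r i v c n * ph i b n))) = 0"
    by (simp only: stab mult_zero_right sum.neutral_const)
  then have ABC: "A + B + C = 0"
    by (simp only: A_def B_def C_def distrib_left sum.distrib sum_distrib_left)
  have "A = 6 * ?Q"
  proof -
    have m: "ph k b c * (r i v i n * ph n b c) = r i v i n * (ph k b c * ph n b c)" for i b c n by simp
    have "A = (\<Sum>i\<in>UNIV. \<Sum>n\<in>UNIV. \<Sum>b\<in>UNIV. \<Sum>c\<in>UNIV. ph k b c * (r i v i n * ph n b c))"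
      unfolding A_def by (rule sum.cong[OF refl], rule sum_rotate3[symmetric])
    also have "\<dots> = (\<Sum>i\<in>UNIV. \<Sum>n\<in>UNIV. r i v i n * (\<Sum>b\<in>UNIV. \<Sum>c\<in>UNIV. ph k b c * ph n b c))"
      by (simp only: m sum_distrib_left)
    also have "\<dots> = (\<Sum>i\<in>UNIV. \<Sum>n\<in>UNIV. if k = n then 6 * r i v i n else 0)"
      unfolding ph_contraction2 by (intro sum.cong refl) simp
    also have "\<dots> = 6 * ?Q" by (simp add: sum_distrib_left)
    finally show ?thesis .
  qed
  moreover have B: "B = - ?Q"
  proof -
    have m: "ph k b c * (r i v b n * ph i n c) = r i v b n * (ph k b c * ph i n c)" for i b c n by simp
    have "B = (\<Sum>i\<in>UNIV. \<Sum>b\<in>UNIV. \<Sum>n\<in>UNIV. \<Sum>c\<in>UNIV. ph k b c * (r i v b n * ph i n c))"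
      unfolding B_def by (rule sum.cong[OF refl], rule sum.cong[OF refl], rule sum.swap)
    also have "\<dots> = (\<Sum>i\<in>UNIV. \<Sum>b\<in>UNIV. \<Sum>n\<in>UNIV. r i v b n * (\<Sum>c\<in>UNIV. ph k b c * ph i n c))"
      by (simp only: m sum_distrib_left)
    also have "\<dots> = (\<Sum>i\<in>UNIV. \<Sum>b\<in>UNIV. \<Sum>n\<in>UNIV. ps k b i n * r i v b n - (if k = n then if b = i then r i v b n else 0 else 0))"
      unfolding ph_contraction1
    proof (intro sum.cong refl)
      fix i b n
      have "r i v b n * (if k = i \<and> b = n then 1 else 0) = 0" by (cases "b = n") (simp_all add: rnn)
      moreover have "r i v b n * (if k = n \<and> b = i then 1 else 0) = (if k = n then if b = i then r i v b n else 0 else 0)"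
        by simp
      ultimately show "r i v b n * ((if k = i \<and> b = n then 1 else 0) - (if k = n \<and> b = i then 1 else 0) + ps k b i n) =
        ps k b i n * r i v b n - (if k = n then if b = i then r i v b n else 0 else 0)"
        by (simp only: distrib_left right_diff_distrib)
          (simp only: mult.commute[of "ps k b i n"] diff_0 add.commute[of _ "r i v b n * ps k b i n"] diff_conv_add_uminus)
    qed
    also have "\<dots> = (\<Sum>i\<in>UNIV. \<Sum>b\<in>UNIV. \<Sum>n\<in>UNIV. ps k b i n * r i v b n) - ?Q"
      by (simp add: sum_subtractf)
    \<comment> \<open>Pair symmetry brings the fixed index \<open>v\<close> into last position, so
      that the three summed indices are the ones permuted in the Bianchi identity.\<close>
    also have "(\<Sum>i\<in>UNIV. \<Sum>b\<in>UNIV. \<Sum>n\<in>UNIV. ps k b i n * r i v b n) =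
        (\<Sum>i\<in>UNIV. \<Sum>b\<in>UNIV. \<Sum>n\<in>UNIV. ps k b i n * r b n i v)"
      by (intro sum.cong refl arg_cong2[where f = "(*)"] pair_symmetry[of r, OF skew bianchi])
    also have "\<dots> = 0"
    proof (rule alternating_sum_bianchi[where r = "\<lambda>i b n. r b n i v" and q = "\<lambda>i b n. ps k b i n"])
      show "r b c a v + r c a b v + r a b c v = 0" for a b c using bianchi[of a b c v] by linarith
      show "ps k c b a = ps k b a c" for a b c
        using psi_swap(2)[of "axis k 1" "axis c 1" "axis b 1" "axis a 1"] psi_swap(3)[of "axis k 1" "axis b 1" "axis c 1" "axis a 1"]
        by simp
    qed
    finally show ?thesis by simp
  qed
  moreover have "C = B"
  proof -
    have m: "ph k b c * (x * ph i b n) = ph k c b * (x * ph i n b)" for b c i n x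
      by (simp only: ph2[of k c b] ph2[of i n b] mult_minus_left mult_minus_right minus_minus)
    have "C = (\<Sum>i\<in>UNIV. \<Sum>c\<in>UNIV. \<Sum>b\<in>UNIV. \<Sum>n\<in>UNIV. ph k b c * (r i v c n * ph i b n))"
      unfolding C_def by (rule sum.cong[OF refl], rule sum.swap)
    also have "\<dots> = B"
      unfolding B_def by (intro sum.cong refl m)
    finally show ?thesis .
  qed
  ultimately have "?Q = 0" using ABC by linarith
  moreover have "(\<Sum>i\<in>UNIV. r i v k i) = (\<Sum>i\<in>UNIV. - r i v i k)" by (intro sum.cong refl skew(2))
  ultimately show ?thesis by (simp add: sum_negf)
qed

subsection \<open>Closed \<open>G\<^sub>2\<close>-structures on a coordinate domain\<close>

lemma linear_sum_const:
  fixes f :: "'i \<Rightarrow> 'a::real_vector \<Rightarrow> real"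
  assumes "\<And>i. linear (f i)" shows "linear (\<lambda>a. \<Sum>i\<in>I. f i a)"
  by (rule linear_compose_sum) (use assms in auto)

context g2_domain begin

text \<open>The triple trace is a smooth function and has the same value in every frame. It
  therefore vanishes on \<open>U\<close> and can be differentiated, even though the frames
  \<open>E y\<close> may vary discontinuously; at \<open>x\<close> the result is read in the fixed
  frame \<open>E x\<close>.\<close>

lemma contract3_zero_deriv:
  assumes W: "\<And>p q r t. metric.smooth_bilinear (\<lambda>y a b. W y a b p q r t)"
     "\<And>p q r t. metric.smooth_bilinear (\<lambda>y a b. W y p q a b r t)"
     "\<And>p q r t. metric.smooth_bilinear (\<lambda>y a b. W y p q r t a b)"
    and zero: "\<And>y. y \<in> U \<Longrightarrow> (\<Sum>i\<in>UNIV. \<Sum>j\<in>UNIV. \<Sum>k\<in>UNIV. W y (E y i) (E y i) (E y j) (E y j) (E y k) (E y k)) = 0"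
    and x: "x \<in> U"
  shows "(\<Sum>i\<in>UNIV. \<Sum>j\<in>UNIV. \<Sum>k\<in>UNIV. dderiv (\<lambda>y. W y (E x i) (E x i) (E x j) (E x j) (E x k) (E x k)) x v
       - W x (\<Gamma> x v (E x i)) (E x i) (E x j) (E x j) (E x k) (E x k) - W x (E x i) (\<Gamma> x v (E x i)) (E x j) (E x j) (E x k) (E x k)
       - W x (E x i) (E x i) (\<Gamma> x v (E x j)) (E x j) (E x k) (E x k) - W x (E x i) (E x i) (E x j) (\<Gamma> x v (E x j)) (E x k) (E x k)
       - W x (E x i) (E x i) (E x j) (E x j) (\<Gamma> x v (E x k)) (E x k) - W x (E x i) (E x i) (E x j) (E x j) (E x k) (\<Gamma> x v (E x k))) = 0"
proof -
  let ?C = "metric.contract (\<lambda>y a b. metric.contract (\<lambda>y c d. metric.contract (\<lambda>y e f. W y a b c d e f) y) y)"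
  have z: "0 = ?C y" if "y \<in> U" for y
    unfolding metric.contract3_frame[OF W that frame_E[OF that]] zero[OF that] ..
  have "frechet_derivative (\<lambda>y. 0) (at x) = frechet_derivative ?C (at x)"
    by (rule frechet_derivative_transform_within_open[OF differentiable_const open_U x z])
  then have "dderiv ?C x v = 0" by (metis frechet_derivative_const)
  then show ?thesis
    unfolding metric.contract3_deriv[OF W x frame_E[OF x]] .
qed

abbreviation "T_spec x v T \<equiv> (\<forall>a b c. N x v (E x a) (E x b) (E x c) = psi [T, axis a 1, axis b 1, axis c 1])"

lemma S_E: "x \<in> U \<Longrightarrow> S x (E x i) (E x j) (E x k) = ph i j k"
  by (simp add: S_eq u_E)

lemma SN_trace:
  assumes x: "x \<in> U"
  shows "(\<Sum>i\<in>UNIV. \<Sum>j\<in>UNIV. \<Sum>k\<in>UNIV. S x (E x i) (E x j) (E x k) * N x v (E x i) (E x j) (E x k)) = 0"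
proof -
  obtain T where "T_spec x v T" using torsion_exists[OF x] by blast
  then show ?thesis by (simp only: S_E[OF x] phi_psi_trace)
qed

lemma trace_identity:
  assumes x: "x \<in> U"
  shows "(\<Sum>i\<in>UNIV. \<Sum>j\<in>UNIV. \<Sum>k\<in>UNIV. N x v (E x i) (E x j) (E x k) * N x l (E x i) (E x j) (E x k)
     + ph i j k * K x v l (E x i) (E x j) (E x k)) = 0"
proof -
  let ?W = "\<lambda>y a b c d e f. S y a c e * N y l b d f"
  have W: "metric.smooth_bilinear (\<lambda>y a b. ?W y a b p q r t)"
     "metric.smooth_bilinear (\<lambda>y a b. ?W y p q a b r t)"
     "metric.smooth_bilinear (\<lambda>y a b. ?W y p q r t a b)" for p q r t
    unfolding metric.smooth_bilinear_def
    by (intro conjI allI ballI Ck_on_mult open_U S_smooth N_smooth linear_mult_const S_linear N_linear; assumption)+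
  have z: "(\<Sum>i\<in>UNIV. \<Sum>j\<in>UNIV. \<Sum>k\<in>UNIV. ?W y (E y i) (E y i) (E y j) (E y j) (E y k) (E y k)) = 0" if "y \<in> U" for y
    by (rule SN_trace[OF that])
  note c = contract3_zero_deriv[of ?W, OF W z x, of v]
  \<comment> \<open>\<open>nabla2\<close> also corrects the direction slot \<open>l\<close>; the
    extra sum vanishes by \<open>SN_trace\<close> in the direction
    \<open>\<Gamma> x v l\<close>.\<close>
  have "(\<Sum>i\<in>UNIV. \<Sum>j\<in>UNIV. \<Sum>k\<in>UNIV. N x v (E x i) (E x j) (E x k) * N x l (E x i) (E x j) (E x k)
     + S x (E x i) (E x j) (E x k) * K x v l (E x i) (E x j) (E x k)
     + S x (E x i) (E x j) (E x k) * N x (\<Gamma> x v l) (E x i) (E x j) (E x k)) = 0"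
    by (rule trans[OF _ c], intro sum.cong refl)
      (simp add: frechet_derivative_mult S_diff[OF x] N_diff[OF x] metric.nabla_def[of S x v] metric.nabla2_def algebra_simps)
  then have e: "(\<Sum>i\<in>UNIV. \<Sum>j\<in>UNIV. \<Sum>k\<in>UNIV. N x v (E x i) (E x j) (E x k) * N x l (E x i) (E x j) (E x k)
     + S x (E x i) (E x j) (E x k) * K x v l (E x i) (E x j) (E x k))
     + (\<Sum>i\<in>UNIV. \<Sum>j\<in>UNIV. \<Sum>k\<in>UNIV. S x (E x i) (E x j) (E x k) * N x (\<Gamma> x v l) (E x i) (E x j) (E x k)) = 0"
    by (simp only: sum.distrib)
  from e[unfolded SN_trace[OF x] add_0_right, unfolded S_E[OF x]] show ?thesis .
qed

end

locale closed_g2_domain = g2_domain +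
  assumes closed: "x \<in> U \<Longrightarrow> dderiv (\<lambda>y. s y [b, c, d]) x a
     - dderiv (\<lambda>y. s y [a, c, d]) x b
     + dderiv (\<lambda>y. s y [a, b, d]) x c
     - dderiv (\<lambda>y. s y [a, b, c]) x d = 0"
begin

text \<open>Since the connection is torsion-free, the \<open>\<Gamma>\<close> terms cancel in pairs,
  and the exterior derivative is the alternation of \<open>N\<close>.\<close>

lemma N_closed:
  assumes x: "x \<in> U"
  shows "N x a b c d - N x b a c d + N x c a b d - N x d a b c = 0"
proof -
  note g = metric.Gamma_sym[OF x]
  have "dderiv (\<lambda>y. S y b c d) x a - dderiv (\<lambda>y. S y a c d) x b
     + dderiv (\<lambda>y. S y a b d) x c - dderiv (\<lambda>y. S y a b c) x d = 0"
    unfolding S_def by (rule closed[OF x])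
  moreover have m: "S x p G q = - S x G p q" "S x p q G = S x G p q" for p q G
    using S_swap(1)[OF x, of G p q] S_swap(1)[OF x, of G p q] S_swap(2)[OF x, of p q G] by simp_all
  ultimately show ?thesis
    unfolding metric.nabla_def g[of b a] g[of c a] g[of d a] g[of c b] g[of d b] g[of d c]
    using m(1)[of b "\<Gamma> x a c" d] m(2)[of b c "\<Gamma> x a d"] S_swap(2)[OF x, of a "\<Gamma> x b d" c]
    by linarith
qed

text \<open>The derivative of \<open>N_closed\<close>; its correction terms are instances of
  \<open>N_closed\<close> with one argument replaced by a value of \<open>\<Gamma>\<close>.\<close>

lemma K_closed:
  assumes x: "x \<in> U"
  shows "K x w a b c d - K x w b a c d + K x w c a b d - K x w d a b c = 0"
proof -
  let ?f = "\<lambda>y. N y a b c d - N y b a c d + N y c a b d - N y d a b c"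
  note d = N_diff[OF x]
  have df: "?f differentiable (at x)" by (intro differentiable_add differentiable_diff d)
  have "frechet_derivative ?f (at x) = frechet_derivative (\<lambda>y. 0) (at x)"
    by (rule frechet_derivative_transform_within_open[OF df open_U x N_closed])
  then have "dderiv ?f x w = 0" by simp
  then have "dderiv (\<lambda>y. N y a b c d) x w - dderiv (\<lambda>y. N y b a c d) x w
      + dderiv (\<lambda>y. N y c a b d) x w - dderiv (\<lambda>y. N y d a b c) x w = 0"
    by (simp add: frechet_derivative_add frechet_derivative_diff d differentiable_add differentiable_diff)
  then show ?thesis
    unfolding metric.nabla2_def
    using N_closed[OF x, of "\<Gamma> x w a" b c d] N_closed[OF x, of a "\<Gamma> x w b" c d]
      N_closed[OF x, of a b "\<Gamma> x w c" d] N_closed[OF x, of a b c "\<Gamma> x w d"]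
    by linarith
qed


text \<open>The vector \<open>\<tau> x l\<close> is row \<open>l\<close> of the torsion tensor in
  the frame \<open>E x\<close>.\<close>

definition \<tau> :: "real ^ 7 \<Rightarrow> 7 \<Rightarrow> real ^ 7" where
  "\<tau> x l = (SOME T. T_spec x (E x l) T)"

lemma N_E:
  assumes x: "x \<in> U"
  shows "N x (E x l) (E x a) (E x b) (E x c) = psi [\<tau> x l, axis a 1, axis b 1, axis c 1]"
  using someI_ex[OF torsion_exists[OF x, of "E x l"]] unfolding \<tau>_def by blast

lemma \<tau>_closed:
  assumes x: "x \<in> U"
  shows "psi [\<tau> x l, axis a 1, axis b 1, axis c 1] - psi [\<tau> x a, axis l 1, axis b 1, axis c 1]
     + psi [\<tau> x b, axis l 1, axis a 1, axis c 1] - psi [\<tau> x c, axis l 1, axis a 1, axis b 1] = 0"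
  using N_closed[OF x, of "E x l" "E x a" "E x b" "E x c"] unfolding N_E[OF x] .

lemma N_divergence:
  assumes x: "x \<in> U"
  shows "(\<Sum>m\<in>UNIV. N x (E x m) (E x m) (E x j) (E x k)) = 2 * \<tau> x j $ k"
  unfolding N_E[OF x] by (rule closed_torsion_divergence[OF \<tau>_closed[OF x]])

text \<open>Up to the factor 2 this is \<open>closed_torsion_phi\<close>. The vector
  \<open>p\<close> is arbitrary, not a frame vector, because \<open>div_identity\<close>
  differentiates the equation with \<open>p\<close> constant.\<close>

lemma div_zero:
  assumes x: "x \<in> U"
  shows "(\<Sum>m\<in>UNIV. \<Sum>j\<in>UNIV. \<Sum>k\<in>UNIV. S x p (E x j) (E x k) * N x (E x m) (E x m) (E x j) (E x k)) = 0"
proof -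
  have "(\<Sum>m\<in>UNIV. \<Sum>j\<in>UNIV. \<Sum>k\<in>UNIV. S x p (E x j) (E x k) * N x (E x m) (E x m) (E x j) (E x k)) =
     (\<Sum>j\<in>UNIV. \<Sum>k\<in>UNIV. \<Sum>m\<in>UNIV. S x p (E x j) (E x k) * N x (E x m) (E x m) (E x j) (E x k))"
    by (rule sum_rotate3)
  also have "\<dots> = 2 * (\<Sum>j\<in>UNIV. \<Sum>k\<in>UNIV. phi [u x p, axis j 1, axis k 1] * \<tau> x j $ k)"
    by (simp add: sum_distrib_left[symmetric] N_divergence[OF x] S_eq[OF x] u_E[OF x] mult_ac)
  also have "(\<Sum>j\<in>UNIV. \<Sum>k\<in>UNIV. phi [u x p, axis j 1, axis k 1] * \<tau> x j $ k)
     = (\<Sum>a\<in>UNIV. u x p $ a * (\<Sum>j\<in>UNIV. \<Sum>k\<in>UNIV. phi [axis a 1, axis j 1, axis k 1] * \<tau> x j $ k))"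
    by (rule linear_expand) (intro linear_sum_const linear_mult_const linear_phi)
  also have "\<dots> = 0" by (simp add: closed_torsion_phi[OF \<tau>_closed[OF x]])
  finally show ?thesis by simp
qed

lemma div_identity:
  assumes x: "x \<in> U"
  shows "(\<Sum>m\<in>UNIV. \<Sum>j\<in>UNIV. \<Sum>k\<in>UNIV. N x v p (E x j) (E x k) * N x (E x m) (E x m) (E x j) (E x k)
     + S x p (E x j) (E x k) * K x v (E x m) (E x m) (E x j) (E x k)) = 0"
proof -
  let ?W = "\<lambda>y a b c d e f. S y p c e * N y a b d f"
  have W: "metric.smooth_bilinear (\<lambda>y a b. ?W y a b p q r t)"
     "metric.smooth_bilinear (\<lambda>y a b. ?W y p q a b r t)"
     "metric.smooth_bilinear (\<lambda>y a b. ?W y p q r t a b)" for p q r t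
    unfolding metric.smooth_bilinear_def
    by (intro conjI allI ballI Ck_on_mult open_U S_smooth N_smooth linear_mult_const S_linear N_linear; assumption)+
  have z: "(\<Sum>i\<in>UNIV. \<Sum>j\<in>UNIV. \<Sum>k\<in>UNIV. ?W y (E y i) (E y i) (E y j) (E y j) (E y k) (E y k)) = 0" if "y \<in> U" for y
    by (rule div_zero[OF that])
  note c = contract3_zero_deriv[of ?W, OF W z x, of v]
  have "(\<Sum>m\<in>UNIV. \<Sum>j\<in>UNIV. \<Sum>k\<in>UNIV. N x v p (E x j) (E x k) * N x (E x m) (E x m) (E x j) (E x k)
     + S x p (E x j) (E x k) * K x v (E x m) (E x m) (E x j) (E x k)
     + S x (\<Gamma> x v p) (E x j) (E x k) * N x (E x m) (E x m) (E x j) (E x k)) = 0"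
    by (rule trans[OF _ c], intro sum.cong refl)
      (simp add: frechet_derivative_mult S_diff[OF x] N_diff[OF x] metric.nabla_def[of S x v] metric.nabla2_def algebra_simps)
  then have "(\<Sum>m\<in>UNIV. \<Sum>j\<in>UNIV. \<Sum>k\<in>UNIV. N x v p (E x j) (E x k) * N x (E x m) (E x m) (E x j) (E x k)
     + S x p (E x j) (E x k) * K x v (E x m) (E x m) (E x j) (E x k))
     + (\<Sum>m\<in>UNIV. \<Sum>j\<in>UNIV. \<Sum>k\<in>UNIV. S x (\<Gamma> x v p) (E x j) (E x k) * N x (E x m) (E x m) (E x j) (E x k)) = 0"
    by (simp only: sum.distrib)
  then show ?thesis by (simp only: div_zero[OF x] add_0_right)
qed


section \<open>Curvature in a frame and its relation to the torsion\<close>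

definition r :: "real ^ 7 \<Rightarrow> 7 \<Rightarrow> 7 \<Rightarrow> 7 \<Rightarrow> 7 \<Rightarrow> real" where
  "r x a b c d = metric.G x (metric.R x (E x a) (E x b) (E x c)) (E x d)"

lemma r_symmetries:
  assumes x: "x \<in> U"
  shows "r x b a c d = - r x a b c d" "r x a b d c = - r x a b c d" "r x a b c d + r x b c a d + r x c a b d = 0"
proof -
  show "r x b a c d = - r x a b c d"
    unfolding r_def metric.R_swap[of x "E x b"] by (rule linear_neg[OF metric.G_linear(1)])
  show "r x a b d c = - r x a b c d"
    using metric.R_skew[OF x, of "E x a" "E x b" "E x c" "E x d"] metric.G_sym[OF x, of "E x c"] by (simp add: r_def)
  show "r x a b c d + r x b c a d + r x c a b d = 0"
    using arg_cong[OF metric.bianchi[OF x, of "E x a" "E x b" "E x c"], of "\<lambda>w. metric.G x w (E x d)"]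
    by (simp add: r_def linear_add[OF metric.G_linear(1)] linear_0[OF metric.G_linear(1)])
qed

lemma ricci_matrix_eq:
  assumes x: "x \<in> U"
  shows "ricci_matrix g x $ j $ k = (\<Sum>m\<in>UNIV. metric.G x (metric.R x (E x m) (axis j 1) (axis k 1)) (E x m))"
  unfolding metric.ricci_matrix_eq_R by (rule metric.trace_frame[OF x frame_E[OF x] metric.R_linear(1)[OF x]])

lemma ricci_linear:
  assumes x: "x \<in> U"
  shows "linear (\<lambda>b. \<Sum>m\<in>UNIV. metric.G x (metric.R x (E x m) a b) (E x m))"
    "linear (\<lambda>a. \<Sum>m\<in>UNIV. metric.G x (metric.R x (E x m) a b) (E x m))"
  by (intro linear_sum_const linear_compose_real[OF metric.G_linear(1)] metric.R_linear x)+

definition scal :: "real ^ 7 \<Rightarrow> real" where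
  "scal x = (\<Sum>j\<in>UNIV. \<Sum>k\<in>UNIV. matrix_inv (g x) $ j $ k * ricci_matrix g x $ j $ k)"

lemma scal_eq_r:
  assumes x: "x \<in> U"
  shows "scal x = (\<Sum>i\<in>UNIV. \<Sum>m\<in>UNIV. r x m i i m)"
  unfolding scal_def ricci_matrix_eq[OF x] r_def
  by (rule metric.sum_P_frame[OF frame_E[OF x]]) (rule ricci_linear[OF x])+

lemma S_expand:
  assumes x: "x \<in> U"
  shows "S x w (E x b) (E x c) = (\<Sum>n\<in>UNIV. metric.G x w (E x n) * ph n b c)"
    "S x (E x a) w (E x c) = (\<Sum>n\<in>UNIV. metric.G x w (E x n) * ph a n c)"
    "S x (E x a) (E x b) w = (\<Sum>n\<in>UNIV. metric.G x w (E x n) * ph a b n)"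
  unfolding S_eq[OF x] G_eq[OF x] u_E[OF x] inner_axis
  by (simp_all add: linear_expand[OF linear_phi(1), of "u x w"] linear_expand[OF linear_phi(2), of _ "u x w"]
      linear_expand[OF linear_phi(3), of _ _ "u x w"])

lemma K_ricci_identity:
  assumes x: "x \<in> U"
  shows "K x (E x w) (E x v) (E x a) (E x b) (E x c) - K x (E x v) (E x w) (E x a) (E x b) (E x c)
    = - (\<Sum>n\<in>UNIV. r x w v a n * ph n b c) - (\<Sum>n\<in>UNIV. r x w v b n * ph a n c) - (\<Sum>n\<in>UNIV. r x w v c n * ph a b n)"
  unfolding metric.ricci_identity[OF S_trilinear x] S_expand[OF x] r_def ..

text \<open>The divergence is twice the torsion and \<open>psi_norm\<close> contributes 24 for each
  torsion vector, so 12 times the scalar curvature is 3 * 4 - 24 = -12 times the squared norm of the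
  torsion.\<close>

theorem scal_eq_torsion:
  assumes x: "x \<in> U"
  shows "scal x = - (\<Sum>l\<in>UNIV. \<tau> x l \<bullet> \<tau> x l)"
proof -
  let ?h = "\<lambda>l a b c. N x (E x l) (E x a) (E x b) (E x c)"
  let ?k = "\<lambda>w l a b c. K x (E x w) (E x l) (E x a) (E x b) (E x c)"
  have "12 * (\<Sum>i\<in>UNIV. \<Sum>m\<in>UNIV. r x m i i m) =
     3 * (\<Sum>j\<in>UNIV. \<Sum>k\<in>UNIV. (\<Sum>m\<in>UNIV. ?h m m j k)\<^sup>2)
     - (\<Sum>l\<in>UNIV. \<Sum>i\<in>UNIV. \<Sum>j\<in>UNIV. \<Sum>k\<in>UNIV. (?h l i j k)\<^sup>2)"
  proof (rule scalar_curvature_formula_index[where \<kappa> = ?k and r = "r x"])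
    show "(\<Sum>i\<in>UNIV. \<Sum>j\<in>UNIV. \<Sum>k\<in>UNIV. ?h v i j k * ?h l i j k + ph i j k * ?k v l i j k) = 0" for v l
      by (rule trace_identity[OF x])
    show "(\<Sum>m\<in>UNIV. \<Sum>j\<in>UNIV. \<Sum>k\<in>UNIV. ?h v p j k * ?h m m j k + ph p j k * ?k v m m j k) = 0" for v p
      using div_identity[OF x, of "E x v" "E x p"] unfolding S_E[OF x] .
  qed (rule K_closed[OF x], rule K_ricci_identity[OF x], (rule r_symmetries[OF x])+)
  also have "(\<Sum>j\<in>UNIV. \<Sum>k\<in>UNIV. (\<Sum>m\<in>UNIV. ?h m m j k)\<^sup>2) = 4 * (\<Sum>l\<in>UNIV. \<tau> x l \<bullet> \<tau> x l)"
    unfolding N_divergence[OF x] by (simp add: inner_vec_def power2_eq_square sum_distrib_left mult_ac)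
  also have "(\<Sum>l\<in>UNIV. \<Sum>i\<in>UNIV. \<Sum>j\<in>UNIV. \<Sum>k\<in>UNIV. (?h l i j k)\<^sup>2) = 24 * (\<Sum>l\<in>UNIV. \<tau> x l \<bullet> \<tau> x l)"
    unfolding N_E[OF x] psi_norm by (simp add: sum_distrib_left)
  finally show ?thesis by (simp add: scal_eq_r[OF x])
qed

corollary scal_nonpos: "x \<in> U \<Longrightarrow> scal x \<le> 0"
  by (simp add: scal_eq_torsion sum_nonneg)

lemma linear_eq_0_frame:
  assumes x: "x \<in> U" and "linear f" "\<And>i. f (E x i) = 0"
  shows "f v = (0 :: real)"
proof -
  have "f v = f (\<Sum>m\<in>UNIV. u x v $ m *\<^sub>R E x m)" using E_expand[OF x, of v] by simp
  then show ?thesis by (simp add: linear_sum[OF assms(2)] linear_cmul[OF assms(2)] assms(3))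
qed

lemma N_zero_iff_scal_zero:
  assumes x: "x \<in> U"
  shows "scal x = 0 \<longleftrightarrow> (\<forall>l. \<tau> x l = 0)" "scal x = 0 \<Longrightarrow> N x v a b c = 0"
proof -
  show e: "scal x = 0 \<longleftrightarrow> (\<forall>l. \<tau> x l = 0)"
    by (simp add: scal_eq_torsion[OF x] sum_nonneg_eq_0_iff)
  assume "scal x = 0"
  then have z: "\<tau> x l = 0" for l using e by simp
  have "psi [0, p, q, t] = 0" for p q t by (simp add: psi_eq)
  then have "N x (E x l) (E x i) (E x j) (E x k) = 0" for l i j k
    by (simp add: N_E[OF x] z)
  then have "N x (E x l) (E x i) (E x j) c = 0" for l i j
    by (rule linear_eq_0_frame[OF x N_linear(4)[OF x]])
  then have "N x (E x l) (E x i) b c = 0" for l i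
    by (rule linear_eq_0_frame[OF x N_linear(3)[OF x]])
  then have "N x (E x l) a b c = 0" for l
    by (rule linear_eq_0_frame[OF x N_linear(2)[OF x]])
  then show "N x v a b c = 0"
    by (rule linear_eq_0_frame[OF x N_linear(1)[OF x]])
qed

text \<open>The Ricci identity involves second derivatives of \<open>S\<close>, so \<open>N\<close>
  has to vanish around \<open>x\<close> and not only at \<open>x\<close>; hence the assumption on
  all of \<open>U\<close>. The curvature then annihilates \<open>phi\<close>, as
  \<open>ricci_flat_index\<close> demands.\<close>

theorem ricci_flat_if_scal_zero:
  assumes "\<And>y. y \<in> U \<Longrightarrow> scal y = 0" and x: "x \<in> U"
  shows "ricci_matrix g x $ j $ k = 0"
proof -
  have N0: "0 = N y v a b c" if "y \<in> U" for y v a b c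
    using N_zero_iff_scal_zero(2)[OF that assms(1)[OF that]] by simp
  have "frechet_derivative (\<lambda>y. 0) (at x) = frechet_derivative (\<lambda>y. N y v a b c) (at x)" for v a b c
    by (rule frechet_derivative_transform_within_open[OF differentiable_const open_U x N0])
  then have "dderiv (\<lambda>y. N y v a b c) x w = 0" for w v a b c
    by (metis frechet_derivative_const)
  then have "K x w v a b c = 0" for w v a b c
    by (simp add: metric.nabla2_def N0[OF x, symmetric])
  then have stab: "(\<Sum>n\<in>UNIV. r x w v a n * ph n b c) + (\<Sum>n\<in>UNIV. r x w v b n * ph a n c)
       + (\<Sum>n\<in>UNIV. r x w v c n * ph a b n) = 0" for w v a b c
    using K_ricci_identity[OF x, of w v a b c] by simp
  have "(\<Sum>m\<in>UNIV. metric.G x (metric.R x (E x m) (E x v) (E x k)) (E x m)) = 0" for v k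
    using ricci_flat_index[where r = "r x", OF stab r_symmetries[OF x]] unfolding r_def .
  then have "(\<Sum>m\<in>UNIV. metric.G x (metric.R x (E x m) (E x v) w) (E x m)) = 0" for v w
    by (rule linear_eq_0_frame[OF x ricci_linear(1)[OF x]])
  then have "(\<Sum>m\<in>UNIV. metric.G x (metric.R x (E x m) v w) (E x m)) = 0" for v w
    by (rule linear_eq_0_frame[OF x ricci_linear(2)[OF x]])
  then show ?thesis unfolding ricci_matrix_eq[OF x] .
qed

section \<open>The exterior derivative of psi\<close>

abbreviation "ext_deriv_Psi x a b c d e \<equiv> dderiv (\<lambda>y. Psi y b c d e) x a
    - dderiv (\<lambda>y. Psi y a c d e) x b + dderiv (\<lambda>y. Psi y a b d e) x c
    - dderiv (\<lambda>y. Psi y a b c e) x d + dderiv (\<lambda>y. Psi y a b c d) x e"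

lemma ext_deriv_Psi_eq:
  assumes x: "x \<in> U"
  shows "ext_deriv_Psi x a b c d e = nabla_Psi x a b c d e - nabla_Psi x b a c d e + nabla_Psi x c a b d e
     - nabla_Psi x d a b c e + nabla_Psi x e a b c d"
proof -
  note g = metric.Gamma_sym[OF x]
  note p = Psi_swap[of x]
  show ?thesis
    unfolding nabla_Psi_def g[of b a] g[of c a] g[of d a] g[of e a] g[of c b] g[of d b] g[of e b] g[of d c] g[of e c] g[of e d]
    using p(1)[of b "\<Gamma> x a c" d e] p(2)[of b c "\<Gamma> x a d" e] p(1)[of b "\<Gamma> x a d" c e]
      p(3)[of b c d "\<Gamma> x a e"] p(2)[of b c "\<Gamma> x a e" d] p(1)[of b "\<Gamma> x a e" c d]
      p(2)[of a c "\<Gamma> x b d" e] p(3)[of a c d "\<Gamma> x b e"] p(2)[of a c "\<Gamma> x b e" d] p(3)[of a b d "\<Gamma> x c e"]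
    by linarith
qed

lemma coclosed_if_scal_zero:
  assumes "scal x = 0" and x: "x \<in> U"
  shows "ext_deriv_Psi x a b c d e = 0"
proof -
  have "nabla_Psi x v a b c d = 0" for v a b c d
    unfolding nabla_Psi_eq[OF x] by (simp add: N_zero_iff_scal_zero(2)[OF x assms(1)])
  then show ?thesis by (simp add: ext_deriv_Psi_eq[OF x])
qed

text \<open>The arguments are specialised to frame vectors, where
  \<open>closed_torsion_coclosed\<close> applies to the components of the torsion.\<close>

lemma scal_zero_if_coclosed:
  assumes "\<And>a b c d e. ext_deriv_Psi x a b c d e = 0" and x: "x \<in> U"
  shows "scal x = 0"
proof -
  have n: "nabla_Psi x (E x l) (E x a) (E x b) (E x c) (E x d) =
     (\<Sum>i\<in>UNIV. psi [\<tau> x l, axis a 1, axis b 1, axis i 1] * phi [axis i 1, axis c 1, axis d 1]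
      + phi [axis a 1, axis b 1, axis i 1] * psi [\<tau> x l, axis i 1, axis c 1, axis d 1])" for l a b c d
    unfolding nabla_Psi_eq[OF x] N_E[OF x] S_E[OF x] ..
  have "\<tau> x l = 0" for l
    by (rule closed_torsion_coclosed[OF \<tau>_closed[OF x]], unfold n[symmetric] ext_deriv_Psi_eq[OF x, symmetric], rule assms(1))
  then show ?thesis by (simp add: N_zero_iff_scal_zero(1)[OF x])
qed

end

subsection \<open>Charts of a manifold\<close>

locale manifold_chart =
  fixes M :: "'a topology" and A :: "('a, 'n::finite) chart set" and c :: "('a, 'n) chart"
  assumes manifold: "smooth_manifold M A" and chart: "c \<in> A"
begin

lemma is_chart_A: "d \<in> A \<Longrightarrow> is_chart M d"
  using manifold by (simp add: smooth_manifold_def)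

lemma fst_subset: "d \<in> A \<Longrightarrow> fst d \<subseteq> topspace M"
  using is_chart_A[of d] by (simp add: is_chart_def openin_subset)

lemma inj_chart: "d \<in> A \<Longrightarrow> inj_on (snd d) (fst d)"
  using is_chart_A[of d] fst_subset[of d]
  by (auto simp: is_chart_def dest!: homeomorphic_imp_injective_map simp: Int_absorb1)

lemma open_image: "d \<in> A \<Longrightarrow> open (chart_image d)"
  using is_chart_A by (simp add: is_chart_def)

lemma chart_inv_chart: "d \<in> A \<Longrightarrow> p \<in> fst d \<Longrightarrow> chart_inv d (snd d p) = p"
  by (simp add: chart_inv_def inj_chart)

lemma chart_chart_inv: "x \<in> chart_image d \<Longrightarrow> snd d (chart_inv d x) = x"
  by (auto simp: chart_inv_def chart_image_def f_inv_into_f)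

lemma chart_inv_in: "x \<in> chart_image d \<Longrightarrow> chart_inv d x \<in> fst d"
  by (auto simp: chart_inv_def chart_image_def inv_into_into)

lemma chart_inv_charts_at: "x \<in> chart_image c \<Longrightarrow> c \<in> charts_at A (chart_inv c x)"
  by (simp add: charts_at_def chart chart_inv_in)

lemma chart_inv_topspace: "x \<in> chart_image c \<Longrightarrow> chart_inv c x \<in> topspace M"
  using chart_inv_in fst_subset[OF chart] by blast

lemma open_overlap:
  assumes "d \<in> A" "e \<in> A"
  shows "open (snd d ` (fst d \<inter> fst e))"
proof -
  have d: "homeomorphic_map (subtopology M (fst d)) (top_of_set (chart_image d)) (snd d)"
    and e: "openin M (fst e)" and "open (chart_image d)"
    using assms is_chart_A by (auto simp: is_chart_def)
  have "openin (subtopology M (fst d)) (fst d \<inter> fst e)"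
    using e by (metis inf_commute openin_subtopology_Int)
  then have "openin (top_of_set (chart_image d)) (snd d ` (fst d \<inter> fst e))"
    using d homeomorphic_imp_open_map open_map_def by blast
  then show ?thesis using \<open>open (chart_image d)\<close> openin_open_trans by blast
qed

lemma transition_differentiable:
  assumes "d \<in> charts_at A p" "e \<in> charts_at A p"
  shows "(snd e \<circ> chart_inv d) differentiable (at (snd d p))"
proof -
  have "Ck_on (Suc 0) (snd d ` (fst d \<inter> fst e)) (snd e \<circ> chart_inv d)"
    using manifold assms unfolding smooth_manifold_def smooth_on_def charts_at_def by blast
  then show ?thesis
    by (rule Ck_on_Suc_differentiable) (use assms in \<open>auto simp: charts_at_def\<close>)
qed

text \<open>The chain rule on the overlap of two charts. This cocycle property makes
  \<open>chart_tvec\<close> satisfy the compatibility that defines tangent vectors.\<close>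

lemma transition_compose:
  assumes c: "c \<in> charts_at A p" and d: "d \<in> charts_at A p" and e: "e \<in> charts_at A p"
  shows "dderiv (snd e \<circ> chart_inv c) (snd c p) v =
    dderiv (snd e \<circ> chart_inv d) (snd d p) (dderiv (snd d \<circ> chart_inv c) (snd c p) v)"
proof -
  let ?S = "snd c ` (fst c \<inter> fst d)"
  have A: "c \<in> A" "d \<in> A" "e \<in> A" and p: "p \<in> fst c" "p \<in> fst d" using assms by (auto simp: charts_at_def)
  have dp: "(snd d \<circ> chart_inv c) (snd c p) = snd d p" by (simp add: chart_inv_chart A p)
  have 1: "(snd d \<circ> chart_inv c) differentiable (at (snd c p))" by (rule transition_differentiable[OF c d])
  have 2: "(snd e \<circ> chart_inv d) differentiable (at ((snd d \<circ> chart_inv c) (snd c p)))"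
    unfolding dp by (rule transition_differentiable[OF d e])
  have "frechet_derivative ((snd e \<circ> chart_inv d) \<circ> (snd d \<circ> chart_inv c)) (at (snd c p)) =
     frechet_derivative (snd e \<circ> chart_inv c) (at (snd c p))"
  proof (rule frechet_derivative_transform_within_open[OF _ open_overlap[OF A(1,2)]])
    show "(snd e \<circ> chart_inv d \<circ> (snd d \<circ> chart_inv c)) differentiable (at (snd c p))"
      by (rule differentiable_chain_at[OF 1 2])
    show "snd c p \<in> ?S" using p by auto
    show "(snd e \<circ> chart_inv d \<circ> (snd d \<circ> chart_inv c)) y = (snd e \<circ> chart_inv c) y" if "y \<in> ?S" for y
      using that A by (auto simp: chart_inv_chart)
  qed
  then show ?thesis
    using frechet_derivative_compose[OF 1 2] unfolding dp by (metis comp_apply)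
qed

lemma chart_tvec_self:
  assumes "c \<in> charts_at A p"
  shows "chart_tvec A c p v c = v"
proof -
  have p: "p \<in> fst c" using assms by (simp add: charts_at_def)
  have "frechet_derivative (\<lambda>x. x) (at (snd c p)) = frechet_derivative (snd c \<circ> chart_inv c) (at (snd c p))"
    by (rule frechet_derivative_transform_within_open[OF differentiable_ident open_image[OF chart]])
      (use p in \<open>auto simp: chart_image_def chart_chart_inv[unfolded chart_image_def]\<close>)
  then have "frechet_derivative (snd c \<circ> chart_inv c) (at (snd c p)) = (\<lambda>x. x)"
    by (simp only: frechet_derivative_ident)
  then show ?thesis using assms by (simp add: chart_tvec_def)
qed

lemma chart_tvec_in:
  assumes "c \<in> charts_at A p"
  shows "chart_tvec A c p v \<in> tangent_space A p"
  unfolding tangent_space_def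
proof (intro CollectI conjI ballI allI impI)
  fix d e assume "d \<in> charts_at A p" "e \<in> charts_at A p"
  then show "chart_tvec A c p v e = dderiv (snd e \<circ> chart_inv d) (snd d p) (chart_tvec A c p v d)"
    unfolding chart_tvec_def by (simp only: if_True) (rule transition_compose[OF assms])
qed (simp add: chart_tvec_def)

lemma chart_tvec_surj:
  assumes "c \<in> charts_at A p" "X \<in> tangent_space A p"
  shows "chart_tvec A c p (X c) = X"
proof
  fix d
  show "chart_tvec A c p (X c) d = X d"
  proof (cases "d \<in> charts_at A p")
    case True
    then have "X d = dderiv (snd d \<circ> chart_inv c) (snd c p) (X c)"
      using assms unfolding tangent_space_def by blast
    with True show ?thesis by (simp only: chart_tvec_def if_True)
  next
    case False
    then have "X d = 0" using assms(2) unfolding tangent_space_def by blast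
    with False show ?thesis by (simp only: chart_tvec_def if_False)
  qed
qed

lemma chart_tvec_linear:
  assumes "c \<in> charts_at A p"
  shows "chart_tvec A c p (v + w) = (\<lambda>d. chart_tvec A c p v d + chart_tvec A c p w d)"
    "chart_tvec A c p (a *\<^sub>R v) = (\<lambda>d. a *\<^sub>R chart_tvec A c p v d)"
  using transition_differentiable[OF assms]
  by (auto simp: chart_tvec_def fun_eq_iff frechet_derivative_linear_dir)

lemma chart_tvec_bij:
  assumes "c \<in> charts_at A p"
  shows "bij_betw (chart_tvec A c p) UNIV (tangent_space A p)"
  by (rule bij_betw_byWitness[where f' = "\<lambda>X. X c"])
    (auto simp: chart_tvec_self[OF assms] chart_tvec_surj[OF assms] chart_tvec_in[OF assms])

end

text \<open>A form is specified only on lists of the right length, so agreement can be asked for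
  only there.\<close>

lemma hodge_std_cong:
  assumes "\<And>vs. length vs = k \<Longrightarrow> \<alpha> vs = \<beta> vs"
  shows "hodge_std k \<alpha> vs = hodge_std k \<beta> vs"
  unfolding hodge_std_def by (intro arg_cong2[where f = "(/)"] sum.cong refl) (simp add: assms)

locale closed_g2_chart = manifold_chart M A c
  for M :: "'a topology" and A :: "('a, 7) chart set" and c :: "('a, 7) chart" +
  fixes \<sigma> :: "('a, 7) form"
  assumes g2: "g2_structure M A \<sigma>" and closed_\<sigma>: "closed_form A 3 \<sigma>"
begin

abbreviation "fr \<equiv> some_g2_frame A \<sigma>"

lemma g2_frame_fr: "p \<in> topspace M \<Longrightarrow> g2_frame A \<sigma> p (fr p)"
  using g2 unfolding g2_structure_def some_g2_frame_def by (metis someI_ex)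

definition local_frame :: "real ^ 7 \<Rightarrow> real ^ 7 \<Rightarrow> real ^ 7" where
  "local_frame x v = fr (chart_inv c x) (chart_tvec A c (chart_inv c x) v)"

lemma local_frame_linear:
  assumes "x \<in> chart_image c" shows "linear (local_frame x)"
proof -
  note C = chart_inv_charts_at[OF assms]
  have "tangent_iso A (chart_inv c x) (fr (chart_inv c x))"
    using g2_frame_fr[OF chart_inv_topspace[OF assms]] by (simp add: g2_frame_def)
  then show ?thesis
    by (intro linearI) (simp_all add: local_frame_def tangent_iso_def chart_tvec_linear[OF C] chart_tvec_in[OF C])
qed

lemma local_frame_bij:
  assumes "x \<in> chart_image c" shows "bij (local_frame x)"
proof -
  note C = chart_inv_charts_at[OF assms]
  have "tangent_iso A (chart_inv c x) (fr (chart_inv c x))"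
    using g2_frame_fr[OF chart_inv_topspace[OF assms]] by (simp add: g2_frame_def)
  then have "bij_betw (fr (chart_inv c x) \<circ> chart_tvec A c (chart_inv c x)) UNIV UNIV"
    by (intro bij_betw_trans[OF chart_tvec_bij[OF C]]) (simp add: tangent_iso_def)
  then show ?thesis by (simp add: local_frame_def[abs_def] comp_def)
qed

lemma local_form_\<sigma>:
  assumes "x \<in> chart_image c"
  shows "local_form A c \<sigma> x [a, b, d] = phi [local_frame x a, local_frame x b, local_frame x d]"
  using g2_frame_fr[OF chart_inv_topspace[OF assms]] chart_tvec_in[OF chart_inv_charts_at[OF assms]]
  by (simp add: local_form_def g2_frame_def local_frame_def)

text \<open>Composing the chosen frame with the chart's identification of tangent vectors carries
  the definitions on the manifold over to the coordinate setting.\<close>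

sublocale closed_g2_domain "chart_image c" "local_form A c \<sigma>" "metric_matrix A c (g2_metric A \<sigma>)" local_frame
proof
  show "open (chart_image c)" by (rule open_image[OF chart])
  show "Ck_on k (chart_image c) (\<lambda>x. local_form A c \<sigma> x [a, b, d])" for k a b d
  proof -
    have "\<forall>vs. length vs = 3 \<longrightarrow> smooth_on (chart_image c) (\<lambda>x. local_form A c \<sigma> x vs)"
      using g2 chart by (simp add: g2_structure_def smooth_form_def)
    from spec[OF this, of "[a, b, d]"] show ?thesis by (simp add: smooth_on_def)
  qed
  show "metric_matrix A c (g2_metric A \<sigma>) x $ i $ j = local_frame x (axis i 1) \<bullet> local_frame x (axis j 1)" for x i j
    by (simp add: metric_matrix_def g2_metric_def local_frame_def)
  show "dderiv (\<lambda>y. local_form A c \<sigma> y [b, d, e]) x a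
     - dderiv (\<lambda>y. local_form A c \<sigma> y [a, d, e]) x b
     + dderiv (\<lambda>y. local_form A c \<sigma> y [a, b, e]) x d
     - dderiv (\<lambda>y. local_form A c \<sigma> y [a, b, d]) x e = 0"
    if "x \<in> chart_image c" for x a b d e
  proof -
    have "ext_deriv (local_form A c \<sigma>) x [a, b, d, e] = 0"
      using closed_\<sigma> chart that by (simp add: closed_form_def)
    then show ?thesis by (simp add: ext_deriv_def eval_nat_numeral)
  qed
qed (simp_all add: linear_add[OF local_frame_linear] linear_cmul[OF local_frame_linear] local_frame_bij local_form_\<sigma>)

text \<open>In the chosen frame \<sigma> becomes \<open>phi\<close>, so its Hodge star is
  \<open>psi\<close> on the frame images by \<open>hodge_phi\<close>. This identifies it with
  \<open>Psi\<close>, which is known to be smooth.\<close>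

lemma local_form_hodge:
  assumes "x \<in> chart_image c"
  shows "local_form A c (hodge A \<sigma> 3 \<sigma>) x [a, b, d, e] = Psi x a b d e"
proof -
  let ?p = "chart_inv c x"
  have fr: "g2_frame A \<sigma> ?p (fr ?p)" by (rule g2_frame_fr[OF chart_inv_topspace[OF assms]])
  then have bij: "bij_betw (fr ?p) (tangent_space A ?p) UNIV" by (simp add: g2_frame_def tangent_iso_def)
  have "\<sigma> ?p (map (inv_into (tangent_space A ?p) (fr ?p)) vs) = phi vs" if "length vs = 3" for vs
  proof -
    have im: "fr ?p ` tangent_space A ?p = UNIV" using bij by (simp add: bij_betw_def)
    have "set (map (inv_into (tangent_space A ?p) (fr ?p)) vs) \<subseteq> tangent_space A ?p"
      using im by (auto intro!: inv_into_into)
    then have "\<sigma> ?p (map (inv_into (tangent_space A ?p) (fr ?p)) vs) =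
        phi (map (fr ?p) (map (inv_into (tangent_space A ?p) (fr ?p)) vs))"
      using fr that by (simp add: g2_frame_def)
    also have "map (fr ?p) (map (inv_into (tangent_space A ?p) (fr ?p)) vs) = vs"
      using im by (simp add: map_idI f_inv_into_f)
    finally show ?thesis .
  qed
  then have "local_form A c (hodge A \<sigma> 3 \<sigma>) x [a, b, d, e] =
      hodge_std 3 phi (map (fr ?p) (map (chart_tvec A c ?p) [a, b, d, e]))"
    unfolding local_form_def hodge_def by (rule hodge_std_cong)
  then show ?thesis by (simp add: hodge_phi Psi_def local_frame_def)
qed

lemma ext_deriv_hodge:
  assumes x: "x \<in> chart_image c"
  shows "ext_deriv (local_form A c (hodge A \<sigma> 3 \<sigma>)) x [v0, v1, v2, v3, v4] = ext_deriv_Psi x v0 v1 v2 v3 v4"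
proof -
  have "frechet_derivative (\<lambda>y. local_form A c (hodge A \<sigma> 3 \<sigma>) y [a, b, d, e]) (at x)
     = frechet_derivative (\<lambda>y. Psi y a b d e) (at x)" for a b d e
    by (rule frechet_derivative_transform_within_open[OF Psi_diff[OF x] open_U x, symmetric])
      (simp add: local_form_hodge)
  then show ?thesis by (simp add: ext_deriv_def eval_nat_numeral)
qed

lemma scalar_curvature_eq:
  "scalar_curvature A c (g2_metric A \<sigma>) p = scal (snd c p)"
  by (simp add: scalar_curvature_def scal_def)

end

lemma sum_axis: "(\<Sum>b\<in>UNIV. f b * axis k (1 :: real) $ b) = f k"
  by (simp add: axis_def if_distrib cong: if_cong)

theorem corollary1:
  fixes M :: "'a topology" and A :: "('a, 7) chart set" and \<sigma> :: "('a, 7) form"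
  assumes "smooth_manifold M A"
    and "g2_structure M A \<sigma>"
    and "closed_form A 3 \<sigma>"
  shows "(\<forall>p\<in>topspace M. \<forall>c\<in>charts_at A p. scalar_curvature A c (g2_metric A \<sigma>) p \<le> 0) \<and>
    ((\<forall>p\<in>topspace M. \<forall>c\<in>charts_at A p. scalar_curvature A c (g2_metric A \<sigma>) p = 0) \<longleftrightarrow>
     (\<forall>p\<in>topspace M. \<forall>c\<in>charts_at A p. \<forall>X\<in>tangent_space A p. \<forall>Y\<in>tangent_space A p.
        ricci A c (g2_metric A \<sigma>) p X Y = 0)) \<and>
    ((\<forall>p\<in>topspace M. \<forall>c\<in>charts_at A p. scalar_curvature A c (g2_metric A \<sigma>) p = 0) \<longleftrightarrow>
     closed_form A 3 \<sigma> \<and> closed_form A 4 (hodge A \<sigma> 3 \<sigma>))"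
    (is "?nonpos \<and> (?flat \<longleftrightarrow> ?ricci_flat) \<and> (?flat \<longleftrightarrow> _ \<and> ?coclosed)")
proof (intro conjI)
  have L: "closed_g2_chart M A c \<sigma>" if "c \<in> A" for c
    by unfold_locales (use assms that in auto)
  have at: "c \<in> A" "snd c p \<in> chart_image c" if "c \<in> charts_at A p" for c p
    using that by (auto simp: charts_at_def chart_image_def)
  show ?nonpos
  proof (intro ballI)
    fix p c assume c: "c \<in> charts_at A p"
    interpret closed_g2_chart M A c \<sigma> by (rule L[OF at(1)[OF c]])
    show "scalar_curvature A c (g2_metric A \<sigma>) p \<le> 0"
      unfolding scalar_curvature_eq by (rule scal_nonpos[OF at(2)[OF c]])
  qed
  \<comment> \<open>The vanishing is recorded on the whole image of the chart, since the Ricci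
    argument at a point differentiates around it.\<close>
  have scal0: "closed_g2_domain.scal (metric_matrix A c (g2_metric A \<sigma>)) x = 0"
    if flat: ?flat and c: "c \<in> A" and x: "x \<in> chart_image c" for c x
  proof -
    interpret closed_g2_chart M A c \<sigma> by (rule L[OF c])
    have "scalar_curvature A c (g2_metric A \<sigma>) (chart_inv c x) = 0"
      using flat chart_inv_topspace[OF x] chart_inv_charts_at[OF x] by blast
    then show ?thesis by (simp add: scalar_curvature_eq chart_chart_inv[OF x])
  qed
  show "?flat \<longleftrightarrow> ?ricci_flat"
  proof
    assume flat: ?flat
    show ?ricci_flat
    proof (intro ballI)
      fix p c X Y assume c: "c \<in> charts_at A p"
      interpret closed_g2_chart M A c \<sigma> by (rule L[OF at(1)[OF c]])
      have "ricci_matrix (metric_matrix A c (g2_metric A \<sigma>)) (snd c p) $ j $ k = 0" for j k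
        by (rule ricci_flat_if_scal_zero[OF scal0[OF flat at(1)[OF c]] at(2)[OF c]])
      then show "ricci A c (g2_metric A \<sigma>) p X Y = 0" by (simp add: ricci_def)
    qed
  next
    assume ric: ?ricci_flat
    show ?flat
    proof (intro ballI)
      fix p c assume p: "p \<in> topspace M" and c: "c \<in> charts_at A p"
      interpret closed_g2_chart M A c \<sigma> by (rule L[OF at(1)[OF c]])
      have "ricci_matrix (metric_matrix A c (g2_metric A \<sigma>)) (snd c p) $ j $ k = 0" for j k
      proof -
        \<comment> \<open>Coordinate basis vectors isolate the entries of the Ricci matrix, whose
          trace is the scalar curvature.\<close>
        have "ricci A c (g2_metric A \<sigma>) p (chart_tvec A c p (axis j 1)) (chart_tvec A c p (axis k 1)) = 0"
          using ric p c chart_tvec_in[OF c] by blast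
        then have "(\<Sum>a\<in>UNIV. \<Sum>b\<in>UNIV. ricci_matrix (metric_matrix A c (g2_metric A \<sigma>)) (snd c p) $ a $ b
            * axis j 1 $ a * axis k 1 $ b) = 0"
          by (simp add: ricci_def chart_tvec_self[OF c])
        then show ?thesis by (simp only: sum_axis)
      qed
      then show "scalar_curvature A c (g2_metric A \<sigma>) p = 0" by (simp add: scalar_curvature_def)
    qed
  qed
  show "?flat \<longleftrightarrow> closed_form A 3 \<sigma> \<and> ?coclosed"
  proof
    assume flat: ?flat
    have ?coclosed
      unfolding closed_form_def
    proof (intro ballI allI impI)
      fix c x and vs :: "(real ^ 7) list" assume c: "c \<in> A" and x: "x \<in> chart_image c" and "length vs = Suc 4"
      interpret closed_g2_chart M A c \<sigma> by (rule L[OF c])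
      from \<open>length vs = Suc 4\<close> obtain v0 v1 v2 v3 v4 where "vs = [v0, v1, v2, v3, v4]"
        by (auto simp: eval_nat_numeral length_Suc_conv)
      then show "ext_deriv (local_form A c (hodge A \<sigma> 3 \<sigma>)) x vs = 0"
        using coclosed_if_scal_zero[OF scal0[OF flat c x] x] by (simp only: ext_deriv_hodge[OF x])
    qed
    with assms(3) show "closed_form A 3 \<sigma> \<and> ?coclosed" ..
  next
    assume "closed_form A 3 \<sigma> \<and> ?coclosed"
    then have coclosed: ?coclosed ..
    show ?flat
    proof (intro ballI)
      fix p c assume c: "c \<in> charts_at A p"
      interpret closed_g2_chart M A c \<sigma> by (rule L[OF at(1)[OF c]])
      note x = at(2)[OF c]
      have "ext_deriv_Psi (snd c p) v0 v1 v2 v3 v4 = 0" for v0 v1 v2 v3 v4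
      proof -
        have "ext_deriv (local_form A c (hodge A \<sigma> 3 \<sigma>)) (snd c p) [v0, v1, v2, v3, v4] = 0"
          using coclosed x chart by (simp add: closed_form_def)
        then show ?thesis by (simp only: ext_deriv_hodge[OF x])
      qed
      then show "scalar_curvature A c (g2_metric A \<sigma>) p = 0"
        unfolding scalar_curvature_eq by (rule scal_zero_if_coclosed[OF _ x])
    qed
  qed
qed

end
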